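(* For $z_0=\alpha+i\beta\in\mathbb H$, $m\in\mathbb Z_{\ge0}$, $n\in\mathbb Z_{\ge1}$ and any orthonormal basis $\mathcal F$ of $S_k(\Gamma)$, $$\sum_{f\in\mathcal F}c_{z_0}(f,m)\overline{c_\infty(f,n)}=\frac{-(2i)^{k/2}\beta^{m+k/2}}{(k-2)!}\sum_{j=0}^m\binom{m+k-1}{m-j}\frac{(-4\pi n)^{k+j-1}}{j!}F_{k+2m}(z_0,n,k/2+j).$$
   Context: $\Gamma\subset\mathrm{SL}(2,\mathbb R)$ is discrete, finitely generated, of finite covolume, with a cusp of width $1$ at $\infty$ and $\Gamma_\infty=\{\pm\begin{pmatrix}1&n\\0&1\end{pmatrix}:n\in\mathbb Z\}$; $k\ge4$ even; $j(\gamma,z)=cz+d$. $S_k(\Gamma)$ is the space of weight $k$ cusp forms with Petersson inner product $\langle f,g\rangle=\int_{\Gamma\backslash\mathbb H}f\overline g\,y^k\frac{dx\,dy}{y^2}$. For $f\in S_k(\Gamma)$: $f(z)=\sum_{n\ge1}c_\infty(f,n)e^{2\pi inz}$; with $\sigma_{z_0}=\frac1{2i\beta}\begin{pmatrix}-\overline{z_0}&z_0\\-1&1\end{pmatrix}$ and $(f|_k\gamma)(z)=\det(\gamma)^{k/2}f(\gamma z)j(\gamma,z)^{-k}$, the $c_{z_0}(f,m)$ are defined by $(f|_k\sigma_{z_0})(w)=\sum_{m\ge0}c_{z_0}(f,m)w^m$, $|w|<1$. $F_k(z,n,s)=\sum_{\gamma\in\Gamma_\infty\backslash\Gamma}\mathrm{Im}(\gamma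 z)^{s-k/2}j(\gamma,z)^{-k}e^{2\pi in\gamma z}$. *)

theory Defs
  imports "HOL-Complex_Analysis.Complex_Analysis" "HOL-Algebra.Generated_Groups"
begin

section \<open>Fuchsian groups and their action\<close>

definition mat2 :: "'a::zero \<Rightarrow> 'a \<Rightarrow> 'a \<Rightarrow> 'a \<Rightarrow> 'a^2^2" where
  "mat2 a b c d = vector [vector [a, b], vector [c, d]]"

definition SL2R :: "(real^2^2) monoid" where
  "SL2R = \<lparr>carrier = {A. det A = 1}, mult = (**), one = mat 1\<rparr>"

abbreviation cmat :: "real^2^2 \<Rightarrow> complex^2^2" where
  "cmat \<equiv> map_matrix complex_of_real"

definition upper_half_plane :: "complex set" where
  "upper_half_plane = {z. 0 < Im z}"

text \<open>
  Complex matrices are allowed because the slash operator is also used with the matrix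
  that maps the unit disc to the upper half plane.
\<close>

definition act :: "complex^2^2 \<Rightarrow> complex \<Rightarrow> complex" where
  "act A = moebius (A$1$1) (A$1$2) (A$2$1) (A$2$2)"

definition jfac :: "complex^2^2 \<Rightarrow> complex \<Rightarrow> complex" where
  "jfac A z = A$2$1 * z + A$2$2"

text \<open>The weights are even, so \<open>k div 2\<close> is \<open>k/2\<close> and no root of the determinant has to be chosen.\<close>

definition slash :: "nat \<Rightarrow> complex^2^2 \<Rightarrow> (complex \<Rightarrow> complex) \<Rightarrow> complex \<Rightarrow> complex" where
  "slash k A f z = det A ^ (k div 2) * f (act A z) / jfac A z ^ k"

definition stab_infinity :: "(real^2^2) set \<Rightarrow> (real^2^2) set" where
  "stab_infinity \<Gamma> = {\<gamma> \<in> \<Gamma>. \<gamma>$2$1 = 0}"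

definition finitely_generated :: "(real^2^2) set \<Rightarrow> bool" where
  "finitely_generated \<Gamma> \<longleftrightarrow> (\<exists>S. finite S \<and> S \<subseteq> \<Gamma> \<and> generate SL2R S = \<Gamma>)"

definition hyp_measure :: "complex measure" where
  "hyp_measure = density lborel (\<lambda>z. indicator upper_half_plane z * ennreal (1 / (Im z)\<^sup>2))"

text \<open>
  Integrals over \<open>\<Gamma>\<backslash>\<H>\<close> are taken over a measurable fundamental domain; the integral
  of a \<open>\<Gamma>\<close>-invariant function does not depend on which one is used.
\<close>

definition fundamental_domain :: "(real^2^2) set \<Rightarrow> complex set \<Rightarrow> bool" where
  "fundamental_domain \<Gamma> D \<longleftrightarrow>
     D \<in> sets borel \<and> D \<subseteq> upper_half_plane \<and>
     (\<forall>z\<in>upper_half_plane. \<exists>\<gamma>\<in>\<Gamma>. act (cmat \<gamma>) z \<in> D) \<and>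
     (\<forall>\<gamma>\<in>\<Gamma>. \<gamma> \<noteq> mat 1 \<and> \<gamma> \<noteq> - mat 1 \<longrightarrow>
        emeasure hyp_measure (D \<inter> act (cmat \<gamma>) ` D) = 0)"

section \<open>Cusp forms\<close>

text \<open>
  If \<open>\<tau>\<close> in \<open>SL(2,\<real>)\<close> and \<open>h > 0\<close> are such that \<open>\<tau> (1 h; 0 1) \<tau>\<^sup>-\<^sup>1\<close> lies in \<open>\<Gamma>\<close>, then
  \<open>\<tau>\<infinity>\<close> is a cusp, and every cusp arises in this way when \<open>-1 \<in> \<Gamma>\<close>. The number \<open>h\<close> may
  be a proper multiple of the width, which merely spreads out the expansion.
\<close>

definition vanishes_at_cusps :: "(real^2^2) set \<Rightarrow> nat \<Rightarrow> (complex \<Rightarrow> complex) \<Rightarrow> bool" where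
  "vanishes_at_cusps \<Gamma> k f \<longleftrightarrow>
     (\<forall>\<tau> h. det \<tau> = 1 \<and> h > 0 \<and> \<tau> ** mat2 1 h 0 1 ** matrix_inv \<tau> \<in> \<Gamma> \<longrightarrow>
        (\<exists>a :: nat \<Rightarrow> complex. a 0 = 0 \<and>
           (\<forall>z\<in>upper_half_plane.
              (\<lambda>n. a n * exp (2 * pi * \<i> * n * z / h)) sums slash k (cmat \<tau>) f z)))"

text \<open>
  Forms are extended by \<open>0\<close> outside the upper half plane, so that equal forms are equal
  HOL functions.
\<close>

definition cusp_forms :: "(real^2^2) set \<Rightarrow> nat \<Rightarrow> (complex \<Rightarrow> complex) set" where
  "cusp_forms \<Gamma> k =
     {f. f holomorphic_on upper_half_plane \<and>
         (\<forall>z. z \<notin> upper_half_plane \<longrightarrow> f z = 0) \<and>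
         (\<forall>\<gamma>\<in>\<Gamma>. \<forall>z\<in>upper_half_plane. slash k (cmat \<gamma>) f z = f z) \<and>
         vanishes_at_cusps \<Gamma> k f}"

definition petersson ::
  "complex set \<Rightarrow> nat \<Rightarrow> (complex \<Rightarrow> complex) \<Rightarrow> (complex \<Rightarrow> complex) \<Rightarrow> complex" where
  "petersson D k f g = (LINT z:D|hyp_measure. f z * cnj (g z) * of_real (Im z ^ k))"

text \<open>\<open>S\<^sub>k(\<Gamma>)\<close> is finite-dimensional, so its bases are finite sets.\<close>

definition orthonormal_basis ::
  "(real^2^2) set \<Rightarrow> complex set \<Rightarrow> nat \<Rightarrow> (complex \<Rightarrow> complex) set \<Rightarrow> bool" where
  "orthonormal_basis \<Gamma> D k F \<longleftrightarrow>
     finite F \<and> F \<subseteq> cusp_forms \<Gamma> k \<and>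
     (\<forall>f\<in>F. \<forall>g\<in>F. petersson D k f g = (if f = g then 1 else 0)) \<and>
     (\<forall>g\<in>cusp_forms \<Gamma> k. \<exists>a. g = (\<lambda>z. \<Sum>f\<in>F. a f * f z))"

section \<open>Expansion coefficients and Poincare series\<close>

text \<open>Both coefficient sequences are unique whenever they exist, as they do for cusp forms.\<close>

definition coeff_infinity :: "(complex \<Rightarrow> complex) \<Rightarrow> nat \<Rightarrow> complex" where
  "coeff_infinity f =
     (THE c. c 0 = 0 \<and>
        (\<forall>z\<in>upper_half_plane. (\<lambda>n. c n * exp (2 * pi * \<i> * n * z)) sums f z))"

definition disc_to_plane :: "complex \<Rightarrow> complex^2^2" where
  "disc_to_plane z0 =
     map_matrix (\<lambda>x. 1 / (2 * \<i> * Im z0) * x) (mat2 (- cnj z0) z0 (-1) 1)"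

definition coeff_at :: "nat \<Rightarrow> complex \<Rightarrow> (complex \<Rightarrow> complex) \<Rightarrow> nat \<Rightarrow> complex" where
  "coeff_at k z0 f =
     (THE c. \<forall>w\<in>ball 0 1. (\<lambda>m. c m * w ^ m) sums slash k (disc_to_plane z0) f w)"

text \<open>
  The sum runs over the right cosets \<open>\<Gamma>\<^sub>\<infinity>\<gamma>\<close>. For even \<open>k\<close>, and with \<open>\<Gamma>\<^sub>\<infinity>\<close> generated by
  \<open>-1\<close> and \<open>(1 1; 0 1)\<close>, the summand depends only on the coset of the representative.
\<close>

definition poincare_F :: "(real^2^2) set \<Rightarrow> nat \<Rightarrow> complex \<Rightarrow> nat \<Rightarrow> complex \<Rightarrow> complex" where
  "poincare_F \<Gamma> k z n s =
     (\<Sum>\<^sub>\<infinity>C \<in> rcosets\<^bsub>SL2R\<lparr>carrier := \<Gamma>\<rparr>\<^esub> (stab_infinity \<Gamma>).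
        let \<gamma> = cmat (SOME \<gamma>. \<gamma> \<in> C); w = act \<gamma> z
        in of_real (Im w) powr (s - of_nat k / 2) / jfac \<gamma> z ^ k * exp (2 * pi * \<i> * n * w))"

end

theory Submission
  imports Defs "HOL-Probability.Distributions"
begin

text \<open>
  Up to a factor, the left-hand side is the \<open>m\<close>-th coefficient at \<open>z\<^sub>0\<close> of the Poincare series
  \<open>P(z) = \<Sum> j(\<gamma>,z)\<^sup>-\<^sup>k e(n\<gamma>z)\<close>: unfolding gives \<open>\<langle>P, f\<rangle> = cnj c\<^sub>\<infinity>(f,n) (k-2)!/(4\<pi>n)\<^sup>k\<^sup>-\<^sup>1\<close>,
  so \<open>P\<close> is a multiple of \<open>\<Sum> cnj c\<^sub>\<infinity>(f,n) f\<close>. Pulling each term of \<open>P\<close> back to the unit disc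
  yields the generating function \<open>(1-v)\<^sup>-\<^sup>k exp(-xv/(1-v))\<close> of the Laguerre polynomials, whose
  coefficients are the inner sums on the right-hand side.

  No geometry of the fundamental domain is needed. By Shimizu's lemma the bottom rows of
  inequivalent elements of \<open>\<Gamma>\<close> have pairwise determinant at least 1 in absolute value, and packing
  disjoint rectangles bounds \<open>\<Sum> Im(\<gamma>z)\<^sup>2\<close> over the terms with \<open>Im(\<gamma>z) \<le> 1\<close> uniformly in \<open>z\<close>;
  at most one term exceeds 1. This gives convergence and, since the basis elements are square
  integrable and the covolume is finite, the integrability needed for unfolding.
\<close>

text \<open>Three points shape the argument. (1) The growth of cusp forms is never estimated: a
  basis element has norm 1 and a non-integrable function has Bochner integral 0, so normalization
  alone gives square integrability. Unfolding then needs a bound, uniform in z, for the sum over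
  cosets of Im(gamma z)^(k/2) exp(-2 pi n Im(gamma z)). As k/2 >= 2, the small terms are bounded by
  Im(gamma z)^2, and the exponential caps the one large term. (2) \<open>D\<close> is an arbitrary
  measurable domain whose translates overlap only in null sets. Unfolding is therefore proved as an
  identity of measures: copies of \<open>D\<close>, one per coset, are pushed forward onto the strip
  0 <= x < 1. (3) Write J = j(gamma,z0). In the disc, gamma replaces w by v = (conj J / J) w, so the
  m-th coefficient carries conj(J)^m / J^(k+m) = |J|^(2m) / J^(k+2m). Since |J|^2 = beta / Im(gamma
  z0), this produces the weight k+2m and the factor beta^m. The leading minus sign is (-1)^(k-1),
  which turns (4 pi n)^(k-1) into (-4 pi n)^(k-1).\<close>

no_notation fps_nth (infixl \<open>$\<close> 75)

section \<open>Matrix entries and an explicit inverse\<close>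

lemma mat2_nth [simp]:
  "mat2 a b c d $ 1 $ 1 = a" "mat2 a b c d $ 1 $ 2 = b"
  "mat2 a b c d $ 2 $ 1 = c" "mat2 a b c d $ 2 $ 2 = d"
  by (simp_all add: mat2_def)

lemma mat2_eqI:
  fixes A B :: "'a^2^2"
  assumes "A$1$1 = B$1$1" "A$1$2 = B$1$2" "A$2$1 = B$2$1" "A$2$2 = B$2$2"
  shows "A = B"
  using assms by (simp add: vec_eq_iff forall_2)

lemma matmul2_nth:
  fixes A B :: "'a::semiring_1^2^2"
  shows "(A ** B) $ i $ j = A$i$1 * B$1$j + A$i$2 * B$2$j"
  by (simp add: matrix_matrix_mult_def sum_2)

lemma mat2_one_nth:
  "(mat 1 :: 'a::semiring_1^2^2) $ 1 $ 1 = 1" "(mat 1 :: 'a::semiring_1^2^2) $ 1 $ 2 = 0"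
  "(mat 1 :: 'a::semiring_1^2^2) $ 2 $ 1 = 0" "(mat 1 :: 'a::semiring_1^2^2) $ 2 $ 2 = 1"
  by (simp_all add: mat_def)

text \<open>The adjugate. On determinant 1 it agrees with \<open>matrix_inv\<close> and with the
  group inverse of \<open>SL2R\<close>, and its entries can be computed.\<close>

definition inv2 :: "real^2^2 \<Rightarrow> real^2^2" where
  "inv2 A = mat2 (A$2$2) (- A$1$2) (- A$2$1) (A$1$1)"

lemma inv2_right: "det A = 1 \<Longrightarrow> A ** inv2 A = mat 1"
  and inv2_left: "det A = 1 \<Longrightarrow> inv2 A ** A = mat 1"
  by (rule mat2_eqI; simp add: inv2_def matmul2_nth mat2_one_nth det_2 algebra_simps)+

lemma matrix_inv_eq_inv2:
  assumes "det A = 1"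
  shows "matrix_inv A = inv2 A"
proof -
  have "A ** matrix_inv A = mat 1 \<and> matrix_inv A ** A = mat 1"
    unfolding matrix_inv_def
    by (rule someI[of _ "inv2 A"]) (simp add: inv2_left inv2_right assms)
  then show ?thesis
    by (metis assms inv2_right matrix_mul_assoc matrix_mul_lid matrix_mul_rid)
qed

lemma inv2_inv2 [simp]: "inv2 (inv2 A) = A"
  by (rule mat2_eqI) (simp_all add: inv2_def)

lemma det_inv2 [simp]: "det (inv2 A) = det A"
  by (simp add: inv2_def det_2 algebra_simps)

lemma det_matmul_eq_1: "det A = 1 \<Longrightarrow> det B = 1 \<Longrightarrow> det (A ** B) = (1::real)"
  by (simp add: det_mul)

definition transl :: "real \<Rightarrow> real^2^2" where
  "transl x = mat2 1 x 0 1"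

lemma det_transl [simp]: "det (transl x) = 1"
  by (simp add: transl_def det_2)

section \<open>The action on the upper half plane\<close>

abbreviation mact :: "real^2^2 \<Rightarrow> complex \<Rightarrow> complex" where
  "mact A \<equiv> act (cmat A)"

abbreviation jf :: "real^2^2 \<Rightarrow> complex \<Rightarrow> complex" where
  "jf A \<equiv> jfac (cmat A)"

lemma map_matrix_nth [simp]: "map_matrix f A $ i $ j = f (A $ i $ j)"
  by (simp add: map_matrix_def)

lemma mem_uhp [simp]: "z \<in> upper_half_plane \<longleftrightarrow> 0 < Im z"
  by (simp add: upper_half_plane_def)

lemma mact_eq: "mact A z = (of_real (A$1$1) * z + of_real (A$1$2)) / jf A z"
  by (simp add: act_def jfac_def moebius_def)

lemma Im_jf: "Im (jf A z) = A$2$1 * Im z"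
  and Re_jf: "Re (jf A z) = A$2$1 * Re z + A$2$2"
  by (simp_all add: jfac_def)

lemma jf_nonzero:
  assumes "det A = 1" "0 < Im z"
  shows "jf A z \<noteq> 0"
proof
  assume "jf A z = 0"
  then have "A$2$1 * Im z = 0" "A$2$1 * Re z + A$2$2 = 0"
    using Im_jf[of A z] Re_jf[of A z] by auto
  then have "A$2$1 = 0" "A$2$2 = 0"
    using assms(2) by auto
  with assms(1) show False
    by (simp add: det_2)
qed

lemma Im_mact:
  assumes "det A = 1" "0 < Im z"
  shows "Im (mact A z) = Im z / (cmod (jf A z))\<^sup>2"
proof -
  have d: "A$1$1 * A$2$2 - A$1$2 * A$2$1 = 1"
    using assms(1) by (simp add: det_2)
  have nz: "jf A z \<noteq> 0"
    by (rule jf_nonzero) fact+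
  have "Im (mact A z) =
    (A$1$1 * Im z * Re (jf A z) - (A$1$1 * Re z + A$1$2) * Im (jf A z)) / (cmod (jf A z))\<^sup>2"
    by (simp add: mact_eq Im_divide cmod_def)
  also have "A$1$1 * Im z * Re (jf A z) - (A$1$1 * Re z + A$1$2) * Im (jf A z) =
      (A$1$1 * A$2$2 - A$1$2 * A$2$1) * Im z"
    by (simp add: Im_jf Re_jf algebra_simps)
  finally show ?thesis
    by (simp add: d)
qed

lemma Im_mact_pos: "det A = 1 \<Longrightarrow> 0 < Im z \<Longrightarrow> 0 < Im (mact A z)"
  using jf_nonzero[of A z] by (simp add: Im_mact)

lemma jf_mult:
  assumes "det B = 1" "0 < Im z"
  shows "jf (A ** B) z = jf A (mact B z) * jf B z"
proof -
  have "mact B z * jf B z = of_real (B$1$1) * z + of_real (B$1$2)"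
    using jf_nonzero[OF assms] by (simp add: mact_eq)
  have "jf A (mact B z) * jf B z = of_real (A$2$1) * (mact B z * jf B z) + of_real (A$2$2) * jf B z"
    by (simp add: jfac_def[of "cmat A"] algebra_simps)
  also have "\<dots> =
      of_real (A$2$1) * (of_real (B$1$1) * z + of_real (B$1$2)) + of_real (A$2$2) * jf B z"
    unfolding \<open>mact B z * jf B z = _\<close> ..
  also have "\<dots> = jf (A ** B) z"
    by (simp add: jfac_def matmul2_nth algebra_simps)
  finally show ?thesis ..
qed

lemma mact_mult:
  assumes "det A = 1" "det B = 1" "0 < Im z"
  shows "mact (A ** B) z = mact A (mact B z)"
proof -
  have B: "mact B z * jf B z = of_real (B$1$1) * z + of_real (B$1$2)"
    using jf_nonzero[OF assms(2,3)] by (simp add: mact_eq)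
  have "mact (A ** B) z =
     (of_real (A$1$1) * (mact B z * jf B z) + of_real (A$1$2) * jf B z) / jf (A ** B) z"
    unfolding mact_eq[of "A ** B"] B
    by (simp add: jfac_def matmul2_nth algebra_simps)
  also have "\<dots> = (of_real (A$1$1) * mact B z + of_real (A$1$2)) * jf B z / (jf A (mact B z) * jf B z)"
    unfolding jf_mult[OF assms(2,3)] by (simp add: algebra_simps)
  also have "\<dots> = mact A (mact B z)"
    using jf_nonzero[OF assms(2,3)] by (simp add: mact_eq[of A])
  finally show ?thesis .
qed

lemma mact_one [simp]: "mact (mat 1) z = z" and jf_one [simp]: "jf (mat 1) z = 1"
  by (simp_all add: mact_eq jfac_def mat2_one_nth)

lemma jf_uminus [simp]: "jf (- A) z = - jf A z"
  by (simp add: jfac_def)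

lemma mact_uminus [simp]: "mact (- A) z = mact A z"
proof -
  have "mact (- A) z = (- (of_real (A$1$1) * z + of_real (A$1$2))) / (- jf A z)"
    unfolding mact_eq by simp
  then show ?thesis
    unfolding minus_divide_divide by (simp add: mact_eq)
qed

lemma mact_transl [simp]: "mact (transl x) z = z + of_real x" and jf_transl [simp]: "jf (transl x) z = 1"
  by (simp_all add: mact_eq jfac_def transl_def)

lemma transl_mult_nth:
  fixes A :: "real^2^2"
  shows
  "(transl x ** A)$1$1 = A$1$1 + x * A$2$1" "(transl x ** A)$1$2 = A$1$2 + x * A$2$2"
  "(transl x ** A)$2$1 = A$2$1" "(transl x ** A)$2$2 = A$2$2"
  by (simp_all add: matmul2_nth transl_def)

lemma mact_inv2:
  assumes "det A = 1" "0 < Im z"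
  shows "mact (inv2 A) (mact A z) = z" "mact A (mact (inv2 A) z) = z"
  using mact_mult[of "inv2 A" A z] mact_mult[of A "inv2 A" z] assms
  by (simp_all add: inv2_left inv2_right)

lemma holomorphic_on_mact [holomorphic_intros]:
    "det A = 1 \<Longrightarrow> mact A holomorphic_on upper_half_plane"
  and holomorphic_on_jf [holomorphic_intros]: "jf A holomorphic_on S"
  unfolding mact_eq jfac_def
  by (intro holomorphic_intros; use jf_nonzero[of A] in \<open>auto simp: jfac_def\<close>)+

lemma open_uhp: "open upper_half_plane"
  unfolding upper_half_plane_def by (rule open_halfspace_Im_gt)

lemma slash_cmat: "det A = 1 \<Longrightarrow> slash k (cmat A) f z = f (mact A z) / jf A z ^ k"
proof -
  assume "det A = 1"
  have "det (cmat A) = complex_of_real (A$1$1 * A$2$2 - A$1$2 * A$2$1)" 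
    by (simp add: det_2)
  also have "\<dots> = of_real (det A)"
    by (simp only: det_2)
  also have "\<dots> = 1"
    using \<open>det A = 1\<close> by simp
  finally show ?thesis
    by (simp add: slash_def)
qed

section \<open>A packing bound\<close>

text \<open>Above each point \<open>t i\<close> sits a rectangle of width \<open>q i\<close>^2/2 at
  heights between \<open>q i\<close>^2/2 and \<open>q i\<close>^2. Two rectangles that meet
  vertically have comparable \<open>q\<close>, and then the separation keeps them apart
  horizontally. Each has area \<open>q i\<close>^4/4, and all lie in a box of area 3 * 2 = 6, whence
  24.\<close>

lemma packing_slopes:
  fixes t q :: "'i \<Rightarrow> real"
  assumes "finite I"
    and sep: "\<And>i j. i \<in> I \<Longrightarrow> j \<in> I \<Longrightarrow> i \<noteq> j \<Longrightarrow> q i * q j \<le> \<bar>t i - t j\<bar>"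
    and t: "\<And>i. i \<in> I \<Longrightarrow> \<bar>t i\<bar> \<le> 1"
    and q: "\<And>i. i \<in> I \<Longrightarrow> 0 < q i" "\<And>i. i \<in> I \<Longrightarrow> (q i)\<^sup>2 \<le> 2"
  shows "(\<Sum>i\<in>I. q i ^ 4) \<le> 24"
proof -
  define A where "A i = box (t i - (q i)\<^sup>2 / 4, (q i)\<^sup>2 / 2) (t i + (q i)\<^sup>2 / 4, (q i)\<^sup>2)" for i
  have A: "(x, y) \<in> A i \<longleftrightarrow> \<bar>x - t i\<bar> < (q i)\<^sup>2 / 4 \<and> (q i)\<^sup>2 / 2 < y \<and> y < (q i)\<^sup>2" for i x y
  proof -
    have "(x, y) \<in> A i \<longleftrightarrow>
        t i - (q i)\<^sup>2 / 4 < x \<and> x < t i + (q i)\<^sup>2 / 4 \<and> (q i)\<^sup>2 / 2 < y \<and> y < (q i)\<^sup>2"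
      by (auto simp: A_def mem_box Basis_prod_def ball_Un)
    then show ?thesis by linarith
  qed
  have disj: "A i \<inter> A j = {}" if ij: "i \<in> I" "j \<in> I" "i \<noteq> j" for i j
  proof -
    have "\<not> ((x, y) \<in> A i \<and> (x, y) \<in> A j)" for x y
    proof
      assume "(x, y) \<in> A i \<and> (x, y) \<in> A j"
      then have xy: "\<bar>x - t i\<bar> < (q i)\<^sup>2 / 4" "\<bar>x - t j\<bar> < (q j)\<^sup>2 / 4"
          "(q i)\<^sup>2 / 2 < y" "y < (q i)\<^sup>2" "(q j)\<^sup>2 / 2 < y" "y < (q j)\<^sup>2"
        unfolding A by blast+
      have x: "\<bar>t i - t j\<bar> < ((q i)\<^sup>2 + (q j)\<^sup>2) / 4"
      proof -
        have "\<bar>t i - t j\<bar> \<le> \<bar>x - t i\<bar> + \<bar>x - t j\<bar>" by linarith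
        then show ?thesis using xy(1,2) by (simp add: add_divide_distrib)
      qed
      have y: "(q i)\<^sup>2 < 2 * (q j)\<^sup>2"
        using xy by linarith
      have y': "(q j)\<^sup>2 < 2 * (q i)\<^sup>2"
        using xy by linarith
      have "(q i * q j)\<^sup>2 < (((q i)\<^sup>2 + (q j)\<^sup>2) / 4)\<^sup>2"
        using sep[OF ij] x q(1)[OF ij(1)] q(1)[OF ij(2)]
        by (intro power_strict_mono) auto
      \<comment> \<open>With X, Y the squares of \<open>q i\<close>, \<open>q j\<close>, the
        previous fact reads 16 X Y < (X+Y)^2. This product gives 2 (X^2 + Y^2) < 5 X Y, that is
        (X+Y)^2 < (9/2) X Y, a contradiction as X Y > 0.\<close>
      moreover have "0 < (2 * (q j)\<^sup>2 - (q i)\<^sup>2) * (2 * (q i)\<^sup>2 - (q j)\<^sup>2)"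
        using y y' by (intro mult_pos_pos) auto
      moreover have "0 < (q i)\<^sup>2 * (q j)\<^sup>2"
        using q(1)[OF ij(1)] q(1)[OF ij(2)] by simp
      ultimately show False
        unfolding power2_eq_square power_mult_distrib by (auto simp: field_simps)
    qed
    then show ?thesis by auto
  qed
  have m: "measure lborel (A i) = q i ^ 4 / 4" if "i \<in> I" for i
  proof -
    have "measure lborel (A i) = measure lborel (cbox (t i - (q i)\<^sup>2 / 4, (q i)\<^sup>2 / 2) (t i + (q i)\<^sup>2 / 4, (q i)\<^sup>2))"
      unfolding A_def by (simp add: measure_lborel_box_eq measure_lborel_cbox_eq)
    also have "\<dots> = q i ^ 4 / 4"
      using q(1)[OF that]
      by (subst content_Pair) (simp add: power2_eq_square power4_eq_xxxx field_simps)
    finally show ?thesis .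
  qed
  have "(\<Sum>i\<in>I. q i ^ 4 / 4) = (\<Sum>i\<in>I. measure lborel (A i))"
    by (intro sum.cong refl) (simp add: m)
  also have "\<dots> = measure lborel (\<Union>i\<in>I. A i)"
  proof (rule measure_finite_Union[symmetric])
    show "A ` I \<subseteq> sets lborel" by (auto simp: A_def)
    show "disjoint_family_on A I" using disj by (auto simp: disjoint_family_on_def)
    show "emeasure lborel (A i) \<noteq> \<infinity>" for i
      unfolding A_def by (metis emeasure_lborel_box_finite infinity_ennreal_def less_irrefl)
  qed fact
  also have "\<dots> \<le> measure lborel (cbox (- 3/2, 0) (3/2, 2) :: (real \<times> real) set)"
  proof (rule measure_mono_fmeasurable)
    show "(\<Union>i\<in>I. A i) \<subseteq> cbox (- 3/2, 0) (3/2, 2)"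
    proof (rule subsetI)
      fix p assume "p \<in> (\<Union>i\<in>I. A i)"
      moreover obtain x y where p: "p = (x, y)" by fastforce
      ultimately obtain i where i: "i \<in> I" and "(x, y) \<in> A i" by blast
      then have xy: "\<bar>x - t i\<bar> < (q i)\<^sup>2 / 4" "(q i)\<^sup>2 / 2 < y" "y < (q i)\<^sup>2"
        unfolding A by blast+
      have "\<bar>x\<bar> \<le> \<bar>x - t i\<bar> + \<bar>t i\<bar>" by linarith
      then have "\<bar>x\<bar> \<le> 3/2"
        using xy(1) q(2)[OF i] t[OF i] by simp
      moreover have "0 \<le> y"
        using xy(2) zero_le_power2[of "q i"] by linarith
      ultimately show "p \<in> cbox (- 3/2, 0) (3/2, 2)"
        using xy(3) q(2)[OF i] unfolding p cbox_Pair_eq by (auto simp: abs_le_iff)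
    qed
    show "(\<Union>i\<in>I. A i) \<in> sets lborel"
      using \<open>finite I\<close> by (auto simp: A_def)
  qed simp
  also have "\<dots> = 6"
    by (subst content_Pair) simp
  finally show ?thesis
    by (simp add: sum_divide_distrib[symmetric])
qed

text \<open>Under \<open>|a| <= |b|\<close> the slopes \<open>a i / b i\<close> lie in [-1,1], and
  like Farey fractions they are at least 1/|b i b j| apart. So \<open>packing_slopes\<close> applies
  with q = 1/|b|; the bound q^2 <= 2 comes from 1 <= a^2 + b^2 <= 2 b^2.\<close>

lemma packing_half:
  fixes a b :: "'i \<Rightarrow> real"
  assumes "finite I"
    and sep: "\<And>i j. i \<in> I \<Longrightarrow> j \<in> I \<Longrightarrow> i \<noteq> j \<Longrightarrow> 1 \<le> \<bar>a i * b j - a j * b i\<bar>"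
    and big: "\<And>i. i \<in> I \<Longrightarrow> 1 \<le> (a i)\<^sup>2 + (b i)\<^sup>2"
    and ab: "\<And>i. i \<in> I \<Longrightarrow> \<bar>a i\<bar> \<le> \<bar>b i\<bar>"
  shows "(\<Sum>i\<in>I. 1 / ((a i)\<^sup>2 + (b i)\<^sup>2)\<^sup>2) \<le> 24"
proof -
  have b2: "1 \<le> 2 * (b i)\<^sup>2" if "i \<in> I" for i
    using big[OF that] power_mono[OF ab[OF that], of 2] by simp
  then have b0: "b i \<noteq> 0" if "i \<in> I" for i
    using that by fastforce
  have "(\<Sum>i\<in>I. 1 / ((a i)\<^sup>2 + (b i)\<^sup>2)\<^sup>2) \<le> (\<Sum>i\<in>I. (1 / \<bar>b i\<bar>) ^ 4)"
  proof (rule sum_mono)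
    fix i assume i: "i \<in> I"
    have "(b i)\<^sup>2 ^ 2 \<le> ((a i)\<^sup>2 + (b i)\<^sup>2)\<^sup>2"
      by (rule power_mono) auto
    then show "1 / ((a i)\<^sup>2 + (b i)\<^sup>2)\<^sup>2 \<le> (1 / \<bar>b i\<bar>) ^ 4"
      using b0[OF i] by (auto simp: power_divide intro!: divide_left_mono mult_pos_pos add_nonneg_pos)
  qed
  also have "\<dots> \<le> 24"
  proof (rule packing_slopes[where t = "\<lambda>i. a i / b i"])
    fix i j assume ij: "i \<in> I" "j \<in> I" "i \<noteq> j"
    have "\<bar>a i / b i - a j / b j\<bar> = \<bar>(a i * b j - a j * b i) / (b i * b j)\<bar>"
      using b0 ij by (simp add: field_simps)
    also have "\<dots> = \<bar>a i * b j - a j * b i\<bar> * (1 / \<bar>b i\<bar> * (1 / \<bar>b j\<bar>))"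
      by (simp add: abs_mult)
    also have "\<dots> \<ge> 1 * (1 / \<bar>b i\<bar> * (1 / \<bar>b j\<bar>))"
      by (rule mult_right_mono[OF sep[OF ij]]) simp
    finally show "1 / \<bar>b i\<bar> * (1 / \<bar>b j\<bar>) \<le> \<bar>a i / b i - a j / b j\<bar>" by simp
  next
    fix i assume i: "i \<in> I"
    show "\<bar>a i / b i\<bar> \<le> 1" using ab[OF i] b0[OF i] by (simp add: divide_simps)
    show "(1 / \<bar>b i\<bar>)\<^sup>2 \<le> 2" using b2[OF i] b0[OF i] by (simp add: power_divide divide_simps)
    show "0 < 1 / \<bar>b i\<bar>" using b0[OF i] by simp
  qed fact
  finally show ?thesis .
qed

text \<open>The vectors are split by which coordinate dominates; exchanging the coordinates changes
  the determinant only in sign, so each half contributes at most 24.\<close>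

lemma packing_bound:
  fixes a b :: "'i \<Rightarrow> real"
  assumes "finite I"
    and sep: "\<And>i j. i \<in> I \<Longrightarrow> j \<in> I \<Longrightarrow> i \<noteq> j \<Longrightarrow> 1 \<le> \<bar>a i * b j - a j * b i\<bar>"
    and big: "\<And>i. i \<in> I \<Longrightarrow> 1 \<le> (a i)\<^sup>2 + (b i)\<^sup>2"
  shows "(\<Sum>i\<in>I. 1 / ((a i)\<^sup>2 + (b i)\<^sup>2)\<^sup>2) \<le> 48"
proof -
  define J where "J = {i \<in> I. \<bar>a i\<bar> \<le> \<bar>b i\<bar>}"
  have J: "J \<subseteq> I" by (auto simp: J_def)
  have "(\<Sum>i\<in>I. 1 / ((a i)\<^sup>2 + (b i)\<^sup>2)\<^sup>2) =
      (\<Sum>i\<in>I - J. 1 / ((b i)\<^sup>2 + (a i)\<^sup>2)\<^sup>2) + (\<Sum>i\<in>J. 1 / ((a i)\<^sup>2 + (b i)\<^sup>2)\<^sup>2)"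
    by (simp add: sum.subset_diff[OF J \<open>finite I\<close>] add.commute[of "(a _)\<^sup>2"])
  also have "\<dots> \<le> 24 + 24"
  proof (rule add_mono; rule packing_half)
    show "finite J" "finite (I - J)" using \<open>finite I\<close> by (auto simp: J_def)
    fix i j
    show "1 \<le> \<bar>b i * a j - b j * a i\<bar>" if "i \<in> I - J" "j \<in> I - J" "i \<noteq> j"
      using sep[of j i] that by (simp add: algebra_simps)
  qed (use sep big in \<open>auto simp: J_def add.commute\<close>)
  finally show ?thesis by simp
qed

section \<open>Discrete groups with a cusp of width one\<close>

lemma group_SL2R: "group SL2R"
proof (rule groupI)
  fix A assume "A \<in> carrier SL2R"
  then show "\<exists>B\<in>carrier SL2R. B \<otimes>\<^bsub>SL2R\<^esub> A = \<one>\<^bsub>SL2R\<^esub>"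
    by (intro bexI[of _ "inv2 A"]) (auto simp: SL2R_def inv2_left)
qed (auto simp: SL2R_def det_matmul_eq_1 matrix_mul_assoc)

lemma inv_SL2R: "det A = 1 \<Longrightarrow> inv\<^bsub>SL2R\<^esub> A = inv2 A"
  by (rule group.inv_equality[OF group_SL2R]) (auto simp: SL2R_def inv2_left)

locale cusp_group =
  fixes \<Gamma> :: "(real^2^2) set"
  assumes subgroup: "subgroup \<Gamma> SL2R"
    and discrete: "discrete \<Gamma>"
    and stab: "stab_infinity \<Gamma> =
           {mat2 1 (of_int l) 0 1 | l :: int. True} \<union> {- mat2 1 (of_int l) 0 1 | l :: int. True}"
begin

lemma det_mem: "A \<in> \<Gamma> \<Longrightarrow> det A = 1"
  using subgroup.subset[OF subgroup] by (auto simp: SL2R_def)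

lemma mult_mem: "A \<in> \<Gamma> \<Longrightarrow> B \<in> \<Gamma> \<Longrightarrow> A ** B \<in> \<Gamma>"
  using subgroup.m_closed[OF subgroup] by (simp add: SL2R_def)

lemma inv2_mem: "A \<in> \<Gamma> \<Longrightarrow> inv2 A \<in> \<Gamma>"
  using subgroup.m_inv_closed[OF subgroup, of A] inv_SL2R[of A] det_mem[of A] by simp

lemma stab_iff: "A \<in> \<Gamma> \<and> A$2$1 = 0 \<longleftrightarrow> (\<exists>l::int. A = transl (of_int l) \<or> A = - transl (of_int l))"
proof -
  have "A \<in> \<Gamma> \<and> A$2$1 = 0 \<longleftrightarrow> A \<in> stab_infinity \<Gamma>"
    by (simp add: stab_infinity_def)
  then show ?thesis
    unfolding stab transl_def by blast
qed

lemma transl_mem: "transl (of_int l) \<in> \<Gamma>" and uminus_transl_mem: "- transl (of_int l) \<in> \<Gamma>"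
  using stab_iff[of "transl (of_int l)"] stab_iff[of "- transl (of_int l)"] by blast+

lemma transl_0: "transl 0 = mat 1"
  by (rule mat2_eqI) (simp_all add: transl_def mat2_one_nth)

lemma uminus_one_mem: "- mat 1 \<in> \<Gamma>"
  using uminus_transl_mem[of 0] by (simp add: transl_0)

lemma uminus_mem: "A \<in> \<Gamma> \<Longrightarrow> - A \<in> \<Gamma>"
proof -
  assume "A \<in> \<Gamma>"
  moreover have "- A = (- mat 1) ** A"
    by (rule mat2_eqI) (simp_all add: matmul2_nth mat2_one_nth)
  ultimately show ?thesis
    using mult_mem[OF uminus_one_mem] by simp
qed

text \<open>Shimizu's lemma: if \<open>0 < \<bar>c\<bar> < 1\<close>, iterating \<open>A \<mapsto> A T A\<^sup>-\<^sup>1\<close> with \<open>T = (1 1; 0 1)\<close>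
  produces elements of \<open>\<Gamma>\<close> different from \<open>T\<close> that converge to \<open>T\<close>.\<close>

lemma shimizu:
  assumes A: "A \<in> \<Gamma>" and c: "A$2$1 \<noteq> 0"
  shows "1 \<le> \<bar>A$2$1\<bar>"
proof (rule ccontr)
  assume "\<not> 1 \<le> \<bar>A$2$1\<bar>"
  define r where "r = \<bar>A$2$1\<bar>"
  have r: "0 < r" "r < 1"
    using c \<open>\<not> 1 \<le> \<bar>A$2$1\<bar>\<close> by (auto simp: r_def)
  define B where "B n = ((\<lambda>X. X ** transl 1 ** inv2 X) ^^ n) A" for n
  have B0: "B 0 = A" and BS: "B (Suc n) = B n ** transl 1 ** inv2 (B n)" for n
    by (simp_all add: B_def)
  have mem: "B n \<in> \<Gamma>" for n
    by (induction n) (use A transl_mem[of 1] in \<open>auto simp: B0 BS intro!: mult_mem inv2_mem\<close>)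
  have det: "B n$1$1 * B n$2$2 - B n$1$2 * B n$2$1 = 1" for n
    using det_mem[OF mem[of n]] by (simp add: det_2)
  have rec: "B (Suc n)$1$1 = 1 - B n$1$1 * B n$2$1" "B (Suc n)$1$2 = (B n$1$1)\<^sup>2"
    "B (Suc n)$2$1 = - (B n$2$1)\<^sup>2" "B (Suc n)$2$2 = 1 + B n$1$1 * B n$2$1" for n
    using det[of n] by (simp_all add: BS matmul2_nth inv2_def transl_def power2_eq_square algebra_simps)
  have nz: "B n$2$1 \<noteq> 0" for n
    by (induction n) (use c in \<open>auto simp: B0 rec\<close>)
  \<comment> \<open>The lower left entry is squared at each stage, up to sign. Geometric decay is
    all that is kept of this, since the upper left entry grows at most linearly.\<close>
  have cn: "\<bar>B n$2$1\<bar> \<le> r ^ Suc n" for n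
  proof (induction n)
    case (Suc n)
    have "\<bar>B (Suc n)$2$1\<bar> = \<bar>B n$2$1\<bar> * \<bar>B n$2$1\<bar>"
      by (simp add: rec power2_eq_square abs_mult)
    also have "\<dots> \<le> r ^ Suc n * r ^ Suc n"
      using Suc r by (intro mult_mono) auto
    also have "\<dots> \<le> r ^ Suc n * r ^ 1"
      using r by (intro mult_left_mono power_decreasing) auto
    finally show ?case by (simp add: mult_ac)
  qed (simp add: B0 r_def)
  have an: "\<bar>B n$1$1\<bar> \<le> \<bar>A$1$1\<bar> + real n" for n
  proof (induction n)
    case (Suc n)
    have "\<bar>B n$2$1\<bar> \<le> 1"
      using cn[of n] r power_le_one[of r "Suc n"] by linarith
    then have "\<bar>B n$1$1 * B n$2$1\<bar> \<le> \<bar>B n$1$1\<bar>"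
      by (simp add: abs_mult mult_left_le)
    then show ?case
      using Suc by (simp add: rec)
  qed (simp add: B0)
  have "(\<lambda>n. (\<bar>A$1$1\<bar> + real n) * r ^ Suc n) \<longlonglongrightarrow> 0"
    using r by real_asymp
  then have ac: "(\<lambda>n. B n$1$1 * B n$2$1) \<longlonglongrightarrow> 0"
    by (rule Lim_null_comparison[rotated])
      (use an cn in \<open>auto simp: abs_mult intro!: always_eventually mult_mono\<close>)
  have "(\<lambda>n. r ^ Suc n) \<longlonglongrightarrow> 0"
    using r by real_asymp
  then have c0: "(\<lambda>n. B n$2$1) \<longlonglongrightarrow> 0"
    by (rule Lim_null_comparison[rotated]) (use cn in \<open>auto intro!: always_eventually\<close>)
  have a1: "(\<lambda>n. B (Suc n)$1$1) \<longlonglongrightarrow> 1"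
    unfolding rec using tendsto_diff[OF tendsto_const[of 1] ac] by simp
  \<comment> \<open>Two shifts let \<open>rec\<close> express every entry through limits already
    found: the upper right entry is the square of the preceding upper left one, whose limit
    \<open>a1\<close> is itself stated with one shift.\<close>
  have "(\<lambda>n. B (Suc (Suc n))$i$j) \<longlonglongrightarrow> transl 1$i$j" for i j
  proof -
    have "(\<lambda>n. B (Suc (Suc n))$1$1) \<longlonglongrightarrow> 1"
      using a1 by (rule LIMSEQ_Suc)
    moreover have "(\<lambda>n. B (Suc (Suc n))$1$2) \<longlonglongrightarrow> 1"
      unfolding rec(2)[of "Suc _"] using tendsto_power[OF a1, of 2] by simp
    moreover have "(\<lambda>n. B (Suc (Suc n))$2$1) \<longlonglongrightarrow> 0"
      using LIMSEQ_Suc[OF LIMSEQ_Suc[OF c0]] .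
    moreover have "(\<lambda>n. B (Suc (Suc n))$2$2) \<longlonglongrightarrow> 1"
      unfolding rec(4)[of "Suc _"] using tendsto_add[OF tendsto_const[of 1] LIMSEQ_Suc[OF ac]] by simp
    ultimately have "\<forall>i j. (\<lambda>n. B (Suc (Suc n))$i$j) \<longlonglongrightarrow> transl 1$i$j"
      by (simp add: forall_2 transl_def)
    then show ?thesis by blast
  qed
  then have lim: "(\<lambda>n. B (Suc (Suc n))) \<longlonglongrightarrow> transl 1"
    by (intro vec_tendstoI)
  have "transl 1 \<in> \<Gamma>"
    using transl_mem[of 1] by simp
  \<comment> \<open>Discreteness makes the limit \<open>transl 1\<close> isolated in the group, so
    some iterate equals it; but \<open>nz\<close> says that no iterate has lower left entry
    0.\<close>
  then obtain T where T: "open T" "T \<inter> \<Gamma> = {transl 1}"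
    using discreteD[OF discrete] unfolding isolated_in_def by blast
  then have "\<forall>\<^sub>F n in sequentially. B (Suc (Suc n)) \<in> T"
    using lim by (auto simp: tendsto_def)
  then obtain n where "B (Suc (Suc n)) \<in> T"
    by (auto simp: eventually_sequentially)
  then have "B (Suc (Suc n)) = transl 1"
    using T(2) mem by blast
  then show False
    using nz[of "Suc (Suc n)"] by (simp add: transl_def)
qed

section \<open>Cosets of the stabilizer of the cusp\<close>

abbreviation cosets :: "(real^2^2) set set" where
  "cosets \<equiv> rcosets\<^bsub>SL2R\<lparr>carrier := \<Gamma>\<rparr>\<^esub> (stab_infinity \<Gamma>)"

text \<open>The same choice as inside \<open>poincare_F\<close>, so that its summands can be matched
  one by one.\<close>

definition rep :: "(real^2^2) set \<Rightarrow> real^2^2" where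
  "rep C = (SOME \<gamma>. \<gamma> \<in> C)"

text \<open>The right coset of \<open>A\<close> under the stabilizer, encoded by the bottom row up
  to sign; equality of cosets then becomes a matter of matrix entries.\<close>

definition coset :: "real^2^2 \<Rightarrow> (real^2^2) set" where
  "coset A = {X \<in> \<Gamma>. X$2$1 = A$2$1 \<and> X$2$2 = A$2$2 \<or> X$2$1 = - A$2$1 \<and> X$2$2 = - A$2$2}"

text \<open>The lower left entry of X A^-1 is the determinant of the two bottom rows, which vanishes
  when they agree up to sign. Conversely, left multiplication by plus or minus a translation changes
  the bottom row at most in sign.\<close>

lemma coset_altdef:
  assumes A: "A \<in> \<Gamma>"
  shows "coset A = (\<Union>h\<in>stab_infinity \<Gamma>. {h ** A})"
proof (intro equalityI subsetI)
  fix X assume X: "X \<in> coset A"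
  then have "X \<in> \<Gamma>" by (simp add: coset_def)
  have "X ** inv2 A \<in> stab_infinity \<Gamma>"
    using X A by (auto simp: stab_infinity_def coset_def inv2_def matmul2_nth
      intro!: mult_mem inv2_mem[unfolded inv2_def])
  moreover have "X ** inv2 A ** A = X"
    using det_mem[OF A] by (simp add: matrix_mul_assoc[symmetric] inv2_left)
  ultimately show "X \<in> (\<Union>h\<in>stab_infinity \<Gamma>. {h ** A})"
    by force
next
  fix X assume "X \<in> (\<Union>h\<in>stab_infinity \<Gamma>. {h ** A})"
  then obtain h where h: "h \<in> \<Gamma>" "h$2$1 = 0" "X = h ** A"
    by (auto simp: stab_infinity_def)
  then obtain l :: int where "h = transl (of_int l) \<or> h = - transl (of_int l)"
    using stab_iff by blast
  then show "X \<in> coset A"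
    using h A mult_mem by (auto simp: coset_def matmul2_nth transl_def)
qed

lemma mem_cosets: "C \<in> cosets \<longleftrightarrow> (\<exists>A\<in>\<Gamma>. C = coset A)"
proof -
  have "C \<in> cosets \<longleftrightarrow> (\<exists>A\<in>\<Gamma>. C = (\<Union>h\<in>stab_infinity \<Gamma>. {h ** A}))"
    by (auto simp: RCOSETS_def r_coset_def SL2R_def)
  then show ?thesis
    using coset_altdef by auto
qed

lemma coset_refl: "A \<in> \<Gamma> \<Longrightarrow> A \<in> coset A"
  by (simp add: coset_def)

lemma coset_eqI: "B \<in> coset A \<Longrightarrow> coset B = coset A"
  by (auto simp: coset_def)

lemma rep_mem_coset: "C \<in> cosets \<Longrightarrow> rep C \<in> C"
  unfolding rep_def using coset_refl by (auto simp: mem_cosets intro: someI[of "\<lambda>x. x \<in> _"])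

lemma rep_mem: "C \<in> cosets \<Longrightarrow> rep C \<in> \<Gamma>"
  using rep_mem_coset[of C] by (auto simp: mem_cosets coset_def)

lemma det_rep: "C \<in> cosets \<Longrightarrow> det (rep C) = 1"
  by (simp add: rep_mem det_mem)

lemma coset_rep: "C \<in> cosets \<Longrightarrow> coset (rep C) = C"
  using rep_mem_coset[of C] coset_eqI by (auto simp: mem_cosets)

lemma coset_cases:
  assumes "A \<in> \<Gamma>" "B \<in> coset A"
  obtains l :: int where "B = transl (of_int l) ** A \<or> B = - (transl (of_int l) ** A)"
proof -
  obtain h where h: "h \<in> stab_infinity \<Gamma>" "B = h ** A"
    using assms coset_altdef by auto
  then obtain l :: int where "h = transl (of_int l) \<or> h = - transl (of_int l)"
    using stab_iff[of h] by (auto simp: stab_infinity_def)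
  moreover have "(- transl (of_int l)) ** A = - (transl (of_int l) ** A)"
    by (rule mat2_eqI) (simp_all add: matmul2_nth)
  ultimately show ?thesis
    using h(2) that by auto
qed

text \<open>The determinant of the two bottom rows is the lower left entry of A B^-1. It is nonzero
  because the cosets differ, so Shimizu's lemma applies to A B^-1.\<close>

lemma coset_separated:
  assumes A: "A \<in> \<Gamma>" and B: "B \<in> \<Gamma>" and ne: "coset A \<noteq> coset B"
  shows "1 \<le> \<bar>A$2$1 * B$2$2 - A$2$2 * B$2$1\<bar>"
proof -
  have e: "(A ** inv2 B)$2$1 = A$2$1 * B$2$2 - A$2$2 * B$2$1"
    by (simp add: matmul2_nth inv2_def)
  have m: "A ** inv2 B \<in> \<Gamma>"
    using A B by (intro mult_mem inv2_mem)
  have "(A ** inv2 B)$2$1 \<noteq> 0"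
  proof
    assume "(A ** inv2 B)$2$1 = 0"
    then have "A ** inv2 B \<in> stab_infinity \<Gamma>"
      using m by (simp add: stab_infinity_def)
    moreover have "A ** inv2 B ** B = A"
      using det_mem[OF B] by (simp add: matrix_mul_assoc[symmetric] inv2_left)
    ultimately have "A \<in> coset B"
      unfolding coset_altdef[OF B] by force
    then show False
      using ne coset_eqI by blast
  qed
  then show ?thesis
    using shimizu[OF m] e by simp
qed

text \<open>As a vector in the plane, j(gamma,z) = cz + d is a linear image of the bottom row (c,d),
  and the linear map scales areas by Im z. This carries \<open>coset_separated\<close> over to the
  automorphy factors.\<close>

lemma jf_separated:
  assumes "C \<in> cosets" "C' \<in> cosets" "C \<noteq> C'" "0 < Im z"
  shows "Im z \<le> \<bar>Re (jf (rep C) z) * Im (jf (rep C') z) - Re (jf (rep C') z) * Im (jf (rep C) z)\<bar>"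
proof -
  have "Im z * 1 \<le> Im z * \<bar>rep C$2$1 * rep C'$2$2 - rep C$2$2 * rep C'$2$1\<bar>"
    using assms coset_separated[of "rep C" "rep C'"]
    by (intro mult_left_mono) (auto simp: rep_mem coset_rep)
  also have "\<dots> = \<bar>Im z * (rep C$2$1 * rep C'$2$2 - rep C$2$2 * rep C'$2$1)\<bar>"
    using assms(4) by (simp add: abs_mult)
  also have "Im z * (rep C$2$1 * rep C'$2$2 - rep C$2$2 * rep C'$2$1) =
      - (Re (jf (rep C) z) * Im (jf (rep C') z) - Re (jf (rep C') z) * Im (jf (rep C) z))"
    by (simp add: Im_jf Re_jf algebra_simps)
  finally show ?thesis
    by simp
qed

section \<open>Heights Im(gamma z) and convergence\<close>

abbreviation ht :: "(real^2^2) set \<Rightarrow> complex \<Rightarrow> real" where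
  "ht C z \<equiv> Im (mact (rep C) z)"

lemma ht_eq: "C \<in> cosets \<Longrightarrow> 0 < Im z \<Longrightarrow> ht C z = Im z / (cmod (jf (rep C) z))\<^sup>2"
  by (rule Im_mact) (simp add: det_rep)

lemma ht_pos: "C \<in> cosets \<Longrightarrow> 0 < Im z \<Longrightarrow> 0 < ht C z"
  by (rule Im_mact_pos) (simp add: det_rep)

text \<open>Dividing the automorphy factors by sqrt(Im z) normalizes their pairwise determinants to
  at least 1, and the squared length of a normalized vector is 1 / \<open>ht C z\<close>. The
  packing bound then holds with a constant independent of z.\<close>

lemma sum_ht_le:
  assumes z: "0 < Im z" and S: "finite S" "S \<subseteq> cosets" and le: "\<And>C. C \<in> S \<Longrightarrow> ht C z \<le> 1"
  shows "(\<Sum>C\<in>S. (ht C z)\<^sup>2) \<le> 48"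
proof -
  define a where "a C = Re (jf (rep C) z) / sqrt (Im z)" for C
  define b where "b C = Im (jf (rep C) z) / sqrt (Im z)" for C
  have ab: "(a C)\<^sup>2 + (b C)\<^sup>2 = (cmod (jf (rep C) z))\<^sup>2 / Im z" for C
    using z by (simp add: a_def b_def power_divide cmod_def add_divide_distrib)
  have h: "ht C z = 1 / ((a C)\<^sup>2 + (b C)\<^sup>2)" if "C \<in> S" for C
    unfolding ab using ht_eq[of C z] that S z by auto
  have "(\<Sum>C\<in>S. 1 / ((a C)\<^sup>2 + (b C)\<^sup>2)\<^sup>2) \<le> 48"
  proof (rule packing_bound)
    fix C C' assume C: "C \<in> S" "C' \<in> S" "C \<noteq> C'"
    have "a C * b C' - a C' * b C =
        (Re (jf (rep C) z) * Im (jf (rep C') z) - Re (jf (rep C') z) * Im (jf (rep C) z)) / Im z"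
      using z by (simp add: a_def b_def diff_divide_distrib)
    then show "1 \<le> \<bar>a C * b C' - a C' * b C\<bar>"
      using jf_separated[of C C' z] C S z by (auto simp: abs_divide mult.commute)
  next
    fix C assume C: "C \<in> S"
    then have "0 < 1 / ((a C)\<^sup>2 + (b C)\<^sup>2)"
      using h[OF C] ht_pos[of C z] S z by auto
    then show "1 \<le> (a C)\<^sup>2 + (b C)\<^sup>2"
      using le[OF C] unfolding h[OF C] by (simp add: divide_simps split: if_splits)
  qed fact
  also have "(\<Sum>C\<in>S. 1 / ((a C)\<^sup>2 + (b C)\<^sup>2)\<^sup>2) = (\<Sum>C\<in>S. (ht C z)\<^sup>2)"
    by (intro sum.cong refl) (simp add: h power_divide)
  finally show ?thesis .
qed

text \<open>Both automorphy factors would have squared length below Im z, so they would span a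
  parallelogram of area below Im z, against \<open>jf_separated\<close>. Geometrically, distinct
  translates of the horoball Im > 1 are disjoint.\<close>

lemma ht_gt_1_unique:
  assumes "C \<in> cosets" "C' \<in> cosets" "0 < Im z" "1 < ht C z" "1 < ht C' z"
  shows "C = C'"
proof (rule ccontr)
  assume "C \<noteq> C'"
  let ?u = "jf (rep C) z" and ?v = "jf (rep C') z"
  have nz: "?u \<noteq> 0" "?v \<noteq> 0"
    using assms det_rep jf_nonzero by blast+
  have lt: "(cmod ?u)\<^sup>2 < Im z" "(cmod ?v)\<^sup>2 < Im z"
    using assms nz by (auto simp: ht_eq less_divide_eq_1 split: if_splits)
  have "Re ?u * Im ?v - Re ?v * Im ?u = Im (cnj ?u * ?v)"
    by simp
  then have "Im z \<le> \<bar>Im (cnj ?u * ?v)\<bar>"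
    using jf_separated[OF assms(1,2) \<open>C \<noteq> C'\<close> assms(3)] by (simp only:)
  also have "\<dots> \<le> cmod (cnj ?u * ?v)"
    by (rule abs_Im_le_cmod)
  also have "\<dots> = cmod ?u * cmod ?v"
    by (simp add: norm_mult)
  also have "\<dots> \<le> ((cmod ?u)\<^sup>2 + (cmod ?v)\<^sup>2) / 2"
    using sum_squares_bound[of "cmod ?u" "cmod ?v"] by simp
  finally show False
    using lt by simp
qed

lemma sum_weight_le:
  assumes z: "0 < Im z" and S: "finite S" "S \<subseteq> cosets"
    and h: "\<And>u. 0 < u \<Longrightarrow> u \<le> 1 \<Longrightarrow> h u \<le> u\<^sup>2" "\<And>u. 0 < u \<Longrightarrow> h u \<le> B" and "0 \<le> B"
  shows "(\<Sum>C\<in>S. h (ht C z)) \<le> B + 48"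
proof -
  define J where "J = {C \<in> S. 1 < ht C z}"
  have J: "J \<subseteq> S" by (auto simp: J_def)
  have "(\<Sum>C\<in>S. h (ht C z)) = (\<Sum>C\<in>S - J. h (ht C z)) + (\<Sum>C\<in>J. h (ht C z))"
    by (rule sum.subset_diff[OF J S(1)])
  also have "(\<Sum>C\<in>S - J. h (ht C z)) \<le> (\<Sum>C\<in>S - J. (ht C z)\<^sup>2)"
    using S z by (intro sum_mono h(1)) (auto simp: J_def ht_pos not_less)
  also have "\<dots> \<le> 48"
    using S z by (intro sum_ht_le) (auto simp: J_def)
  also have "(\<Sum>C\<in>J. h (ht C z)) \<le> B"
  proof (cases "J = {}")
    case False
    then obtain C where "C \<in> J" by blast
    then have "J = {C}"
      using ht_gt_1_unique[of _ C z] S(2) z by (auto simp: J_def)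
    then show ?thesis
      using h(2)[OF ht_pos[of C z]] \<open>C \<in> J\<close> J S z by auto
  qed (use \<open>0 \<le> B\<close> in simp)
  finally show ?thesis by simp
qed

text \<open>For exponent 4 the terms are \<open>ht C z\<close>^2 / (Im z)^2. Outside the at most one
  coset of height above 1, |j| >= sqrt(Im z), so the remaining k - 4 powers contribute only a
  bounded factor.\<close>

lemma summable_jf:
  assumes z: "0 < Im z" and k: "4 \<le> k"
  shows "(\<lambda>C. 1 / cmod (jf (rep C) z) ^ k) summable_on cosets"
proof -
  define J where "J = {C \<in> cosets. 1 < ht C z}"
  have "finite J"
  proof (cases "J = {}")
    case False
    then obtain C where "C \<in> J" by blast
    then have "J = {C}"
      using ht_gt_1_unique[of _ C z] z by (auto simp: J_def)
    then show ?thesis by simp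
  qed simp
  have "(\<lambda>C. (ht C z)\<^sup>2) summable_on (cosets - J)"
  proof (rule nonneg_bdd_above_summable_on)
    show "bdd_above (sum (\<lambda>C. (ht C z)\<^sup>2) ` {F. F \<subseteq> cosets - J \<and> finite F})"
      using sum_ht_le[OF z] by (intro bdd_aboveI[of _ 48]) (force simp: J_def not_less)
  qed simp
  then have s: "(\<lambda>C. (ht C z)\<^sup>2 / (Im z)\<^sup>2 / sqrt (Im z) ^ (k - 4)) summable_on (cosets - J)"
    unfolding divide_inverse by (intro summable_on_cmult_left)
  have "(\<lambda>C. 1 / cmod (jf (rep C) z) ^ k) summable_on (cosets - J)"
  proof (rule summable_on_comparison_test[OF s])
    fix C assume C: "C \<in> cosets - J"
    let ?u = "cmod (jf (rep C) z)"
    have u: "0 < ?u" using C det_rep[of C] z jf_nonzero by auto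
    have "Im z \<le> ?u\<^sup>2"
      using C u z by (auto simp: J_def ht_eq not_less divide_le_eq_1)
    then have "sqrt (Im z) \<le> ?u"
      using u by (metis less_imp_le real_le_lsqrt real_sqrt_le_iff real_sqrt_unique)
    then have "sqrt (Im z) ^ (k - 4) \<le> ?u ^ (k - 4)"
      using z by (intro power_mono) auto
    then have "1 / ?u ^ 4 / ?u ^ (k - 4) \<le> 1 / ?u ^ 4 / sqrt (Im z) ^ (k - 4)"
      using u z by (intro divide_left_mono mult_pos_pos) auto
    moreover have "?u ^ k = ?u ^ 4 * ?u ^ (k - 4)"
      using k by (simp add: power_add[symmetric])
    moreover have "(ht C z)\<^sup>2 / (Im z)\<^sup>2 = 1 / ?u ^ 4"
      using C z by (simp add: ht_eq power_divide)
    ultimately show "1 / ?u ^ k \<le> (ht C z)\<^sup>2 / (Im z)\<^sup>2 / sqrt (Im z) ^ (k - 4)"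
      by simp
  qed simp
  moreover have "(\<lambda>C. 1 / cmod (jf (rep C) z) ^ k) summable_on J"
    using \<open>finite J\<close> by (rule summable_on_finite)
  ultimately have "(\<lambda>C. 1 / cmod (jf (rep C) z) ^ k) summable_on ((cosets - J) \<union> J)"
    by (rule summable_on_Un_disjoint) auto
  moreover have "(cosets - J) \<union> J = cosets"
    by (auto simp: J_def)
  ultimately show ?thesis by simp
qed

text \<open>A summable real family has countable support, and 1/|j|^4 at the point i vanishes
  nowhere. Countability is what later permits exchanging sums over cosets with integrals and
  almost-everywhere statements.\<close>

lemma countable_cosets: "countable cosets"
proof -
  have "countable {C \<in> cosets. 1 / cmod (jf (rep C) \<i>) ^ 4 \<noteq> 0}"
    by (rule summable_countable_real) (rule summable_jf; simp)
  moreover have "{C \<in> cosets. 1 / cmod (jf (rep C) \<i>) ^ 4 \<noteq> 0} = cosets"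
    using jf_nonzero[of "rep _" \<i>] det_rep by auto
  ultimately show ?thesis by simp
qed

end

text \<open>Transfers convergence from the single point i to a half-strip, with a constant depending
  only on \<open>X\<close> and \<open>Y\<close>. The idea is d = (cx + d) - cx, together with c^2 <=
  (cy)^2 / Y^2.\<close>

lemma jf_compare:
  assumes "\<bar>Re z\<bar> \<le> X" "0 < Y" "Y \<le> Im z"
  shows "(cmod (jf A \<i>))\<^sup>2 \<le> (2 + (1 + 2 * X\<^sup>2) / Y\<^sup>2) * (cmod (jf A z))\<^sup>2"
proof -
  define c d x y where "c = A$2$1" "d = A$2$2" "x = Re z" "y = Im z"
  note defs = this
  have x: "x\<^sup>2 \<le> X\<^sup>2"
    using power_mono[OF assms(1), of 2] by (simp add: defs)
  have y: "Y\<^sup>2 \<le> y\<^sup>2"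
    using assms by (auto simp: defs intro!: power_mono)
  \<comment> \<open>This square is exactly the gap between the two sides of the next
    inequality.\<close>
  have "0 \<le> (2 * c * x + d)\<^sup>2" by simp
  then have "d\<^sup>2 \<le> 2 * (c * x + d)\<^sup>2 + 2 * (c\<^sup>2 * x\<^sup>2)"
    by (simp add: power2_eq_square algebra_simps)
  then have "c\<^sup>2 + d\<^sup>2 \<le> 2 * (c * x + d)\<^sup>2 + (1 + 2 * x\<^sup>2) * c\<^sup>2"
    by (simp add: algebra_simps)
  also have "\<dots> \<le> 2 * (c * x + d)\<^sup>2 + (1 + 2 * X\<^sup>2) * c\<^sup>2"
    using x by (intro add_mono mult_right_mono) auto
  also have "\<dots> \<le> 2 * (c * x + d)\<^sup>2 + (1 + 2 * X\<^sup>2) * c\<^sup>2 * (y\<^sup>2 / Y\<^sup>2)"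
    using y assms mult_left_mono[of 1 "y\<^sup>2 / Y\<^sup>2" "(1 + 2 * X\<^sup>2) * c\<^sup>2"]
    by (intro add_left_mono) simp
  also have "2 * (c * x + d)\<^sup>2 + (1 + 2 * X\<^sup>2) * c\<^sup>2 * (y\<^sup>2 / Y\<^sup>2) \<le>
      (2 + (1 + 2 * X\<^sup>2) / Y\<^sup>2) * ((c * x + d)\<^sup>2 + (c * y)\<^sup>2)"
    by (simp add: algebra_simps power_mult_distrib add_divide_distrib)
  finally show ?thesis
    by (simp add: cmod_def Im_jf Re_jf defs add.commute)
qed

section \<open>Invariance of the hyperbolic measure\<close>

lemma sets_hyp [simp, measurable_cong]: "sets hyp_measure = sets borel"
  and space_hyp [simp]: "space hyp_measure = UNIV"
  by (simp_all add: hyp_measure_def)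

lemma uhp_sets [measurable]: "upper_half_plane \<in> sets borel"
  by (rule borel_open[OF open_uhp])

lemma measurable_Complex [measurable (raw)]:
  assumes "f \<in> borel_measurable M" "g \<in> borel_measurable M"
  shows "(\<lambda>x. Complex (f x) (g x)) \<in> borel_measurable M"
proof -
  have "(\<lambda>x. Complex (f x) (g x)) = (\<lambda>x. of_real (f x) + \<i> * of_real (g x))"
    by (simp add: complex_eq_iff fun_eq_iff)
  then show ?thesis
    using assms by simp
qed

lemma measurable_case_Complex [measurable]:
  "(\<lambda>(x, y). Complex x y) \<in> borel_measurable (borel :: (real \<times> real) measure)"
  unfolding case_prod_beta
  by (intro measurable_Complex borel_measurable_continuous_onI continuous_intros)

text \<open>Boxes correspond to boxes of the same volume, which determines Lebesgue measure. The
  pair model serves Fubini's theorem in \<open>integral_hyp\<close>.\<close>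

lemma lborel_complex_prod:
  "distr (lborel :: (real \<times> real) measure) borel (\<lambda>(x, y). Complex x y) = lborel"
proof (rule sym, rule lborel_eqI)
  fix l u :: complex
  assume le: "\<And>b. b \<in> Basis \<Longrightarrow> l \<bullet> b \<le> u \<bullet> b"
  have le': "Re l \<le> Re u" "Im l \<le> Im u"
    using le[of 1] le[of \<i>] by (auto simp: Basis_complex_def)
  have "emeasure (distr lborel borel (\<lambda>(x, y). Complex x y)) (box l u) =
      emeasure lborel (box (Re l, Im l) (Re u, Im u))"
    by (subst emeasure_distr)
      (auto intro!: arg_cong[where f = "emeasure lborel"] simp: mem_box Basis_complex_def Basis_prod_def)
  also have "\<dots> = (\<Prod>b\<in>Basis. ((Re u, Im u) - (Re l, Im l)) \<bullet> b)"
    using le' by (intro emeasure_lborel_box) (auto simp: Basis_prod_def)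
  also have "\<dots> = (\<Prod>b\<in>Basis. (u - l) \<bullet> b)"
    by (simp add: Basis_complex_def Basis_prod_def mult.commute)
  finally show "emeasure (distr lborel borel (\<lambda>(x, y). Complex x y)) (box l u) = (\<Prod>b\<in>Basis. (u - l) \<bullet> b)" .
qed simp

text \<open>A second model of the plane, used for
  \<open>has_absolute_integral_change_of_variables\<close>, which speaks about
  \<open>real^'m\<close>.\<close>

definition vec_complex :: "real^2 \<Rightarrow> complex" where
  "vec_complex v = Complex (v$1) (v$2)"

definition complex_vec :: "complex \<Rightarrow> real^2" where
  "complex_vec z = vector [Re z, Im z]"

lemma vec_complex_inverse [simp]: "complex_vec (vec_complex v) = v" "vec_complex (complex_vec z) = z"
  by (simp_all add: vec_complex_def complex_vec_def vec_eq_iff forall_2)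

lemma linear_vec_complex: "linear vec_complex" and linear_complex_vec: "linear complex_vec"
  by (auto intro!: linearI simp: vec_complex_def complex_vec_def complex_eq_iff vec_eq_iff forall_2)

lemma measurable_vec_complex [measurable]: "vec_complex \<in> borel_measurable borel"
  by (intro borel_measurable_continuous_onI linear_continuous_on
      linear_conv_bounded_linear[THEN iffD1] linear_vec_complex)

lemma Basis_real2: "(Basis :: (real^2) set) = {axis 1 1, axis 2 1}"
  by (auto simp: Basis_vec_def UNIV_2)

lemma lborel_vec_complex: "distr lborel borel vec_complex = lborel"
proof (rule sym, rule lborel_eqI)
  fix l u :: complex
  assume le: "\<And>b. b \<in> Basis \<Longrightarrow> l \<bullet> b \<le> u \<bullet> b"
  have le': "Re l \<le> Re u" "Im l \<le> Im u"
    using le[of 1] le[of \<i>] by (auto simp: Basis_complex_def)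
  have ax: "axis 1 (1::real) \<noteq> (axis 2 1 :: real^2)"
    by (simp add: axis_eq_axis)
  have "emeasure (distr lborel borel vec_complex) (box l u) =
      emeasure lborel (box (complex_vec l) (complex_vec u))"
    by (subst emeasure_distr) (auto intro!: arg_cong[where f = "emeasure lborel"]
        simp: mem_box Basis_complex_def Basis_real2 inner_axis vec_complex_def complex_vec_def)
  also have "\<dots> = (\<Prod>b\<in>Basis. (complex_vec u - complex_vec l) \<bullet> b)"
    using le' by (intro emeasure_lborel_box) (auto simp: Basis_real2 inner_axis complex_vec_def)
  also have "\<dots> = (\<Prod>b\<in>Basis. (u - l) \<bullet> b)"
    using ax by (simp add: Basis_complex_def Basis_real2 inner_axis complex_vec_def)
  finally show "emeasure (distr lborel borel vec_complex) (box l u) = (\<Prod>b\<in>Basis. (u - l) \<bullet> b)" .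
qed simp

lemma measurable_mact [measurable]: "mact A \<in> borel_measurable borel"
  unfolding mact_eq jfac_def by measurable

lemma hyp_AE_uhp: "AE z in hyp_measure. z \<in> upper_half_plane"
  unfolding hyp_measure_def
  by (subst AE_density) (auto simp: indicator_def)

lemma emeasure_hyp_Int_uhp: "A \<in> sets borel \<Longrightarrow> emeasure hyp_measure (A \<inter> upper_half_plane) = emeasure hyp_measure A"
  by (rule emeasure_eq_AE) (use hyp_AE_uhp in \<open>auto elim: AE_mp\<close>)

lemma emeasure_hyp_eq:
  assumes A: "A \<in> sets borel" "A \<subseteq> upper_half_plane"
  shows "emeasure hyp_measure A =
    (\<integral>\<^sup>+v. ennreal (indicator (vec_complex -` A) v * (1 / (v$2)\<^sup>2)) \<partial>lborel)"
proof -
  have "emeasure hyp_measure A = (\<integral>\<^sup>+z. (indicator upper_half_plane z * ennreal (1 / (Im z)\<^sup>2)) * indicator A z \<partial>lborel)"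
    using A unfolding hyp_measure_def by (subst emeasure_density) auto
  also have "\<dots> = (\<integral>\<^sup>+z. indicator A z * ennreal (1 / (Im z)\<^sup>2) \<partial>distr lborel borel vec_complex)"
    unfolding lborel_vec_complex using A(2) by (intro nn_integral_cong) (auto simp: indicator_def)
  also have "\<dots> = (\<integral>\<^sup>+v. indicator A (vec_complex v) * ennreal (1 / (Im (vec_complex v))\<^sup>2) \<partial>lborel)"
    using A by (subst nn_integral_distr) auto
  also have "\<dots> = (\<integral>\<^sup>+v. ennreal (indicator (vec_complex -` A) v * (1 / (v$2)\<^sup>2)) \<partial>lborel)"
    by (intro nn_integral_cong) (auto simp: indicator_def vec_complex_def)
  finally show ?thesis .
qed

lemma borel_vec_nth [measurable]: "(\<lambda>v. v$i) \<in> borel_measurable (borel :: (real^2) measure)"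
  by (intro borel_measurable_continuous_onI continuous_intros)

text \<open>Puts a finite measure into the shape "absolutely integrable with integral
  \<open>b\<close>", which is the shape of both sides of the change-of-variables
  equivalence.\<close>

lemma emeasure_hyp_iff:
  assumes A: "A \<in> sets borel" "A \<subseteq> upper_half_plane" and "0 \<le> b"
  shows "emeasure hyp_measure A = ennreal b \<longleftrightarrow>
    (\<lambda>v. 1 / (v$2)\<^sup>2) absolutely_integrable_on (vec_complex -` A) \<and>
    integral (vec_complex -` A) (\<lambda>v. 1 / (v$2)\<^sup>2) = b"
proof -
  let ?S = "vec_complex -` A" and ?f = "\<lambda>v::real^2. 1 / (v$2)\<^sup>2"
  have S [measurable]: "?S \<in> sets borel"
    using measurable_sets[OF measurable_vec_complex A(1)] by simp
  have m: "(\<lambda>v. indicator ?S v * ?f v) \<in> borel_measurable borel"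
    by measurable
  have "emeasure hyp_measure A = ennreal b \<longleftrightarrow>
      integrable lborel (\<lambda>v. indicator ?S v * ?f v) \<and> integral\<^sup>L lborel (\<lambda>v. indicator ?S v * ?f v) = b"
    unfolding emeasure_hyp_eq[OF A] using m \<open>0 \<le> b\<close> by (intro nn_integral_eq_integrable) auto
  also have "\<dots> \<longleftrightarrow> set_integrable lebesgue ?S ?f \<and> set_lebesgue_integral lebesgue ?S ?f = b"
    using m by (simp add: set_integrable_def set_lebesgue_integral_def integrable_completion integral_completion)
  also have "\<dots> \<longleftrightarrow> ?f absolutely_integrable_on ?S \<and> integral ?S ?f = b"
    using set_lebesgue_integral_eq_integral[of ?S ?f] by auto
  finally show ?thesis .
qed

lemma mact_has_derivative:
  assumes "det A = 1" "0 < Im z"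
  shows "(mact A has_field_derivative 1 / (jf A z)\<^sup>2) (at z within S)"
proof -
  have j: "jf A z \<noteq> 0" by (rule jf_nonzero) fact+
  have d: "complex_of_real (A$1$1) * of_real (A$2$2) - of_real (A$1$2) * of_real (A$2$1) = 1"
    using assms(1) unfolding det_2 of_real_mult[symmetric] of_real_diff[symmetric] by simp
  have "((\<lambda>z. (of_real (A$1$1) * z + of_real (A$1$2)) / (of_real (A$2$1) * z + of_real (A$2$2)))
      has_field_derivative (of_real (A$1$1) * (of_real (A$2$1) * z + of_real (A$2$2)) -
        (of_real (A$1$1) * z + of_real (A$1$2)) * of_real (A$2$1)) /
        ((of_real (A$2$1) * z + of_real (A$2$2)) * (of_real (A$2$1) * z + of_real (A$2$2)))) (at z within S)"
    using j by (auto intro!: derivative_eq_intros simp: jfac_def)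
  also have "of_real (A$1$1) * (of_real (A$2$1) * z + of_real (A$2$2)) -
        (of_real (A$1$1) * z + of_real (A$1$2)) * of_real (A$2$1) =
      complex_of_real (A$1$1) * of_real (A$2$2) - of_real (A$1$2) * of_real (A$2$1)"
    by (simp add: algebra_simps)
  finally show ?thesis
    unfolding d mact_eq jfac_def map_matrix_nth power2_eq_square .
qed

lemma mact_image_eq:
  assumes "det A = 1" "B \<subseteq> upper_half_plane"
  shows "mact A ` B = mact (inv2 A) -` B \<inter> upper_half_plane"
proof (intro equalityI subsetI)
  fix z assume "z \<in> mact (inv2 A) -` B \<inter> upper_half_plane"
  then show "z \<in> mact A ` B"
    using assms by (intro image_eqI[of _ _ "mact (inv2 A) z"]) (auto simp: mact_inv2)
qed (use assms in \<open>auto simp: mact_inv2 Im_mact_pos\<close>)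

lemma mact_image_sets:
  assumes "det A = 1" "B \<subseteq> upper_half_plane" "B \<in> sets borel"
  shows "mact A ` B \<in> sets borel"
  unfolding mact_image_eq[OF assms(1,2)]
  using measurable_sets[OF measurable_mact assms(3), of "inv2 A"] by auto

text \<open>The complex derivative 1/j^2 has real Jacobian 1/|j|^4, and Im shrinks by |j|^2; the two
  effects cancel in the density 1/y^2.\<close>

lemma emeasure_hyp_image:
  assumes A: "det A = 1" and B: "B \<in> sets borel" "B \<subseteq> upper_half_plane"
  shows "emeasure hyp_measure (mact A ` B) = emeasure hyp_measure B"
proof -
  define S where "S = vec_complex -` B"
  define g where "g v = complex_vec (mact A (vec_complex v))" for v
  define w where "w v = 1 / (jf A (vec_complex v))\<^sup>2" for v
  define g' where "g' v h = complex_vec (w v * vec_complex h)" for v h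
  have S: "S \<in> sets borel"
    unfolding S_def using measurable_sets[OF measurable_vec_complex B(1)] by simp
  have pos: "0 < Im (vec_complex v)" if "v \<in> S" for v
    using that B(2) by (auto simp: S_def)
  have gS: "g ` S = vec_complex -` (mact A ` B)"
  proof (intro equalityI subsetI)
    fix v assume "v \<in> vec_complex -` (mact A ` B)"
    then obtain z where "z \<in> B" "vec_complex v = mact A z" by auto
    then have "g (complex_vec z) = complex_vec (vec_complex v)" "complex_vec z \<in> S"
      by (simp_all add: g_def S_def)
    then show "v \<in> g ` S" by (metis image_eqI vec_complex_inverse(1))
  qed (auto simp: g_def S_def)
  have inj: "inj_on (mact A) B"
    by (rule inj_on_inverseI[where g = "mact (inv2 A)"]) (use A B(2) in \<open>auto simp: mact_inv2\<close>)
  have im: "mact A ` B \<in> sets borel" "mact A ` B \<subseteq> upper_half_plane"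
    using mact_image_sets[OF A B(2,1)] A B(2) by (auto simp: Im_mact_pos)
  have der: "(g has_derivative g' v) (at v within S)" if "v \<in> S" for v
  proof -
    have m: "(mact A has_derivative (*) (w v)) (at (vec_complex v) within vec_complex ` S)"
      unfolding w_def by (rule has_field_derivative_imp_has_derivative[OF mact_has_derivative[OF A pos[OF that]]])
    have bl: "bounded_linear vec_complex" "bounded_linear complex_vec"
      using linear_vec_complex linear_complex_vec by (simp_all only: linear_conv_bounded_linear)
    have "((\<lambda>x. mact A (vec_complex x)) has_derivative (\<lambda>h. w v * vec_complex h)) (at v within S)"
      using has_derivative_in_compose[OF bounded_linear_imp_has_derivative[OF bl(1)] m] .
    from bounded_linear.has_derivative[OF bl(2) this]
    show ?thesis
      unfolding g_def[abs_def] g'_def[abs_def] .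
  qed
  have injg: "inj_on g S"
  proof (rule inj_onI)
    fix u v assume *: "u \<in> S" "v \<in> S" "g u = g v"
    then have "vec_complex (g u) = vec_complex (g v)" by simp
    then have "mact A (vec_complex u) = mact A (vec_complex v)"
      by (simp add: g_def)
    then have "vec_complex u = vec_complex v"
      using * by (intro inj_onD[OF inj, of "vec_complex u" "vec_complex v"]) (simp_all add: S_def)
    then have "complex_vec (vec_complex u) = complex_vec (vec_complex v)" by simp
    then show "u = v" by simp
  qed
  \<comment> \<open>The change of variables formula wants vector-valued integrands, so the density
    is viewed as a vector of dimension 1.\<close>
  let ?f = "\<lambda>v::real^2. (vec (1 / (v$2)\<^sup>2) :: real^1)"
  \<comment> \<open>Multiplication by a complex number acts on the plane with determinant its
    squared modulus.\<close>
  have det: "det (matrix (g' v)) = (cmod (w v))\<^sup>2" for v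
    by (simp add: det_2 matrix_def g'_def complex_vec_def vec_complex_def axis_def cmod_def power2_eq_square)
  have jac: "\<bar>det (matrix (g' v))\<bar> *\<^sub>R ?f (g v) = ?f v" if "v \<in> S" for v
  proof -
    let ?j = "jf A (vec_complex v)"
    have j: "?j \<noteq> 0"
      using A pos[OF that] by (rule jf_nonzero)
    have "g v $ 2 = Im (mact A (vec_complex v))"
      by (simp add: g_def complex_vec_def)
    also have "\<dots> = v $ 2 / (cmod ?j)\<^sup>2"
      using A pos[OF that] by (subst Im_mact) (auto simp: vec_complex_def)
    finally have g2: "g v $ 2 = v $ 2 / (cmod ?j)\<^sup>2" .
    have "(cmod (w v))\<^sup>2 * (1 / (g v $ 2)\<^sup>2) = 1 / (v $ 2)\<^sup>2"
      unfolding g2 w_def using j pos[OF that]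
      by (simp add: norm_divide norm_power power_divide)
    then show ?thesis
      unfolding det by (simp add: vec_eq_iff)
  qed
  have "(?f absolutely_integrable_on S \<and> integral S ?f = vec b) \<longleftrightarrow>
      (?f absolutely_integrable_on g ` S \<and> integral (g ` S) ?f = vec b)" for b
  proof -
    have "((\<lambda>v. \<bar>det (matrix (g' v))\<bar> *\<^sub>R ?f (g v)) absolutely_integrable_on S \<and>
        integral S (\<lambda>v. \<bar>det (matrix (g' v))\<bar> *\<^sub>R ?f (g v)) = vec b) \<longleftrightarrow>
      (?f absolutely_integrable_on g ` S \<and> integral (g ` S) ?f = vec b)"
      using S der injg by (intro has_absolute_integral_change_of_variables) auto
    moreover have "(\<lambda>v. \<bar>det (matrix (g' v))\<bar> *\<^sub>R ?f (g v)) absolutely_integrable_on S \<longleftrightarrow>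
        ?f absolutely_integrable_on S"
      unfolding absolutely_integrable_on_1_iff
      by (intro set_integrable_cong) (use jac in auto)
    moreover have "integral S (\<lambda>v. \<bar>det (matrix (g' v))\<bar> *\<^sub>R ?f (g v)) = integral S ?f"
      by (rule Henstock_Kurzweil_Integration.integral_cong) (rule jac)
    ultimately show ?thesis by simp
  qed
  then have key: "((\<lambda>v. 1 / (v$2)\<^sup>2) absolutely_integrable_on S \<and> integral S (\<lambda>v. 1 / (v$2)\<^sup>2) = b) \<longleftrightarrow>
      ((\<lambda>v. 1 / (v$2)\<^sup>2) absolutely_integrable_on g ` S \<and> integral (g ` S) (\<lambda>v. 1 / (v$2)\<^sup>2) = b)" for b :: real
    unfolding absolutely_integrable_on_1_iff integral_on_1_eq by (simp add: vec_eq_iff)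
  have iff: "emeasure hyp_measure B = ennreal b \<longleftrightarrow> emeasure hyp_measure (mact A ` B) = ennreal b" if "0 \<le> b" for b
    unfolding emeasure_hyp_iff[OF B that] emeasure_hyp_iff[OF im that] using key[of b]
    unfolding gS unfolding S_def .
  show ?thesis
  proof (cases "emeasure hyp_measure B" rule: ennreal_cases)
    case (real b)
    then show ?thesis using iff[of b] by simp
  next
    \<comment> \<open>If the image had finite measure, \<open>iff\<close> would make the measure of
      \<open>B\<close> finite as well.\<close>
    case top
    then show ?thesis
      using iff by (cases "emeasure hyp_measure (mact A ` B)" rule: ennreal_cases) auto
  qed
qed

text \<open>The preimage of a set is its image under the inverse matrix, but only inside the upper
  half plane; the rest of the plane is null and is discarded first.\<close>

lemma distr_hyp_mact:
  assumes A: "det A = 1"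
  shows "distr hyp_measure borel (mact A) = hyp_measure"
proof (rule measure_eqI)
  fix B assume "B \<in> sets (distr hyp_measure borel (mact A))"
  then have B: "B \<in> sets borel" by simp
  have pre: "mact A -` B \<in> sets borel"
    using measurable_sets[OF measurable_mact B] by simp
  have eq: "mact A -` B \<inter> upper_half_plane = mact (inv2 A) ` (B \<inter> upper_half_plane)"
    using A by (auto simp: mact_image_eq Im_mact_pos)
  have "emeasure (distr hyp_measure borel (mact A)) B = emeasure hyp_measure (mact A -` B)"
    using B by (subst emeasure_distr) auto
  also have "\<dots> = emeasure hyp_measure (mact A -` B \<inter> upper_half_plane)"
    using emeasure_hyp_Int_uhp[OF pre] by simp
  also have "\<dots> = emeasure hyp_measure (B \<inter> upper_half_plane)"
    unfolding eq using A B by (intro emeasure_hyp_image) auto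
  also have "\<dots> = emeasure hyp_measure B"
    using B by (rule emeasure_hyp_Int_uhp)
  finally show "emeasure (distr hyp_measure borel (mact A)) B = emeasure hyp_measure B" .
qed simp

section \<open>Unfolding\<close>

lemma inv2_uminus: "inv2 (- A) = - inv2 A"
  by (rule mat2_eqI) (simp_all add: inv2_def)

definition strip :: "complex set" where
  "strip = {w. 0 \<le> Re w \<and> Re w < 1 \<and> 0 < Im w}"

definition red :: "complex \<Rightarrow> complex" where
  "red w = w - of_int \<lfloor>Re w\<rfloor>"

lemma strip_sets [measurable]: "strip \<in> sets borel"
  unfolding strip_def by measurable

lemma measurable_red [measurable]: "red \<in> borel_measurable borel"
proof -
  have "(\<lambda>w. w - complex_of_real (of_int \<lfloor>Re w\<rfloor>)) \<in> borel_measurable borel"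
    by measurable
  also have "(\<lambda>w. w - complex_of_real (of_int \<lfloor>Re w\<rfloor>)) = red"
    by (simp add: red_def fun_eq_iff)
  finally show ?thesis .
qed

text \<open>The strip is half-open so that exactly one integer translate of each point lies in it,
  with no exceptional set.\<close>

lemma add_of_int_strip_iff:
  assumes "0 < Im w"
  shows "w + of_int l \<in> strip \<longleftrightarrow> l = - \<lfloor>Re w\<rfloor>"
proof -
  have "w + of_int l \<in> strip \<longleftrightarrow> \<lfloor>Re w + of_int l\<rfloor> = 0"
    unfolding floor_eq_iff using assms by (simp add: strip_def)
  also have "\<dots> \<longleftrightarrow> l = - \<lfloor>Re w\<rfloor>"
    by simp linarith
  finally show ?thesis .
qed

lemma nn_integral_hyp_mact:
  assumes "det A = 1" and f [measurable]: "f \<in> borel_measurable borel"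
  shows "(\<integral>\<^sup>+z. f (mact A z) \<partial>hyp_measure) = (\<integral>\<^sup>+z. f z \<partial>hyp_measure)"
proof -
  have "(\<integral>\<^sup>+z. f z \<partial>distr hyp_measure borel (mact A)) = (\<integral>\<^sup>+z. f (mact A z) \<partial>hyp_measure)"
    by (rule nn_integral_distr) auto
  then show ?thesis
    unfolding distr_hyp_mact[OF assms(1)] by simp
qed

section \<open>Translates of the fundamental domain\<close>

locale cusp_group_domain = cusp_group +
  fixes D :: "complex set"
  assumes dom: "fundamental_domain \<Gamma> D"
    and finite_D: "emeasure hyp_measure D < \<infinity>"
begin

lemma D_sets [measurable]: "D \<in> sets borel" and D_sub: "D \<subseteq> upper_half_plane"
  and D_cover: "0 < Im z \<Longrightarrow> \<exists>A\<in>\<Gamma>. mact A z \<in> D"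
  and D_null: "A \<in> \<Gamma> \<Longrightarrow> A \<noteq> mat 1 \<Longrightarrow> A \<noteq> - mat 1 \<Longrightarrow> emeasure hyp_measure (D \<inter> mact A ` D) = 0"
  using dom by (auto simp: fundamental_domain_def)

text \<open>The pairs (C, l) enumerate the group modulo sign: every element is plus or minus exactly
  one \<open>lam C l\<close>.\<close>

definition lam :: "(real^2^2) set \<Rightarrow> int \<Rightarrow> real^2^2" where
  "lam C l = transl (of_int l) ** rep C"

lemma lam_mem: "C \<in> cosets \<Longrightarrow> lam C l \<in> \<Gamma>"
  unfolding lam_def by (intro mult_mem transl_mem rep_mem)

lemma det_lam [simp]: "C \<in> cosets \<Longrightarrow> det (lam C l) = 1"
  by (rule det_mem[OF lam_mem])

lemma mact_lam: "C \<in> cosets \<Longrightarrow> 0 < Im z \<Longrightarrow> mact (lam C l) z = mact (rep C) z + of_int l"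
  unfolding lam_def by (subst mact_mult) (auto simp: det_rep)

lemma coset_lam: "C \<in> cosets \<Longrightarrow> coset (lam C l) = C" "C \<in> cosets \<Longrightarrow> coset (- lam C l) = C"
proof -
  assume C: "C \<in> cosets"
  have "lam C l \<in> coset (rep C)" "- lam C l \<in> coset (rep C)"
    using lam_mem[OF C, of l] uminus_mem[OF lam_mem[OF C, of l]]
    by (auto simp: coset_def lam_def transl_mult_nth)
  then show "coset (lam C l) = C" "coset (- lam C l) = C"
    using coset_eqI coset_rep[OF C] by blast+
qed

lemma lam_inj:
  assumes C: "C \<in> cosets" "C' \<in> cosets" and eq: "lam C' l' = lam C l \<or> lam C' l' = - lam C l"
  shows "C = C' \<and> l = l'"
proof -
  have CC: "C' = C"
    using eq coset_lam C by metis
  have "lam C l ** inv2 (rep C) = transl (of_int l)" for l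
    using det_rep[OF C(1)] by (simp add: lam_def matrix_mul_assoc[symmetric] inv2_right)
  moreover have "(- lam C l) ** inv2 (rep C) = - (lam C l ** inv2 (rep C))"
    by (rule mat2_eqI) (simp_all add: matmul2_nth)
  ultimately have "transl (of_int l') = transl (of_int l) \<or> transl (of_int l') = - transl (of_int l)"
    using eq CC by metis
  \<comment> \<open>The minus sign is excluded by the upper left entry, which is 1 for every
    translation; otherwise the upper right entry determines the integer.\<close>
  then have "transl (of_int l')$1$2 = transl (of_int l)$1$2 \<and> transl (of_int l')$1$1 = transl (of_int l)$1$1 \<or>
      transl (of_int l')$1$1 = - transl (of_int l)$1$1"
    by auto
  then show ?thesis
    using CC by (simp add: transl_def)
qed

text \<open>A common point of two translates of \<open>D\<close> lies in the
  \<open>lam C l\<close>-image of the overlap of \<open>D\<close> with B D, where B = (lam C l)^-1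
  lam C' l'. Since B is not plus or minus 1, the overlap is null, and invariance of the measure
  keeps its image null.\<close>

lemma lam_AE_disjoint:
  assumes C: "C \<in> cosets" "C' \<in> cosets" and ne: "(C, l) \<noteq> (C', l')"
  shows "AE w in hyp_measure. \<not> (mact (inv2 (lam C l)) w \<in> D \<and> mact (inv2 (lam C' l')) w \<in> D)"
proof -
  define B where "B = inv2 (lam C l) ** lam C' l'"
  have B: "B \<in> \<Gamma>"
    unfolding B_def using C by (intro mult_mem inv2_mem lam_mem)
  have "lam C l ** B = lam C' l'"
    using C by (simp add: B_def matrix_mul_assoc inv2_right)
  moreover have "lam C l ** (- mat 1) = - lam C l"
    by (rule mat2_eqI) (simp_all add: matmul2_nth mat2_one_nth)
  ultimately have "B \<noteq> mat 1" "B \<noteq> - mat 1"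
    using lam_inj[OF C] ne by (metis matrix_mul_rid)+
  then have "emeasure hyp_measure (D \<inter> mact B ` D) = 0"
    using D_null[OF B] by simp
  moreover have m: "D \<inter> mact B ` D \<in> sets borel"
    using mact_image_sets[OF det_mem[OF B] D_sub D_sets] by auto
  ultimately have "emeasure hyp_measure (mact (lam C l) ` (D \<inter> mact B ` D)) = 0"
    using C D_sub by (subst emeasure_hyp_image) auto
  moreover have "mact (lam C l) ` (D \<inter> mact B ` D) \<in> sets borel"
    using C D_sub m by (intro mact_image_sets) auto
  ultimately have null: "mact (lam C l) ` (D \<inter> mact B ` D) \<in> null_sets hyp_measure"
    by (intro null_setsI) auto
  have "AE w in hyp_measure. w \<notin> mact (lam C l) ` (D \<inter> mact B ` D)"
    by (rule AE_not_in) (rule null)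
  with hyp_AE_uhp show ?thesis
  proof eventually_elim
    case (elim w)
    show ?case
    proof
      assume w: "mact (inv2 (lam C l)) w \<in> D \<and> mact (inv2 (lam C' l')) w \<in> D"
      let ?u = "mact (inv2 (lam C' l')) w"
      have "0 < Im ?u" using w D_sub by auto
      then have "mact B ?u = mact (inv2 (lam C l)) w"
        unfolding B_def using C elim by (subst mact_mult) (auto simp: mact_inv2)
      then have "mact (inv2 (lam C l)) w \<in> D \<inter> mact B ` D"
        using w by force
      then have "mact (lam C l) (mact (inv2 (lam C l)) w) \<in> mact (lam C l) ` (D \<inter> mact B ` D)"
        by blast
      then show False
        using elim C by (simp add: mact_inv2)
    qed
  qed
qed

lemma lam_cover:
  assumes w: "0 < Im w"
  shows "\<exists>C\<in>cosets. \<exists>l. mact (inv2 (lam C l)) w \<in> D"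
proof -
  obtain A where A: "A \<in> \<Gamma>" "mact A w \<in> D"
    using D_cover[OF w] by blast
  define C where "C = coset (inv2 A)"
  have C: "C \<in> cosets"
    using A inv2_mem by (auto simp: C_def mem_cosets)
  have "inv2 A \<in> coset (rep C)"
    using coset_refl[OF inv2_mem[OF A(1)]] unfolding coset_rep[OF C] by (simp add: C_def)
  then obtain l :: int where "inv2 A = lam C l \<or> inv2 A = - lam C l"
    using coset_cases[OF rep_mem[OF C], of "inv2 A"] unfolding lam_def by blast
  then have "A = inv2 (lam C l) \<or> A = - inv2 (lam C l)"
    by (metis inv2_inv2 inv2_uminus)
  then have "mact (inv2 (lam C l)) w = mact A w"
    by auto
  then show ?thesis
    using A(2) C by (intro bexI[of _ C] exI[of _ l]) simp_all
qed

text \<open>Almost every point lies in exactly one translate: at least one by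
  \<open>lam_cover\<close>, and at most one because the countably many pairwise exceptional sets can
  be united.\<close>

lemma AE_sum_lam:
  "AE w in hyp_measure. (\<integral>\<^sup>+C. \<integral>\<^sup>+l. indicator D (mact (inv2 (lam C l)) w)
     \<partial>count_space UNIV \<partial>count_space cosets) = (1::ennreal)"
proof -
  have "AE w in hyp_measure. \<forall>C\<in>cosets. \<forall>l. \<forall>C'\<in>cosets. \<forall>l'. (C, l) \<noteq> (C', l') \<longrightarrow>
      \<not> (mact (inv2 (lam C l)) w \<in> D \<and> mact (inv2 (lam C' l')) w \<in> D)"
    using lam_AE_disjoint countable_cosets
    by (simp add: AE_ball_countable AE_all_countable)
  with hyp_AE_uhp show ?thesis
  proof eventually_elim
    case (elim w)
    then obtain C l where C: "C \<in> cosets" "mact (inv2 (lam C l)) w \<in> D"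
      using lam_cover[of w] by auto
    have "indicator D (mact (inv2 (lam C' l')) w) = indicator {C} C' * (indicator {l} l' :: ennreal)"
      if "C' \<in> cosets" for C' l'
    proof -
      have "mact (inv2 (lam C' l')) w \<in> D \<longleftrightarrow> C' = C \<and> l' = l"
        using elim(2) C that by blast
      then show ?thesis
        by (simp add: indicator_def)
    qed
    then have "(\<integral>\<^sup>+C. \<integral>\<^sup>+l. indicator D (mact (inv2 (lam C l)) w) \<partial>count_space UNIV \<partial>count_space cosets) =
      (\<integral>\<^sup>+C'. \<integral>\<^sup>+l'. indicator {C} C' * (indicator {l} l' :: ennreal) \<partial>count_space UNIV \<partial>count_space cosets)"
      by (intro nn_integral_cong) simp
    also have "\<dots> = 1"
      using C(1) by (simp add: nn_integral_cmult)
    finally show ?case .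
  qed
qed

definition domain_measure :: "complex measure" where
  "domain_measure = restrict_space hyp_measure D"

lemma space_domain [simp]: "space domain_measure = D"
  by (simp add: domain_measure_def space_restrict_space)

lemma measurable_domain: "f \<in> borel_measurable borel \<Longrightarrow> f \<in> borel_measurable domain_measure"
  unfolding domain_measure_def by (rule measurable_restrict_space1) simp

lemma finite_measure_domain: "finite_measure domain_measure"
  unfolding domain_measure_def
  by (rule finite_measureI) (use finite_D in \<open>simp add: space_restrict_space emeasure_restrict_space\<close>)

text \<open>Disjoint copies of \<open>D\<close>, one per coset: integrating against it is summing
  over cosets and integrating over \<open>D\<close>.\<close>

definition unfold_measure :: "((real^2^2) set \<times> complex) measure" where
  "unfold_measure = count_space cosets \<Otimes>\<^sub>M domain_measure"

lemma space_unfold: "space unfold_measure = cosets \<times> D"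
  by (simp add: unfold_measure_def space_pair_measure)

lemma measurable_unfold:
  assumes "\<And>C. C \<in> cosets \<Longrightarrow> (\<lambda>z. f (C, z)) \<in> borel_measurable borel"
  shows "f \<in> borel_measurable unfold_measure"
  unfolding unfold_measure_def
  by (rule measurable_pair_measure_countable1[OF countable_cosets measurable_domain[OF assms]])

lemma nn_integral_unfold:
  assumes "f \<in> borel_measurable unfold_measure"
  shows "(\<integral>\<^sup>+x. f x \<partial>unfold_measure) = (\<integral>\<^sup>+C. \<integral>\<^sup>+z. f (C, z) \<partial>domain_measure \<partial>count_space cosets)"
proof -
  interpret finite_measure domain_measure by (rule finite_measure_domain)
  show ?thesis
    using nn_integral_fst[OF assms[unfolded unfold_measure_def]] by (simp add: unfold_measure_def)
qed

lemma measurable_red_rep: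
  "(\<lambda>(C, z). red (mact (rep C) z)) \<in> borel_measurable unfold_measure"
  by (rule measurable_unfold) simp

text \<open>Unfolding as an identity of measures. The sets \<open>rep C\<close> D and their integer
  translates tile the half plane up to a null set, so after reduction modulo integer translations
  the copies of \<open>D\<close> tile the strip.\<close>

lemma distr_unfold:
  "distr unfold_measure borel (\<lambda>(C, z). red (mact (rep C) z)) =
     density hyp_measure (\<lambda>w. ennreal (indicator strip w))"
proof (rule measure_eqI)
  fix A assume "A \<in> sets (distr unfold_measure borel (\<lambda>(C, z). red (mact (rep C) z)))"
  then have A [measurable]: "A \<in> sets borel" by simp
  have "emeasure (distr unfold_measure borel (\<lambda>(C, z). red (mact (rep C) z))) A =
      (\<integral>\<^sup>+x. indicator A x \<partial>distr unfold_measure borel (\<lambda>(C, z). red (mact (rep C) z)))"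
    by simp
  also have "\<dots> = (\<integral>\<^sup>+x. indicator A (case x of (C, z) \<Rightarrow> red (mact (rep C) z)) \<partial>unfold_measure)"
    by (rule nn_integral_distr[OF measurable_red_rep]) simp
  also have "\<dots> = (\<integral>\<^sup>+C. \<integral>\<^sup>+z. indicator A (red (mact (rep C) z)) \<partial>domain_measure \<partial>count_space cosets)"
    using measurable_red_rep by (subst nn_integral_unfold) auto
  also have "\<dots> = (\<integral>\<^sup>+C. \<integral>\<^sup>+l. \<integral>\<^sup>+w. indicator (A \<inter> strip) w * indicator D (mact (inv2 (lam C l)) w)
      \<partial>hyp_measure \<partial>count_space UNIV \<partial>count_space cosets)"
  proof (rule nn_integral_cong)
    fix C assume "C \<in> space (count_space cosets)"
    then have C: "C \<in> cosets" by simp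
    have "(\<integral>\<^sup>+z. indicator A (red (mact (rep C) z)) \<partial>domain_measure) =
        (\<integral>\<^sup>+z. indicator D z * indicator A (red (mact (rep C) z)) \<partial>hyp_measure)"
      unfolding domain_measure_def by (subst nn_integral_restrict_space) (auto simp: mult.commute)
    also have "\<dots> = (\<integral>\<^sup>+z. \<integral>\<^sup>+l. indicator D z * indicator (A \<inter> strip) (mact (lam C l) z)
        \<partial>count_space UNIV \<partial>hyp_measure)"
    proof (rule nn_integral_cong)
      fix z
      show "indicator D z * indicator A (red (mact (rep C) z)) =
        (\<integral>\<^sup>+l. indicator D z * indicator (A \<inter> strip) (mact (lam C l) z) \<partial>count_space UNIV)"
      proof (cases "z \<in> D")
        case True
        then have z: "0 < Im z" using D_sub by auto
        \<comment> \<open>Only this translate falls into the strip, and there it equals the value of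
          \<open>red\<close>; the sum over \<open>l\<close> has a single term.\<close>
        let ?l = "- \<lfloor>Re (mact (rep C) z)\<rfloor>"
        have "indicator (A \<inter> strip) (mact (lam C l) z) =
            indicator A (red (mact (rep C) z)) * (indicator {?l} l :: ennreal)" for l
          using add_of_int_strip_iff[of "mact (rep C) z" l] Im_mact_pos[OF det_rep[OF C] z]
          by (auto simp: indicator_def mact_lam[OF C z] red_def)
        then show ?thesis
          using True by (simp add: nn_integral_cmult)
      qed simp
    qed
    also have "\<dots> = (\<integral>\<^sup>+l. \<integral>\<^sup>+z. indicator D z * indicator (A \<inter> strip) (mact (lam C l) z)
        \<partial>hyp_measure \<partial>count_space UNIV)"
      by (rule nn_integral_count_space_nn_integral) auto
    also have "\<dots> = (\<integral>\<^sup>+l. \<integral>\<^sup>+w. indicator (A \<inter> strip) w * indicator D (mact (inv2 (lam C l)) w)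
        \<partial>hyp_measure \<partial>count_space UNIV)"
    \<comment> \<open>Substitute z = (lam C l)^-1 w, which preserves the measure. Afterwards the
      factor for the strip is the same for all C and l, so the sums act only on the indicator of
      \<open>D\<close>.\<close>
    proof (rule nn_integral_cong)
      fix l
      have "(\<integral>\<^sup>+z. indicator D z * indicator (A \<inter> strip) (mact (lam C l) z) \<partial>hyp_measure) =
          (\<integral>\<^sup>+w. indicator D (mact (inv2 (lam C l)) w) *
            indicator (A \<inter> strip) (mact (lam C l) (mact (inv2 (lam C l)) w)) \<partial>hyp_measure)"
        using C by (intro nn_integral_hyp_mact[symmetric]) auto
      also have "\<dots> = (\<integral>\<^sup>+w. indicator (A \<inter> strip) w * indicator D (mact (inv2 (lam C l)) w) \<partial>hyp_measure)"
      proof (rule nn_integral_cong_AE)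
        show "AE w in hyp_measure. indicator D (mact (inv2 (lam C l)) w) *
            indicator (A \<inter> strip) (mact (lam C l) (mact (inv2 (lam C l)) w)) =
            (indicator (A \<inter> strip) w * indicator D (mact (inv2 (lam C l)) w) :: ennreal)"
          using hyp_AE_uhp by eventually_elim (use C in \<open>simp add: mact_inv2 mult.commute\<close>)
      qed
      finally show "(\<integral>\<^sup>+z. indicator D z * indicator (A \<inter> strip) (mact (lam C l) z) \<partial>hyp_measure) =
        (\<integral>\<^sup>+w. indicator (A \<inter> strip) w * indicator D (mact (inv2 (lam C l)) w) \<partial>hyp_measure)" .
    qed
    finally show "(\<integral>\<^sup>+z. indicator A (red (mact (rep C) z)) \<partial>domain_measure) =
      (\<integral>\<^sup>+l. \<integral>\<^sup>+w. indicator (A \<inter> strip) w * indicator D (mact (inv2 (lam C l)) w)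
        \<partial>hyp_measure \<partial>count_space UNIV)" .
  qed
  also have "\<dots> = (\<integral>\<^sup>+C. \<integral>\<^sup>+w. \<integral>\<^sup>+l. indicator (A \<inter> strip) w * indicator D (mact (inv2 (lam C l)) w)
      \<partial>count_space UNIV \<partial>hyp_measure \<partial>count_space cosets)"
    by (intro nn_integral_cong nn_integral_count_space_nn_integral[symmetric]) auto
  also have "\<dots> = (\<integral>\<^sup>+w. \<integral>\<^sup>+C. \<integral>\<^sup>+l. indicator (A \<inter> strip) w * indicator D (mact (inv2 (lam C l)) w)
      \<partial>count_space UNIV \<partial>count_space cosets \<partial>hyp_measure)"
  proof (rule nn_integral_count_space_nn_integral[symmetric, OF countable_cosets])
    fix C assume "C \<in> cosets"
    have "sigma_finite_measure (count_space (UNIV :: int set))"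
      by (rule sigma_finite_measure_count_space_countable) simp
    moreover have "(\<lambda>(w, l). indicator (A \<inter> strip) w * indicator D (mact (inv2 (lam C l)) w) :: ennreal)
        \<in> borel_measurable (hyp_measure \<Otimes>\<^sub>M count_space UNIV)"
      using measurable_pair_swap[OF measurable_pair_measure_countable1[of UNIV
          "\<lambda>(l, w). indicator (A \<inter> strip) w * indicator D (mact (inv2 (lam C l)) w) :: ennreal" hyp_measure borel]]
      by simp
    ultimately show "(\<lambda>w. \<integral>\<^sup>+l. indicator (A \<inter> strip) w * indicator D (mact (inv2 (lam C l)) w)
        \<partial>count_space UNIV) \<in> borel_measurable hyp_measure"
      by (rule sigma_finite_measure.borel_measurable_nn_integral)
  qed
  also have "\<dots> = (\<integral>\<^sup>+w. indicator (A \<inter> strip) w * (\<integral>\<^sup>+C. \<integral>\<^sup>+l. indicator D (mact (inv2 (lam C l)) w)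
      \<partial>count_space UNIV \<partial>count_space cosets) \<partial>hyp_measure)"
    by (simp add: nn_integral_cmult)
  also have "\<dots> = (\<integral>\<^sup>+w. indicator (A \<inter> strip) w * 1 \<partial>hyp_measure)"
    by (rule nn_integral_cong_AE) (use AE_sum_lam in eventually_elim, simp only:)
  also have "\<dots> = (\<integral>\<^sup>+w. ennreal (indicator strip w) * indicator A w \<partial>hyp_measure)"
    by (intro nn_integral_cong) (auto simp: indicator_def)
  also have "\<dots> = emeasure (density hyp_measure (\<lambda>w. ennreal (indicator strip w))) A"
    by (subst emeasure_density) auto
  finally show "emeasure (distr unfold_measure borel (\<lambda>(C, z). red (mact (rep C) z))) A =
    emeasure (density hyp_measure (\<lambda>w. ennreal (indicator strip w))) A" .
qed simp

text \<open>Tonelli and the majorant \<open>G\<close> give integrability over the copies of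
  \<open>D\<close>. Then \<open>distr_unfold\<close> carries the integral to the strip, while Fubini
  brings the sum over cosets inside the integral over \<open>D\<close>.\<close>

theorem unfolding_integral:
  fixes \<phi> :: "complex \<Rightarrow> complex"
  assumes \<phi> [measurable]: "\<phi> \<in> borel_measurable borel"
    and per: "\<And>w l. 0 < Im w \<Longrightarrow> \<phi> (w + of_int l) = \<phi> w"
    and sum: "\<And>z. z \<in> D \<Longrightarrow> (\<lambda>C. norm (\<phi> (mact (rep C) z))) summable_on cosets"
    and le: "\<And>z. z \<in> D \<Longrightarrow> (\<Sum>\<^sub>\<infinity>C\<in>cosets. norm (\<phi> (mact (rep C) z))) \<le> G z"
    and G: "integrable domain_measure G"
  shows "set_integrable hyp_measure strip \<phi>"
    and "(LINT z:strip|hyp_measure. \<phi> z) = (LINT z:D|hyp_measure. \<Sum>\<^sub>\<infinity>C\<in>cosets. \<phi> (mact (rep C) z))"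
proof -
  interpret D: finite_measure domain_measure by (rule finite_measure_domain)
  interpret C: sigma_finite_measure "count_space cosets"
    by (rule sigma_finite_measure_count_space_countable[OF countable_cosets])
  interpret P: pair_sigma_finite "count_space cosets" domain_measure ..
  define \<psi> where "\<psi> = (\<lambda>(C, z). \<phi> (mact (rep C) z))"
  let ?T = "\<lambda>(C, z). red (mact (rep C) z)"
  have m\<psi>: "\<psi> \<in> borel_measurable unfold_measure"
    unfolding \<psi>_def by (rule measurable_unfold) simp
  have abs: "Infinite_Set_Sum.abs_summable_on (\<lambda>C. \<phi> (mact (rep C) z)) cosets" if "z \<in> D" for z
    using sum[OF that] unfolding abs_summable_equivalent[symmetric] .
  have int: "integrable unfold_measure \<psi>"
  proof (rule integrableI_bounded[OF m\<psi>])
    have "(\<integral>\<^sup>+x. norm (\<psi> x) \<partial>unfold_measure) =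
        (\<integral>\<^sup>+C. \<integral>\<^sup>+z. norm (\<phi> (mact (rep C) z)) \<partial>domain_measure \<partial>count_space cosets)"
      using m\<psi> by (subst nn_integral_unfold) (auto simp: \<psi>_def)
    also have "\<dots> = (\<integral>\<^sup>+z. \<integral>\<^sup>+C. norm (\<phi> (mact (rep C) z)) \<partial>count_space cosets \<partial>domain_measure)"
      by (rule nn_integral_count_space_nn_integral[symmetric, OF countable_cosets])
        (rule measurable_domain, simp)
    also have "\<dots> \<le> (\<integral>\<^sup>+z. ennreal (G z) \<partial>domain_measure)"
    proof (rule nn_integral_mono)
      fix z assume "z \<in> space domain_measure"
      then have z: "z \<in> D" by simp
      have "Infinite_Set_Sum.abs_summable_on (\<lambda>C. norm (\<phi> (mact (rep C) z))) cosets"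
        using abs[OF z] by simp
      then have "(\<integral>\<^sup>+C. norm (\<phi> (mact (rep C) z)) \<partial>count_space cosets) =
          ennreal (infsetsum (\<lambda>C. norm (\<phi> (mact (rep C) z))) cosets)"
        by (rule nn_integral_conv_infsetsum) simp
      also have "infsetsum (\<lambda>C. norm (\<phi> (mact (rep C) z))) cosets = (\<Sum>\<^sub>\<infinity>C\<in>cosets. norm (\<phi> (mact (rep C) z)))"
        by (rule infsetsum_infsum) fact
      finally show "(\<integral>\<^sup>+C. norm (\<phi> (mact (rep C) z)) \<partial>count_space cosets) \<le> ennreal (G z)"
        using le[OF z] by (simp add: ennreal_leI)
    qed
    also have "\<dots> < \<infinity>"
    proof -
      have "(\<integral>\<^sup>+z. ennreal (G z) \<partial>domain_measure) \<le> (\<integral>\<^sup>+z. ennreal (norm (G z)) \<partial>domain_measure)"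
        by (intro nn_integral_mono ennreal_leI) simp
      then show ?thesis
        using G unfolding integrable_iff_bounded by auto
    qed
    finally show "(\<integral>\<^sup>+x. norm (\<psi> x) \<partial>unfold_measure) < \<infinity>" .
  qed
  \<comment> \<open>By periodicity the integrand does not see the reduction modulo integers.\<close>
  have \<psi>T: "\<phi> (?T x) = \<psi> x" if x: "x \<in> space unfold_measure" for x
  proof -
    obtain C z where x: "x = (C, z)" "C \<in> cosets" "z \<in> D"
      using x by (auto simp: space_unfold)
    then have "0 < Im (mact (rep C) z)"
      using D_sub by (intro Im_mact_pos det_rep) auto
    from per[OF this, of "- \<lfloor>Re (mact (rep C) z)\<rfloor>"] show ?thesis
      by (simp add: x \<psi>_def red_def)
  qed
  have "integrable unfold_measure (\<lambda>x. \<phi> (?T x))"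
    using int \<psi>T by (simp cong: Bochner_Integration.integrable_cong)
  then have "integrable (distr unfold_measure borel ?T) \<phi>"
    by (subst integrable_distr_eq[OF measurable_red_rep]) simp_all
  then show "set_integrable hyp_measure strip \<phi>"
    unfolding distr_unfold set_integrable_def by (subst (asm) integrable_density) auto
  have "(LINT z:strip|hyp_measure. \<phi> z) = integral\<^sup>L (density hyp_measure (\<lambda>w. ennreal (indicator strip w))) \<phi>"
    unfolding set_lebesgue_integral_def by (subst integral_density) auto
  also have "\<dots> = integral\<^sup>L unfold_measure (\<lambda>x. \<phi> (?T x))"
    unfolding distr_unfold[symmetric] by (rule integral_distr[OF measurable_red_rep]) simp
  also have "\<dots> = integral\<^sup>L unfold_measure (case_prod (\<lambda>C z. \<phi> (mact (rep C) z)))"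
    using \<psi>T by (intro Bochner_Integration.integral_cong refl) (simp add: \<psi>_def)
  also have "\<dots> = (\<integral>z. (\<integral>C. \<phi> (mact (rep C) z) \<partial>count_space cosets) \<partial>domain_measure)"
    using int unfolding unfold_measure_def \<psi>_def by (rule P.integral_snd[symmetric])
  also have "\<dots> = (\<integral>z. (\<Sum>\<^sub>\<infinity>C\<in>cosets. \<phi> (mact (rep C) z)) \<partial>domain_measure)"
  proof (intro Bochner_Integration.integral_cong refl)
    fix z assume "z \<in> space domain_measure"
    then have "z \<in> D" by simp
    from infsetsum_infsum[OF abs[OF this]]
    show "(\<integral>C. \<phi> (mact (rep C) z) \<partial>count_space cosets) = (\<Sum>\<^sub>\<infinity>C\<in>cosets. \<phi> (mact (rep C) z))"
      by (simp add: infsetsum_def)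
  qed
  also have "\<dots> = (LINT z:D|hyp_measure. \<Sum>\<^sub>\<infinity>C\<in>cosets. \<phi> (mact (rep C) z))"
    unfolding domain_measure_def set_lebesgue_integral_def by (subst integral_restrict_space) auto
  finally show "(LINT z:strip|hyp_measure. \<phi> z) = (LINT z:D|hyp_measure. \<Sum>\<^sub>\<infinity>C\<in>cosets. \<phi> (mact (rep C) z))" .
qed

end

section \<open>Fourier expansions\<close>

text \<open>Approach to infinity inside a vertical strip. The bound on the real part is there
  because the Poincare series is dominated uniformly only on such strips; for functions of period
  \<open>h\<close> it loses nothing.\<close>

definition to_cusp :: "real \<Rightarrow> complex filter" where
  "to_cusp h = inf (filtercomap Im at_top) (principal {z. \<bar>Re z\<bar> \<le> h})"

lemma filterlim_Im_to_cusp: "filterlim Im at_top (to_cusp h)"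
  unfolding to_cusp_def by (rule filterlim_mono[OF filterlim_filtercomap order_refl inf_le1])

lemma eventually_to_cusp: "eventually (\<lambda>z. \<bar>Re z\<bar> \<le> h \<and> Y \<le> Im z) (to_cusp h)"
proof (rule eventually_conj)
  show "eventually (\<lambda>z. \<bar>Re z\<bar> \<le> h) (to_cusp h)"
    unfolding to_cusp_def eventually_inf_principal by simp
  show "eventually (\<lambda>z. Y \<le> Im z) (to_cusp h)"
    using filterlim_Im_to_cusp[of h] by (simp add: filterlim_at_top)
qed

text \<open>In the coordinate q = exp(2 pi i z / h) the function becomes \<open>G\<close> on the
  punctured unit disc. The limit 0 at the cusp removes the singularity at q = 0 with value 0, so the
  Taylor series of \<open>G\<close> is the expansion and has constant term 0.\<close>

lemma fourier_expansion:
  assumes hol: "g holomorphic_on upper_half_plane" and h: "0 < (h::real)"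
    and per: "\<And>z. 0 < Im z \<Longrightarrow> g (z + h) = g z"
    and lim: "(g \<longlongrightarrow> 0) (to_cusp h)"
  shows "\<exists>a :: nat \<Rightarrow> complex. a 0 = 0 \<and>
           (\<forall>z\<in>upper_half_plane.
              (\<lambda>n. a n * exp (2 * pi * \<i> * n * z / h)) sums g z)"
proof -
  define L where "L q = complex_of_real h * Ln q / (2 * of_real pi * \<i>)" for q
  define G where "G q = (if q = 0 then 0 else g (L q))" for q
  define E where "E z = exp (2 * of_real pi * \<i> * z / of_real h)" for z
  have per_nat: "g (z + of_nat m * of_real h) = g z" if "0 < Im z" for z m
  proof (induction m)
    case (Suc m)
    have "z + of_nat (Suc m) * of_real h = (z + of_nat m * of_real h) + of_real h"
      by (simp add: algebra_simps)
    moreover have "g (z + of_nat m * of_real h + of_real h) = g z"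
      using per[of "z + of_nat m * of_real h"] Suc that by simp
    ultimately show ?case by (simp only:)
  qed simp
  have per_int: "g (z + of_int m * of_real h) = g z" if "0 < Im z" for z m
  proof (cases "0 \<le> m")
    case True
    then show ?thesis using per_nat[OF that, of "nat m"] by simp
  next
    case False
    then show ?thesis
      using per_nat[of "z + of_int m * of_real h" "nat (- m)"] that by (simp add: algebra_simps)
  qed
  have E_nz: "E z \<noteq> 0" for z by (simp add: E_def)
  have GE: "G (E z) = g z" if z: "0 < Im z" for z
  proof -
    have "exp (Ln (E z)) = exp (2 * of_real pi * \<i> * z / of_real h)"
      using E_nz by (simp add: E_def)
    then obtain m :: int where "Ln (E z) = 2 * of_real pi * \<i> * z / of_real h + 2 * of_int m * of_real pi * \<i>"
      unfolding exp_eq by auto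
    then have "L (E z) = z + of_int m * of_real h"
      using h by (simp add: L_def field_simps)
    then show ?thesis
      using per_int[OF z] E_nz by (simp add: G_def)
  qed
  have normE: "norm (E z) = exp (- (2 * pi * Im z / h))" for z
    by (simp add: E_def Re_divide_of_real)
  have E_ball: "E z \<in> ball 0 1" if "0 < Im z" for z
    using that h by (simp add: normE)
  have ImL: "Im (L q) = - (h * ln (norm q) / (2 * pi))" and ReL: "Re (L q) = h * Im (Ln q) / (2 * pi)"
    if "q \<noteq> 0" for q
    using that by (simp_all add: L_def Re_divide Im_divide power2_eq_square)
  have EL: "E (L q) = q" if "q \<noteq> 0" for q
    using that h by (simp add: E_def L_def)
  have "G holomorphic_on ball 0 1 - {0}"
    unfolding holomorphic_on_open[OF open_delete[OF open_ball]]
  proof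
    fix q0 :: complex assume q0: "q0 \<in> ball 0 1 - {0}"
    define z0 where "z0 = L q0"
    \<comment> \<open>A branch of the inverse coordinate near \<open>q0\<close>: for
      \<open>q\<close> in \<open>U\<close> the quotient q/q0 is within 1 of 1 and avoids the cut of
      \<open>Ln\<close>. Periodicity makes \<open>G\<close> independent of the branch.\<close>
    define K where "K q = of_real h * Ln (q / q0) / (2 * of_real pi * \<i>) + z0" for q
    define U where "U = ball 0 1 \<inter> ball q0 (norm q0)"
    have U: "open U" "q0 \<in> U" using q0 by (auto simp: U_def)
    have Unz: "q \<noteq> 0" "norm q < 1" if "q \<in> U" for q
      using that by (auto simp: U_def)
    have EK: "E (K q) = q" if "q \<noteq> 0" for q
    proof -
      have "E (K q) = E (of_real h * Ln (q / q0) / (2 * of_real pi * \<i>)) * E z0"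
        by (simp add: E_def K_def exp_add[symmetric] add_divide_distrib ring_distribs)
      also have "\<dots> = q / q0 * q0"
        using that q0 h EL[of q0] by (simp add: E_def z0_def)
      finally show ?thesis using q0 by simp
    qed
    have KU: "0 < Im (K q)" if "q \<in> U" for q
    proof -
      have "norm q = exp (- (2 * pi * Im (K q) / h))"
        using normE[of "K q"] EK[OF Unz(1)[OF that]] by simp
      then have "exp (- (2 * pi * Im (K q) / h)) < exp 0"
        using Unz(2)[OF that] by simp
      then have "0 < 2 * pi * Im (K q) / h"
        unfolding exp_less_cancel_iff by linarith
      then show ?thesis
        using h by (simp add: zero_less_mult_iff zero_less_divide_iff)
    qed
    have GK: "G q = g (K q)" if "q \<in> U" for q
      using GE[OF KU[OF that]] EK[OF Unz(1)[OF that]] by simp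
    have "K holomorphic_on U"
      unfolding K_def
    proof (intro holomorphic_intros)
      fix q assume "q \<in> U"
      then have "norm (q / q0 - 1) < 1"
        using q0 by (auto simp: U_def dist_norm norm_minus_commute diff_divide_distrib[symmetric]
          norm_divide divide_less_eq_1 diff_divide_eq_iff)
      then have "\<bar>Re (q / q0 - 1)\<bar> < 1"
        using abs_Re_le_cmod[of "q / q0 - 1"] by linarith
      then show "q / q0 \<notin> \<real>\<^sub>\<le>\<^sub>0"
        by (auto simp: complex_nonpos_Reals_iff)
    qed (use q0 in auto)
    then have "(g \<circ> K) holomorphic_on U"
      using hol KU by (intro holomorphic_on_compose_gen) auto
    then obtain D where "DERIV (g \<circ> K) q0 :> D"
      using U by (auto simp: holomorphic_on_open)
    then have "DERIV G q0 :> D"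
      using U GK by (elim has_field_derivative_transform_within_open) auto
    then show "\<exists>D. DERIV G q0 :> D" by blast
  qed
  moreover have "(G \<longlongrightarrow> G 0) (at 0)"
  proof -
    \<comment> \<open>The principal logarithm has imaginary part of size at most pi, so
      \<open>L\<close> keeps |Re| <= h/2 while its imaginary part tends to infinity.\<close>
    have "filterlim L (to_cusp h) (at 0)"
      unfolding to_cusp_def filterlim_inf filterlim_filtercomap_iff filterlim_principal
    proof
      have "filterlim (\<lambda>q::complex. ln (norm q)) at_bot (at 0)"
        by (rule filterlim_compose[OF ln_at_0]) 
          (auto simp: filterlim_at eventually_at intro!: tendsto_norm_zero exI[of _ 1])
      then have "filterlim (\<lambda>q::complex. h / (2 * pi) * (- ln (norm q))) at_top (at 0)"
        using h by (intro filterlim_tendsto_pos_mult_at_top[OF tendsto_const])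
          (auto simp: filterlim_uminus_at_top)
      then show "filterlim (Im \<circ> L) at_top (at 0)"
        by (rule filterlim_cong[THEN iffD1, rotated -1]) (auto simp: eventually_at ImL intro!: exI[of _ 1])
      have "L q \<in> {z. \<bar>Re z\<bar> \<le> h}" if "q \<noteq> 0" for q
      proof -
        have "\<bar>Im (Ln q)\<bar> \<le> pi"
          using Im_Ln_le_pi[OF that] mpi_less_Im_Ln[OF that] by auto
        then have "\<bar>h * Im (Ln q) / (2 * pi)\<bar> \<le> h * pi / (2 * pi)"
          using h by (simp add: abs_mult divide_simps)
        also have "\<dots> \<le> h" using h by simp
        finally show ?thesis by (simp add: ReL[OF that])
      qed
      then show "\<forall>\<^sub>F q in at 0. L q \<in> {z. \<bar>Re z\<bar> \<le> h}"
        by (auto simp: eventually_at intro!: exI[of _ 1])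
    qed
    from filterlim_compose[OF lim this]
    have "((\<lambda>q. g (L q)) \<longlongrightarrow> 0) (at 0)" .
    then have "(G \<longlongrightarrow> 0) (at 0)"
      by (rule filterlim_cong[THEN iffD1, rotated -1]) (auto simp: eventually_at G_def intro!: exI[of _ 1])
    then show ?thesis by (simp add: G_def)
  qed
  ultimately have holG: "G holomorphic_on ball 0 1"
    using no_isolated_singularity'[of "{0}" G "ball 0 1"] by (simp add: at_within_open[of 0 "ball 0 1"])
  show ?thesis
  proof (intro exI[of _ "\<lambda>n. (deriv ^^ n) G 0 / fact n"] conjI ballI)
    fix z assume z: "z \<in> upper_half_plane"
    have "(\<lambda>n. (deriv ^^ n) G 0 / fact n * (E z - 0) ^ n) sums G (E z)"
      by (rule holomorphic_power_series[OF holG]) (use E_ball z in auto)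
    moreover have "E z ^ n = exp (2 * pi * \<i> * n * z / h)" for n
      by (simp add: E_def exp_of_nat_mult[symmetric] mult_ac)
    ultimately show "(\<lambda>n. (deriv ^^ n) G 0 / fact n * exp (2 * pi * \<i> * n * z / h)) sums g z"
      using GE z by simp
  qed (simp add: G_def)
qed

section \<open>Poincare series\<close>

definition cexp :: "nat \<Rightarrow> complex \<Rightarrow> complex" where
  "cexp n z = exp (2 * pi * \<i> * n * z)"

lemma norm_cexp: "norm (cexp n z) = exp (- (2 * pi * n * Im z))"
  by (simp add: cexp_def)

lemma norm_cexp_le: "0 \<le> Im z \<Longrightarrow> norm (cexp n z) \<le> 1"
  by (simp add: norm_cexp)

lemma cexp_add_int [simp]: "cexp n (z + of_int l) = cexp n z"
proof -
  have "cexp n (z + of_int l) = cexp n z * exp (2 * of_int (int n * l) * of_real pi * \<i>)"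
    by (simp add: cexp_def exp_add[symmetric] algebra_simps)
  also have "exp (2 * of_int (int n * l) * of_real pi * \<i>) = (1 :: complex)"
    using exp_integer_2pi[of "of_int (int n * l)"] by simp
  finally show ?thesis by simp
qed

text \<open>The exponential slashed in weight \<open>k\<close> by \<open>A\<close>, that is, one
  summand of the Poincare series.\<close>

definition pterm :: "nat \<Rightarrow> nat \<Rightarrow> real^2^2 \<Rightarrow> complex \<Rightarrow> complex" where
  "pterm n k A z = cexp n (mact A z) / jf A z ^ k"

lemma pterm_mult:
  assumes "det A = 1" "det B = 1" "0 < Im z"
  shows "pterm n k A (mact B z) / jf B z ^ k = pterm n k (A ** B) z"
  using assms by (simp add: pterm_def mact_mult jf_mult power_mult_distrib mult.commute)

lemma norm_pterm_le:
  assumes "det A = 1" "0 < Im z"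
  shows "norm (pterm n k A z) \<le> 1 / cmod (jf A z) ^ k"
  using norm_cexp_le[of "mact A z" n] Im_mact_pos[OF assms]
  by (auto simp: pterm_def norm_divide norm_power intro!: divide_right_mono)

lemma holomorphic_pterm: "det A = 1 \<Longrightarrow> pterm n k A holomorphic_on upper_half_plane"
  unfolding pterm_def cexp_def
  by (intro holomorphic_intros) (auto simp: jf_nonzero)

text \<open>If c = 0, the exponential decays because n > 0. If c is nonzero, the exponential is
  merely bounded and the decay comes from |cz + d| >= |c| y.\<close>

lemma pterm_tendsto_0:
  assumes A: "det A = 1" and nk: "0 < n" "0 < k"
  shows "(pterm n k A \<longlongrightarrow> 0) (to_cusp h)"
proof (cases "A$2$1 = 0")
  case True
  then have d: "A$2$2 \<noteq> 0" using A by (auto simp: det_2)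
  have "((\<lambda>y. exp (- (2 * pi * n * (y / (A$2$2)\<^sup>2))) / \<bar>A$2$2\<bar> ^ k) \<longlongrightarrow> 0) at_top"
    using d nk by real_asymp
  from filterlim_compose[OF this filterlim_Im_to_cusp[of h]]
  have "((\<lambda>z. exp (- (2 * pi * n * (Im z / (A$2$2)\<^sup>2))) / \<bar>A$2$2\<bar> ^ k) \<longlongrightarrow> 0) (to_cusp h)" .
  then show ?thesis
  proof (rule Lim_null_comparison[rotated])
    show "\<forall>\<^sub>F z in to_cusp h. norm (pterm n k A z) \<le> exp (- (2 * pi * n * (Im z / (A$2$2)\<^sup>2))) / \<bar>A$2$2\<bar> ^ k"
      using eventually_to_cusp[of h 1]
    proof eventually_elim
      case (elim z)
      have "jf A z = of_real (A$2$2)"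
        using True by (simp add: jfac_def)
      then show ?case
        using elim Im_mact[OF A, of z] by (simp add: pterm_def norm_divide norm_power norm_cexp)
    qed
  qed
next
  case False
  have "((\<lambda>y. 1 / (\<bar>A$2$1\<bar> * y) ^ k) \<longlongrightarrow> 0) at_top"
    using False nk by real_asymp
  from filterlim_compose[OF this filterlim_Im_to_cusp[of h]]
  have "((\<lambda>z. 1 / (\<bar>A$2$1\<bar> * Im z) ^ k) \<longlongrightarrow> 0) (to_cusp h)" .
  then show ?thesis
  proof (rule Lim_null_comparison[rotated])
    show "\<forall>\<^sub>F z in to_cusp h. norm (pterm n k A z) \<le> 1 / (\<bar>A$2$1\<bar> * Im z) ^ k"
      using eventually_to_cusp[of h 1]
    proof eventually_elim
      case (elim z)
      have "\<bar>A$2$1\<bar> * Im z \<le> cmod (jf A z)"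
        using abs_Im_le_cmod[of "jf A z"] elim by (simp add: Im_jf abs_mult)
      then have "1 / cmod (jf A z) ^ k \<le> 1 / (\<bar>A$2$1\<bar> * Im z) ^ k"
        using False elim jf_nonzero[OF A, of z]
        by (intro divide_left_mono power_mono mult_pos_pos zero_less_power) auto
      then show ?case
        using norm_pterm_le[OF A, of z n k] elim by simp
    qed
  qed
qed

locale poincare = cusp_group +
  fixes n k :: nat
  assumes n: "1 \<le> n" and k: "4 \<le> k" "even k"
begin

text \<open>Integer translations leave the exponential fixed, and even \<open>k\<close> absorbs the
  sign, so the chosen representatives do not matter.\<close>

lemma pterm_coset:
  assumes A: "A \<in> \<Gamma>" and B: "B \<in> coset A" and z: "0 < Im z"
  shows "pterm n k B z = pterm n k A z"
proof -
  obtain l where "B = transl (of_int l) ** A \<or> B = - (transl (of_int l) ** A)"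
    using coset_cases[OF A B] .
  moreover have "pterm n k (transl (of_int l) ** A) z = pterm n k A z"
    using z det_mem[OF A] by (simp add: pterm_def mact_mult jf_mult)
  moreover have "pterm n k (- X) z = pterm n k X z" for X
    using k by (simp add: pterm_def)
  ultimately show ?thesis by metis
qed

text \<open>Dominates the terms of the Poincare series at the translate by \<open>\<tau>\<close>,
  on the whole region \<open>\<bar>x\<bar> \<le> X\<close>, \<open>y \<ge> Y\<close>.\<close>

definition dom_bound :: "real^2^2 \<Rightarrow> real \<Rightarrow> real \<Rightarrow> (real^2^2) set \<Rightarrow> real" where
  "dom_bound \<tau> X Y C = (2 + (1 + 2 * X\<^sup>2) / Y\<^sup>2) ^ (k div 2) / cmod (jf (rep C ** \<tau>) \<i>) ^ k"

lemma dom_bound: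
  assumes C: "C \<in> cosets" and \<tau>: "det \<tau> = 1" and z: "\<bar>Re z\<bar> \<le> X" "0 < Y" "Y \<le> Im z"
  shows "norm (pterm n k (rep C ** \<tau>) z) \<le> dom_bound \<tau> X Y C"
proof -
  let ?A = "rep C ** \<tau>"
  have A: "det ?A = 1"
    using det_rep[OF C] \<tau> by (rule det_matmul_eq_1)
  have k2: "cmod w ^ k = (cmod w)\<^sup>2 ^ (k div 2)" for w
    using k by (simp add: power_mult[symmetric])
  have "cmod (jf ?A \<i>) ^ k \<le> ((2 + (1 + 2 * X\<^sup>2) / Y\<^sup>2) * (cmod (jf ?A z))\<^sup>2) ^ (k div 2)"
    unfolding k2 using jf_compare[OF z] by (intro power_mono) auto
  also have "\<dots> = (2 + (1 + 2 * X\<^sup>2) / Y\<^sup>2) ^ (k div 2) * cmod (jf ?A z) ^ k"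
    unfolding k2 by (rule power_mult_distrib)
  finally have "1 / cmod (jf ?A z) ^ k \<le> dom_bound \<tau> X Y C"
    using jf_nonzero[OF A, of z] jf_nonzero[OF A, of \<i>] z by (simp add: dom_bound_def divide_simps mult.commute)
  then show ?thesis
    using norm_pterm_le[OF A, of z n k] z by simp
qed

lemma summable_dom_bound:
  assumes \<tau>: "det \<tau> = 1"
  shows "dom_bound \<tau> X Y summable_on cosets"
proof -
  have "(\<lambda>C. (2 + (1 + 2 * X\<^sup>2) / Y\<^sup>2) ^ (k div 2) / cmod (jf \<tau> \<i>) ^ k *
      (1 / cmod (jf (rep C) (mact \<tau> \<i>)) ^ k)) summable_on cosets"
    using k \<tau> by (intro summable_on_cmult_right summable_jf Im_mact_pos) auto
  also have "?this \<longleftrightarrow> ?thesis"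
    using \<tau> by (intro summable_on_cong)
      (simp add: dom_bound_def jf_mult norm_mult power_mult_distrib mult.commute)
  finally show ?thesis .
qed

lemma uniform_limit_pterm:
  assumes "det \<tau> = 1" "0 < Y"
  shows "uniform_limit {z. \<bar>Re z\<bar> \<le> X \<and> Y \<le> Im z} (\<lambda>S z. \<Sum>C\<in>S. pterm n k (rep C ** \<tau>) z)
    (\<lambda>z. \<Sum>\<^sub>\<infinity>C\<in>cosets. pterm n k (rep C ** \<tau>) z) (finite_subsets_at_top cosets)"
  using assms dom_bound by (intro Weierstrass_m_test_general[where M = "dom_bound \<tau> X Y"] summable_dom_bound) auto

lemma holomorphic_sum_pterm:
  assumes \<tau>: "det \<tau> = 1"
  shows "(\<lambda>z. \<Sum>\<^sub>\<infinity>C\<in>cosets. pterm n k (rep C ** \<tau>) z) holomorphic_on upper_half_plane"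
  (is "?g holomorphic_on _")
  unfolding holomorphic_on_open[OF open_uhp]
proof
  fix z0 assume z0: "z0 \<in> upper_half_plane"
  define r where "r = Im z0 / 2"
  have r: "0 < r" using z0 by (simp add: r_def)
  have sub: "cball z0 r \<subseteq> {z. \<bar>Re z\<bar> \<le> \<bar>Re z0\<bar> + r \<and> r \<le> Im z}"
  proof
    fix z assume "z \<in> cball z0 r"
    then have "\<bar>Re (z0 - z)\<bar> \<le> r" "\<bar>Im (z0 - z)\<bar> \<le> r"
      using abs_Re_le_cmod[of "z0 - z"] abs_Im_le_cmod[of "z0 - z"] by (auto simp: dist_norm)
    then have "\<bar>Re z\<bar> \<le> \<bar>Re z0\<bar> + r" "r \<le> Im z"
      by (simp_all only: minus_complex.sel r_def)
    then show "z \<in> {z. \<bar>Re z\<bar> \<le> \<bar>Re z0\<bar> + r \<and> r \<le> Im z}"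
      by simp
  qed
  have hol: "pterm n k (rep C ** \<tau>) holomorphic_on cball z0 r" if "C \<in> cosets" for C
    by (rule holomorphic_on_subset[OF holomorphic_pterm[OF det_matmul_eq_1[OF det_rep[OF that] \<tau>]]])
      (use sub r in auto)
  have "\<forall>\<^sub>F S in finite_subsets_at_top cosets.
      continuous_on (cball z0 r) (\<lambda>z. \<Sum>C\<in>S. pterm n k (rep C ** \<tau>) z) \<and>
      (\<lambda>z. \<Sum>C\<in>S. pterm n k (rep C ** \<tau>) z) holomorphic_on ball z0 r"
  proof (rule eventually_finite_subsets_at_top_weakI)
    fix S assume "finite S" "S \<subseteq> cosets"
    then have "(\<lambda>z. \<Sum>C\<in>S. pterm n k (rep C ** \<tau>) z) holomorphic_on cball z0 r"
      by (intro holomorphic_on_sum hol) auto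
    then show "continuous_on (cball z0 r) (\<lambda>z. \<Sum>C\<in>S. pterm n k (rep C ** \<tau>) z) \<and>
      (\<lambda>z. \<Sum>C\<in>S. pterm n k (rep C ** \<tau>) z) holomorphic_on ball z0 r"
      using holomorphic_on_imp_continuous_on holomorphic_on_subset ball_subset_cball by blast
  qed
  moreover have "uniform_limit (cball z0 r) (\<lambda>S z. \<Sum>C\<in>S. pterm n k (rep C ** \<tau>) z) ?g (finite_subsets_at_top cosets)"
    by (rule uniform_limit_on_subset[OF uniform_limit_pterm[OF \<tau> r] sub])
  ultimately have "?g holomorphic_on ball z0 r"
    by (rule holomorphic_uniform_limit) simp_all
  then show "\<exists>D. DERIV ?g z0 :> D"
    using r by (simp add: holomorphic_on_open)
qed

text \<open>Uniform convergence on |Re z| <= h, Im z >= 1 allows the limit to be taken term by term.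
  The argument is the same for every \<open>\<tau>\<close>, which settles all cusps at once.\<close>

lemma sum_pterm_tendsto_0:
  assumes \<tau>: "det \<tau> = 1"
  shows "((\<lambda>z. \<Sum>\<^sub>\<infinity>C\<in>cosets. pterm n k (rep C ** \<tau>) z) \<longlongrightarrow> 0) (to_cusp h)"
proof (rule swap_uniform_limit'[OF _ _ uniform_limit_pterm[OF \<tau>, of 1 h]])
  show "\<forall>\<^sub>F S in finite_subsets_at_top cosets.
    ((\<lambda>z. \<Sum>C\<in>S. pterm n k (rep C ** \<tau>) z) \<longlongrightarrow> 0) (to_cusp h)"
  proof (rule eventually_finite_subsets_at_top_weakI)
    fix S assume "finite S" "S \<subseteq> cosets"
    then show "((\<lambda>z. \<Sum>C\<in>S. pterm n k (rep C ** \<tau>) z) \<longlongrightarrow> 0) (to_cusp h)"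
      using n k \<tau> by (intro tendsto_null_sum pterm_tendsto_0 det_matmul_eq_1 det_rep) auto
  qed
  show "\<forall>\<^sub>F z in to_cusp h. z \<in> {z. \<bar>Re z\<bar> \<le> h \<and> 1 \<le> Im z}"
    using eventually_to_cusp[of h 1] by simp
qed auto

definition P :: "complex \<Rightarrow> complex" where
  "P z = (if 0 < Im z then \<Sum>\<^sub>\<infinity>C\<in>cosets. pterm n k (rep C) z else 0)"

lemma slash_P:
  assumes \<tau>: "det \<tau> = 1" and z: "0 < Im z"
  shows "slash k (cmat \<tau>) P z = (\<Sum>\<^sub>\<infinity>C\<in>cosets. pterm n k (rep C ** \<tau>) z)"
proof -
  have "slash k (cmat \<tau>) P z = (\<Sum>\<^sub>\<infinity>C\<in>cosets. pterm n k (rep C) (mact \<tau> z)) * inverse (jf \<tau> z ^ k)"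
    using Im_mact_pos[OF \<tau> z] by (simp add: slash_cmat[OF \<tau>] P_def divide_inverse)
  also have "\<dots> = (\<Sum>\<^sub>\<infinity>C\<in>cosets. pterm n k (rep C) (mact \<tau> z) * inverse (jf \<tau> z ^ k))"
    by (rule infsum_cmult_left'[symmetric])
  also have "\<dots> = (\<Sum>\<^sub>\<infinity>C\<in>cosets. pterm n k (rep C ** \<tau>) z)"
    using pterm_mult[OF det_rep \<tau> z] by (intro infsum_cong) (simp add: divide_inverse)
  finally show ?thesis .
qed

lemma coset_mult:
  assumes "Y \<in> coset X" "B \<in> \<Gamma>"
  shows "Y ** B \<in> coset (X ** B)"
  using assms mult_mem[of Y B] by (auto simp: coset_def matmul2_nth)

text \<open>Right multiplication by \<open>A\<close> permutes the cosets, with inverse given by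
  right multiplication by \<open>inv2 A\<close>.\<close>

lemma sum_pterm_invariant:
  assumes A: "A \<in> \<Gamma>" and z: "0 < Im z"
  shows "(\<Sum>\<^sub>\<infinity>C\<in>cosets. pterm n k (rep C ** A) z) = (\<Sum>\<^sub>\<infinity>C\<in>cosets. pterm n k (rep C) z)"
proof -
  have mem: "coset (rep C ** B) \<in> cosets" if "C \<in> cosets" "B \<in> \<Gamma>" for B C
    using that rep_mem mult_mem mem_cosets by blast
  have inv: "coset (rep (coset (rep C ** B)) ** inv2 B) = C" if C: "C \<in> cosets" and B: "B \<in> \<Gamma>" for B C
  proof -
    let ?X = "rep C ** B"
    have "rep (coset ?X) \<in> coset ?X"
      by (rule rep_mem_coset[OF mem[OF C B]])
    then have "rep (coset ?X) ** inv2 B \<in> coset (?X ** inv2 B)"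
      by (rule coset_mult) (rule inv2_mem[OF B])
    also have "?X ** inv2 B = rep C"
      using det_mem[OF B] by (simp add: matrix_mul_assoc[symmetric] inv2_right)
    finally have "rep (coset ?X) ** inv2 B \<in> coset (rep C)" .
    then show ?thesis
      using coset_eqI coset_rep[OF C] by metis
  qed
  have bij: "bij_betw (\<lambda>C. coset (rep C ** A)) cosets cosets"
  proof (rule bij_betwI[where g = "\<lambda>C. coset (rep C ** inv2 A)"])
    show "coset (rep (coset (rep C ** inv2 A)) ** A) = C" if "C \<in> cosets" for C
      using inv[OF that inv2_mem[OF A]] by simp
  qed (use A mem inv inv2_mem in auto)
  have "(\<Sum>\<^sub>\<infinity>C\<in>cosets. pterm n k (rep C ** A) z) =
      (\<Sum>\<^sub>\<infinity>C\<in>cosets. pterm n k (rep (coset (rep C ** A))) z)"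
  proof (rule infsum_cong)
    fix C assume C: "C \<in> cosets"
    show "pterm n k (rep C ** A) z = pterm n k (rep (coset (rep C ** A))) z"
      using C A z by (intro pterm_coset[symmetric] mult_mem rep_mem rep_mem_coset mem) auto
  qed
  also have "\<dots> = (\<Sum>\<^sub>\<infinity>C\<in>cosets. pterm n k (rep C) z)"
    by (rule infsum_reindex_bij_betw[OF bij])
  finally show ?thesis .
qed

lemma P_invariant: "A \<in> \<Gamma> \<Longrightarrow> 0 < Im z \<Longrightarrow> slash k (cmat A) P z = P z"
  by (simp add: slash_P det_mem sum_pterm_invariant P_def)

theorem P_cusp_form: "P \<in> cusp_forms \<Gamma> k"
  unfolding cusp_forms_def
proof (intro CollectI conjI allI ballI impI)
  have "(\<lambda>z. \<Sum>\<^sub>\<infinity>C\<in>cosets. pterm n k (rep C ** mat 1) z) holomorphic_on upper_half_plane"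
    by (rule holomorphic_sum_pterm) simp
  then show "P holomorphic_on upper_half_plane"
    by (rule holomorphic_transform) (simp add: P_def)
next
  show "vanishes_at_cusps \<Gamma> k P"
    unfolding vanishes_at_cusps_def
  proof (intro allI impI)
    fix \<tau> :: "real^2^2" and h :: real
    assume *: "det \<tau> = 1 \<and> 0 < h \<and> \<tau> ** mat2 1 h 0 1 ** matrix_inv \<tau> \<in> \<Gamma>"
    then have \<tau>: "det \<tau> = 1" and h: "0 < h" by auto
    define B where "B = \<tau> ** transl h ** inv2 \<tau>"
    have B: "B \<in> \<Gamma>"
      using * matrix_inv_eq_inv2[OF \<tau>] by (simp add: B_def transl_def)
    \<comment> \<open>Translating z by \<open>h\<close> before \<open>\<tau>\<close> amounts to
      applying \<open>B\<close> after it; invariance of \<open>P\<close> under \<open>B\<close> is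
      thus periodicity of its translate by \<open>\<tau>\<close>.\<close>
    have B\<tau>: "B ** \<tau> = \<tau> ** transl h"
      using \<tau> by (simp add: B_def matrix_mul_assoc[symmetric] inv2_left)
    let ?g = "\<lambda>z. \<Sum>\<^sub>\<infinity>C\<in>cosets. pterm n k (rep C ** \<tau>) z"
    have "\<exists>a :: nat \<Rightarrow> complex. a 0 = 0 \<and>
           (\<forall>z\<in>upper_half_plane. (\<lambda>n. a n * exp (2 * pi * \<i> * n * z / h)) sums ?g z)"
    proof (rule fourier_expansion[OF holomorphic_sum_pterm[OF \<tau>] h _ sum_pterm_tendsto_0[OF \<tau>]])
      fix z :: complex assume z: "0 < Im z"
      have "?g (z + of_real h) = slash k (cmat \<tau>) P (z + of_real h)"
        using \<tau> z by (simp add: slash_P)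
      also have "\<dots> = P (mact (\<tau> ** transl h) z) / jf (\<tau> ** transl h) z ^ k"
        using \<tau> z by (simp add: slash_cmat mact_mult jf_mult)
      also have "\<dots> = slash k (cmat B) P (mact \<tau> z) / jf \<tau> z ^ k"
        unfolding B\<tau>[symmetric] using \<tau> z det_mem[OF B]
        by (simp add: slash_cmat mact_mult jf_mult power_mult_distrib)
      also have "\<dots> = P (mact \<tau> z) / jf \<tau> z ^ k"
        using P_invariant[OF B Im_mact_pos[OF \<tau> z]] by simp
      also have "\<dots> = ?g z"
        using slash_P[OF \<tau> z] by (simp add: slash_cmat[OF \<tau>])
      finally show "?g (z + of_real h) = ?g z" .
    qed
    then show "\<exists>a :: nat \<Rightarrow> complex. a 0 = 0 \<and>
        (\<forall>z\<in>upper_half_plane. (\<lambda>n. a n * exp (2 * pi * \<i> * n * z / h)) sums slash k (cmat \<tau>) P z)"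
      using slash_P[OF \<tau>] by simp
  qed
qed (use P_invariant in \<open>auto simp: P_def\<close>)

end

section \<open>Fourier coefficients\<close>

lemma measurable_cnj [measurable (raw)]:
  "f \<in> borel_measurable M \<Longrightarrow> (\<lambda>x. cnj (f x)) \<in> borel_measurable M"
  by (rule measurable_compose[OF _ borel_measurable_continuous_onI]) (auto intro: continuous_intros)

lemma measurable_Im_power [measurable]:
  "(\<lambda>z. complex_of_real (Im z ^ k)) \<in> borel_measurable borel"
  by (intro borel_measurable_continuous_onI continuous_intros)

lemma integral_exp_period:
  "(LINT x:{0..<1}|lborel. exp (2 * of_int j * of_real pi * \<i> * of_real x)) = (if j = 0 then 1 else 0 :: complex)"
proof -
  have "(LINT x:{0..<1}|lborel. exp (2 * of_int j * of_real pi * \<i> * of_real x)) =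
      (LINT x:{0..1}|lborel. exp (2 * of_int j * of_real pi * \<i> * of_real x) :: complex)"
    unfolding set_lebesgue_integral_def
  proof (rule integral_cong_AE)
    show "AE x in lborel. indicator {0..<1} x *\<^sub>R exp (2 * of_int j * of_real pi * \<i> * of_real x) =
       indicator {0..1} x *\<^sub>R (exp (2 * of_int j * of_real pi * \<i> * of_real x) :: complex)"
      using AE_lborel_singleton[of "1::real"] by eventually_elim (auto simp: indicator_def)
  qed auto
  also have "\<dots> = (if j = 0 then 1 else 0)"
  proof (cases "j = 0")
    case True
    then show ?thesis by (simp add: set_lebesgue_integral_def)
  next
    case False
    define a :: complex where "a = 2 * of_int j * of_real pi * \<i>"
    have a: "a \<noteq> 0" using False by (simp add: a_def)
    have "has_bochner_integral lborel (\<lambda>x. indicator {0..1} x *\<^sub>R exp (a * of_real x))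
        (exp (a * of_real 1) / a - exp (a * of_real 0) / a)"
    proof (rule has_bochner_integral_FTC_Icc)
      fix x :: real
      have "((\<lambda>z. exp (a * z) / a) has_field_derivative exp (a * of_real x)) (at (of_real x))"
        using a by (auto intro!: derivative_eq_intros)
      then show "((\<lambda>x. exp (a * of_real x) / a) has_vector_derivative exp (a * of_real x)) (at x within {0..1})"
        by (rule has_vector_derivative_real_field)
    qed (auto intro!: continuous_intros)
    moreover have "exp a = 1"
      using exp_integer_2pi[of "of_int j"] by (simp add: a_def)
    ultimately show ?thesis
      using False by (simp add: a_def[symmetric] set_lebesgue_integral_def has_bochner_integral_integral_eq)
  qed
  finally show ?thesis .
qed

lemma cexp_orthogonal:
  "(LINT x:{0..<1}|lborel. cexp m (Complex x y) * cnj (cexp n (Complex x y))) =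
    (if m = n then of_real (exp (- (4 * pi * n * y))) else 0)"
proof -
  have "cexp m (Complex x y) * cnj (cexp n (Complex x y)) =
      of_real (exp (- (2 * pi * (m + n) * y))) * exp (2 * of_int (int m - int n) * of_real pi * \<i> * of_real x)" for x
  proof -
    have e: "2 * pi * \<i> * m * Complex x y + cnj (2 * pi * \<i> * n * Complex x y) =
       of_real (- (2 * pi * (m + n) * y)) + 2 * of_int (int m - int n) * of_real pi * \<i> * of_real x"
      by (simp add: complex_eq_iff algebra_simps)
    have "cexp m (Complex x y) * cnj (cexp n (Complex x y)) =
        exp (2 * pi * \<i> * m * Complex x y + cnj (2 * pi * \<i> * n * Complex x y))"
      unfolding cexp_def exp_cnj exp_add ..
    then show ?thesis
      unfolding e exp_add exp_of_real .
  qed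
  then have "(LINT x:{0..<1}|lborel. cexp m (Complex x y) * cnj (cexp n (Complex x y))) =
     of_real (exp (- (2 * pi * (m + n) * y))) *
     (LINT x:{0..<1}|lborel. exp (2 * of_int (int m - int n) * of_real pi * \<i> * of_real x))"
    by (simp only: set_integral_mult_right)
  also have "\<dots> = (if m = n then of_real (exp (- (4 * pi * n * y))) else 0)"
    unfolding integral_exp_period by (auto simp: algebra_simps)
  finally show ?thesis .
qed

lemma measurable_cexp_line [measurable]: "(\<lambda>x. cexp m (Complex x y)) \<in> borel_measurable borel"
proof -
  have "(\<lambda>x. exp (2 * pi * \<i> * m * (of_real x + \<i> * of_real y))) \<in> borel_measurable borel"
    by (intro borel_measurable_continuous_onI continuous_intros)
  moreover have "(\<lambda>x. cexp m (Complex x y)) = (\<lambda>x. exp (2 * pi * \<i> * m * (of_real x + \<i> * of_real y)))"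
    by (simp add: cexp_def Complex_eq)
  ultimately show ?thesis by (simp only:)
qed

text \<open>Termwise integration against one exponential along a horizontal period. It serves both
  for uniqueness of the coefficients and for the inner integral after unfolding.\<close>

lemma fourier_coeff_integral:
  assumes f: "\<And>z. 0 < Im z \<Longrightarrow> (\<lambda>m. c m * cexp m z) sums f z" and y: "0 < y"
  shows "(LINT x:{0..<1}|lborel. f (Complex x y) * cnj (cexp n (Complex x y))) =
    c n * of_real (exp (- (4 * pi * n * y)))"
proof -
  define F where "F m x = indicator {0..<1} x *\<^sub>R (c m * (cexp m (Complex x y) * cnj (cexp n (Complex x y))))" for m x
  define K where "K m = norm (c m * of_real (exp (- (2 * pi * y))) ^ m) * exp (- (2 * pi * n * y))" for m
  have K: "norm (F m x) = indicator {0..<1} x * K m" for m x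
    by (simp add: F_def K_def norm_mult norm_power norm_cexp exp_of_nat_mult[symmetric] mult_ac)
  \<comment> \<open>The hypothesis gives plain convergence at each point. Convergence at height y/2
    implies absolute convergence at height y, where q = exp(2 pi i z) has smaller modulus.\<close>
  have "summable (\<lambda>m. c m * cexp m (\<i> * of_real (y / 2)))"
    using f[of "\<i> * of_real (y / 2)"] y by (simp add: sums_iff)
  also have "(\<lambda>m. c m * cexp m (\<i> * of_real (y / 2))) = (\<lambda>m. c m * of_real (exp (- (pi * y))) ^ m)"
    by (simp add: cexp_def exp_of_nat_mult[symmetric] exp_of_real[symmetric] mult_ac flip: of_real_power)
  finally have "summable (\<lambda>m. norm (c m * of_real (exp (- (2 * pi * y))) ^ m))"
    by (rule powser_insidea) (use y in simp)
  then have sK: "summable K"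
    unfolding K_def by (rule summable_mult2)
  have Fm: "F m \<in> borel_measurable lborel" for m
    unfolding F_def by measurable
  have int: "integrable lborel (F m)" for m
  proof (rule Bochner_Integration.integrable_bound[where f = "\<lambda>x. indicator {0..<1} x * K m"])
    show "integrable lborel (\<lambda>x::real. indicator {0..<1} x * K m :: real)"
      by (intro integrable_mult_left integrable_real_indicator) auto
    show "AE x in lborel. norm (F m x) \<le> norm (indicator {0..<1} x * K m :: real)"
      by (simp add: K K_def)
  qed (rule Fm)
  have "(\<lambda>m. integral\<^sup>L lborel (F m)) sums (\<integral>x. (\<Sum>m. F m x) \<partial>lborel)"
  proof (rule sums_integral[OF int])
    show "AE x in lborel. summable (\<lambda>m. norm (F m x))"
      unfolding K using sK by (intro AE_I2 summable_mult)
    show "summable (\<lambda>m. \<integral>x. norm (F m x) \<partial>lborel)"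
      unfolding K using sK by simp
  qed
  also have "(\<lambda>m. integral\<^sup>L lborel (F m)) = (\<lambda>m. if m = n then c n * of_real (exp (- (4 * pi * n * y))) else 0)"
  proof
    fix m
    have "integral\<^sup>L lborel (F m) = (LINT x:{0..<1}|lborel. c m * (cexp m (Complex x y) * cnj (cexp n (Complex x y))))"
      unfolding F_def[abs_def] set_lebesgue_integral_def ..
    also have "\<dots> = c m * (LINT x:{0..<1}|lborel. cexp m (Complex x y) * cnj (cexp n (Complex x y)))"
      by (rule set_integral_mult_right)
    finally show "integral\<^sup>L lborel (F m) = (if m = n then c n * of_real (exp (- (4 * pi * n * y))) else 0)"
      unfolding cexp_orthogonal by simp
  qed
  finally have "(\<lambda>m. if m = n then c n * of_real (exp (- (4 * pi * n * y))) else 0) sums (\<integral>x. (\<Sum>m. F m x) \<partial>lborel)" .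
  moreover have "(\<lambda>m. if m = n then c n * of_real (exp (- (4 * pi * n * y))) else 0) sums (c n * of_real (exp (- (4 * pi * n * y))))"
    using sums_single[of n "\<lambda>_. c n * of_real (exp (- (4 * pi * n * y)))"] by simp
  ultimately have "(\<integral>x. (\<Sum>m. F m x) \<partial>lborel) = c n * of_real (exp (- (4 * pi * n * y)))"
    by (rule sums_unique2)
  moreover have "(\<Sum>m. F m x) = indicator {0..<1} x *\<^sub>R (f (Complex x y) * cnj (cexp n (Complex x y)))" for x
  proof -
    have "(\<lambda>m. c m * cexp m (Complex x y)) sums f (Complex x y)"
      using f y by simp
    then have "(\<lambda>m. indicator {0..<1} x *\<^sub>R (c m * cexp m (Complex x y) * cnj (cexp n (Complex x y)))) sums
        (indicator {0..<1} x *\<^sub>R (f (Complex x y) * cnj (cexp n (Complex x y))))"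
      by (intro sums_scaleR_right sums_mult2)
    then show ?thesis
      by (simp add: F_def mult.assoc sums_iff)
  qed
  ultimately show ?thesis
    by (simp add: set_lebesgue_integral_def)
qed

lemma coeff_infinity_eq:
  assumes "c 0 = 0" and f: "\<And>z. 0 < Im z \<Longrightarrow> (\<lambda>m. c m * cexp m z) sums f z"
  shows "coeff_infinity f = c"
  unfolding coeff_infinity_def cexp_def[symmetric]
proof (rule the_equality)
  fix c' assume "c' 0 = 0 \<and> (\<forall>z\<in>upper_half_plane. (\<lambda>m. c' m * cexp m z) sums f z)"
  then have f': "(\<lambda>m. c' m * cexp m z) sums f z" if "0 < Im z" for z
    using that by simp
  show "c' = c"
  proof
    fix m
    show "c' m = c m"
      using fourier_coeff_integral[of c f 1 m, OF f] fourier_coeff_integral[of c' f 1 m, OF f'] by simp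
  qed
qed (use assms in auto)

text \<open>The cusp condition is used for the identity matrix and width 1; uniqueness identifies
  the sequence obtained with the one that \<open>coeff_infinity\<close> picks.\<close>

lemma (in cusp_group) cusp_form_expansion:
  assumes "f \<in> cusp_forms \<Gamma> k" "0 < Im z"
  shows "(\<lambda>m. coeff_infinity f m * cexp m z) sums f z"
proof -
  have v: "\<forall>\<tau> h. det \<tau> = 1 \<and> h > 0 \<and> \<tau> ** mat2 1 h 0 1 ** matrix_inv \<tau> \<in> \<Gamma> \<longrightarrow>
        (\<exists>a :: nat \<Rightarrow> complex. a 0 = 0 \<and>
           (\<forall>z\<in>upper_half_plane.
              (\<lambda>n. a n * exp (2 * pi * \<i> * n * z / h)) sums slash k (cmat \<tau>) f z))"
    using assms by (simp add: cusp_forms_def vanishes_at_cusps_def)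
  have m: "mat 1 ** mat2 1 1 0 1 ** matrix_inv (mat 1) \<in> \<Gamma>"
    using transl_mem[of 1] matrix_inv_eq_inv2[of "mat 1"] inv2_left[of "mat 1"]
    by (simp add: transl_def)
  have "\<exists>a :: nat \<Rightarrow> complex. a 0 = 0 \<and> (\<forall>z\<in>upper_half_plane.
      (\<lambda>n. a n * exp (2 * pi * \<i> * n * z / (1::real))) sums slash k (cmat (mat 1)) f z)"
    by (rule v[THEN spec, THEN spec, THEN mp, OF conjI[OF det_I conjI[OF zero_less_one m]]])
  then obtain a :: "nat \<Rightarrow> complex" where "a 0 = 0" and a': "\<forall>z\<in>upper_half_plane.
      (\<lambda>n. a n * exp (2 * pi * \<i> * n * z / (1::real))) sums slash k (cmat (mat 1)) f z"
    by blast
  have a: "(\<lambda>n. a n * exp (2 * pi * \<i> * n * z / (1::real))) sums slash k (cmat (mat 1)) f z" if "0 < Im z" for z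
    by (rule bspec[OF a']) (simp add: that)
  have "coeff_infinity f = a"
    using \<open>a 0 = 0\<close> a by (intro coeff_infinity_eq) (simp_all add: cexp_def slash_cmat)
  with a[OF assms(2)] show ?thesis
    by (simp add: cexp_def slash_cmat)
qed

section \<open>Inner products with Poincare series\<close>

lemma gamma_integral:
  assumes a: "0 < (a::real)"
  shows "(\<integral>y. indicator {0<..} y * (y ^ p * exp (- (a * y))) \<partial>lborel) = fact p / a ^ Suc p"
proof -
  let ?f = "\<lambda>y::real. indicator {0<..} y * (y ^ p * exp (- y))"
  have "(\<integral>\<^sup>+y. ennreal (?f y) \<partial>lborel) = (\<integral>\<^sup>+y. ennreal (y ^ p * exp (- y)) * indicator {0..} y \<partial>lborel)"
  proof (rule nn_integral_cong_AE)
    show "AE y in lborel. ennreal (?f y) = ennreal (y ^ p * exp (- y)) * indicator {0..} y"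
      using AE_lborel_singleton[of "0::real"] by eventually_elim (auto simp: indicator_def)
  qed
  also have "\<dots> = ennreal (fact p)"
    by (simp add: nn_intergal_power_times_exp_Ici)
  finally have "integral\<^sup>L lborel ?f = fact p"
    by (subst (asm) nn_integral_eq_integrable) (auto simp: indicator_def)
  moreover have "integral\<^sup>L lborel ?f = \<bar>a\<bar> *\<^sub>R (\<integral>y. ?f (0 + a * y) \<partial>lborel)"
    using a by (intro lborel_integral_real_affine) simp
  moreover have "?f (0 + a * y) = a ^ p * (indicator {0<..} y * (y ^ p * exp (- (a * y))))" for y
    using a by (auto simp: indicator_def zero_less_mult_iff power_mult_distrib)
  then have "(\<integral>y. ?f (0 + a * y) \<partial>lborel) = a ^ p * (\<integral>y. indicator {0<..} y * (y ^ p * exp (- (a * y))) \<partial>lborel)"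
    by (simp only: integral_mult_right_zero)
  ultimately have "fact p = a * (a ^ p * (\<integral>y. indicator {0<..} y * (y ^ p * exp (- (a * y))) \<partial>lborel))"
    using a by (simp only: real_scaleR_def abs_of_pos)
  then show ?thesis
    using a by (simp add: field_simps)
qed

lemma integral_hyp:
  fixes \<phi> :: "complex \<Rightarrow> complex"
  assumes "set_integrable hyp_measure A \<phi>" and A: "A \<in> sets borel" "A \<subseteq> upper_half_plane"
    and \<phi>: "\<phi> \<in> borel_measurable borel"
  shows "(LINT z:A|hyp_measure. \<phi> z) =
    (\<integral>y. (\<integral>x. indicator A (Complex x y) *\<^sub>R ((1 / y\<^sup>2) *\<^sub>R \<phi> (Complex x y)) \<partial>lborel) \<partial>lborel)"
proof -
  define g where "g z = indicator A z *\<^sub>R ((1 / (Im z)\<^sup>2) *\<^sub>R \<phi> z)" for z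
  have g: "g \<in> borel_measurable borel"
    unfolding g_def using A(1) \<phi> by measurable
  have hyp: "hyp_measure = density lborel (\<lambda>z. ennreal (indicator upper_half_plane z / (Im z)\<^sup>2))"
    unfolding hyp_measure_def by (intro arg_cong[where f = "density lborel"]) (auto simp: indicator_def)
  have e: "(indicator upper_half_plane z / (Im z)\<^sup>2) *\<^sub>R (indicator A z *\<^sub>R \<phi> z) = g z" for z
    using A(2) by (auto simp: g_def indicator_def)
  have m: "(\<lambda>z. indicator A z *\<^sub>R \<phi> z) \<in> borel_measurable lborel"
    using A(1) \<phi> by measurable
  have int: "integrable lborel g"
    using assms(1) unfolding set_integrable_def hyp by (subst (asm) integrable_density) (use m e in auto)
  have "(LINT z:A|hyp_measure. \<phi> z) = integral\<^sup>L lborel g"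
    unfolding set_lebesgue_integral_def hyp by (subst integral_density) (use m e in auto)
  also have "\<dots> = integral\<^sup>L (distr (lborel :: (real \<times> real) measure) borel (\<lambda>(x, y). Complex x y)) g"
    unfolding lborel_complex_prod ..
  also have "\<dots> = integral\<^sup>L (lborel \<Otimes>\<^sub>M lborel) (\<lambda>(x, y). g (Complex x y))"
    unfolding lborel_prod by (subst integral_distr) (use g in \<open>auto simp: case_prod_unfold measurable_case_Complex[unfolded case_prod_unfold]\<close>)
  also have "\<dots> = (\<integral>y. (\<integral>x. g (Complex x y) \<partial>lborel) \<partial>lborel)"
  proof (rule lborel_pair.integral_snd[symmetric])
    have "integrable (distr (lborel :: (real \<times> real) measure) borel (\<lambda>(x, y). Complex x y)) g"
      unfolding lborel_complex_prod by (rule int)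
    then show "integrable (lborel \<Otimes>\<^sub>M lborel) (\<lambda>(x, y). g (Complex x y))"
      unfolding lborel_prod by (subst (asm) integrable_distr_eq) (use g in \<open>auto simp: case_prod_unfold measurable_case_Complex[unfolded case_prod_unfold]\<close>)
  qed
  finally show ?thesis
    by (simp add: g_def)
qed

lemma measurable_cexp [measurable]: "cexp m \<in> borel_measurable borel"
  unfolding cexp_def by (intro borel_measurable_continuous_onI continuous_intros)

text \<open>Integration over x isolates the n-th coefficient; what remains is the Gamma integral of
  y^(k-2) exp(-4 pi n y), where the measure has taken two powers of y.\<close>

lemma strip_integral:
  assumes f: "\<And>z. 0 < Im z \<Longrightarrow> (\<lambda>m. c m * cexp m z) sums f z"
    and fm [measurable]: "f \<in> borel_measurable borel" and n: "1 \<le> n" and k: "2 \<le> k"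
    and int: "set_integrable hyp_measure strip (\<lambda>z. cexp n z * cnj (f z) * of_real (Im z ^ k))"
  shows "(LINT z:strip|hyp_measure. cexp n z * cnj (f z) * of_real (Im z ^ k)) =
    cnj (c n) * of_real (fact (k - 2) / (4 * pi * n) ^ (k - 1))"
proof -
  have "(LINT z:strip|hyp_measure. cexp n z * cnj (f z) * of_real (Im z ^ k)) =
    (\<integral>y. (\<integral>x. indicator strip (Complex x y) *\<^sub>R ((1 / y\<^sup>2) *\<^sub>R
      (cexp n (Complex x y) * cnj (f (Complex x y)) * of_real (Im (Complex x y) ^ k))) \<partial>lborel) \<partial>lborel)"
  proof (rule integral_hyp[OF int])
    show "(\<lambda>z. cexp n z * cnj (f z) * of_real (Im z ^ k)) \<in> borel_measurable borel"
      by measurable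
  qed (auto simp: strip_def)
  also have "\<dots> = (\<integral>y. cnj (c n) * of_real (indicator {0<..} y * (y ^ (k - 2) * exp (- (4 * pi * n * y)))) \<partial>lborel)"
  proof (intro Bochner_Integration.integral_cong refl)
    fix y :: real
    show "(\<integral>x. indicator strip (Complex x y) *\<^sub>R ((1 / y\<^sup>2) *\<^sub>R
        (cexp n (Complex x y) * cnj (f (Complex x y)) * of_real (Im (Complex x y) ^ k))) \<partial>lborel) =
      cnj (c n) * of_real (indicator {0<..} y * (y ^ (k - 2) * exp (- (4 * pi * n * y))))"
    proof (cases "0 < y")
      case True
      have yk: "y ^ k / y\<^sup>2 = y ^ (k - 2)"
        using True k by (simp add: power_diff)
      have "indicator strip (Complex x y) *\<^sub>R ((1 / y\<^sup>2) *\<^sub>R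
          (cexp n (Complex x y) * cnj (f (Complex x y)) * of_real (Im (Complex x y) ^ k))) =
         of_real (y ^ (k - 2)) * cnj (indicator {0..<1} x *\<^sub>R (f (Complex x y) * cnj (cexp n (Complex x y))))" for x
        unfolding yk[symmetric] using True
        by (auto simp: strip_def indicator_def scaleR_conv_of_real)
      then have "(\<integral>x. indicator strip (Complex x y) *\<^sub>R ((1 / y\<^sup>2) *\<^sub>R
          (cexp n (Complex x y) * cnj (f (Complex x y)) * of_real (Im (Complex x y) ^ k))) \<partial>lborel) =
        of_real (y ^ (k - 2)) * cnj (LINT x:{0..<1}|lborel. f (Complex x y) * cnj (cexp n (Complex x y)))"
        by (simp only: integral_mult_right_zero Bochner_Integration.integral_cnj set_lebesgue_integral_def)
      also have "\<dots> = cnj (c n) * of_real (y ^ (k - 2) * exp (- (4 * pi * n * y)))"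
      proof -
        have "(LINT x:{0..<1}|lborel. f (Complex x y) * cnj (cexp n (Complex x y))) =
            c n * of_real (exp (- (4 * pi * n * y)))"
          by (rule fourier_coeff_integral[OF _ True]) (rule f)
        then show ?thesis by simp
      qed
      finally show ?thesis using True by simp
    qed (simp add: strip_def)
  qed
  also have "\<dots> = cnj (c n) * of_real (\<integral>y. indicator {0<..} y * (y ^ (k - 2) * exp (- (4 * pi * n * y))) \<partial>lborel)"
    by (simp only: integral_mult_right_zero integral_complex_of_real)
  also have "(\<integral>y. indicator {0<..} y * (y ^ (k - 2) * exp (- (4 * pi * n * y))) \<partial>lborel) =
      fact (k - 2) / (4 * pi * n) ^ Suc (k - 2)"
    using n by (intro gamma_integral) simp
  also have "Suc (k - 2) = k - 1"
    using k by simp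
  finally show ?thesis .
qed

lemma cusp_form_measurable:
  assumes "f \<in> cusp_forms \<Gamma> k"
  shows "f \<in> borel_measurable borel"
proof -
  have "(\<lambda>z. if z \<in> upper_half_plane then f z else 0) \<in> borel_measurable borel"
    using assms by (intro borel_measurable_continuous_on_if)
      (auto simp: cusp_forms_def intro: holomorphic_on_imp_continuous_on)
  also have "(\<lambda>z. if z \<in> upper_half_plane then f z else 0) = f"
    using assms by (auto simp: cusp_forms_def)
  finally show ?thesis .
qed

text \<open>A single term of the exponential series is at most the whole.\<close>

lemma power_exp_bound:
  assumes "0 \<le> (u::real)"
  shows "u ^ p * exp (- u) \<le> fact p"
proof -
  have "u ^ p / fact p = (\<Sum>i\<in>{p}. u ^ i /\<^sub>R fact i)"
    by (simp add: divide_inverse mult.commute)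
  also have "\<dots> \<le> exp u"
    using assms summable_exp_generic[of u]
    unfolding exp_def by (intro sum_le_suminf) auto
  finally show ?thesis
    by (simp add: exp_minus field_simps)
qed

locale poincare_domain = poincare + cusp_group_domain
begin

lemma petersson_domain:
  "petersson D k f g = (\<integral>z. f z * cnj (g z) * of_real (Im z ^ k) \<partial>domain_measure)"
  unfolding petersson_def domain_measure_def set_lebesgue_integral_def
  by (subst integral_restrict_space) auto

text \<open>Since f(gamma z) = f(z) j^k and Im(gamma z)^k = Im(z)^k / (j conj j)^k, the conjugate
  factors cancel and j^-k is left. This recognizes the terms of P conj(f) y^k as values of one
  function at the points gamma z.\<close>

lemma norm_cusp_form_act:
  assumes f: "f \<in> cusp_forms \<Gamma> k" and C: "C \<in> cosets" and z: "0 < Im z"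
  shows "cexp n (mact (rep C) z) * cnj (f (mact (rep C) z)) * of_real (ht C z ^ k) =
      pterm n k (rep C) z * (cnj (f z) * of_real (Im z ^ k))"
proof -
  let ?j = "jf (rep C) z"
  have j: "?j \<noteq> 0" using det_rep[OF C] z by (rule jf_nonzero)
  have "slash k (cmat (rep C)) f z = f z"
    using f rep_mem[OF C] z by (simp add: cusp_forms_def)
  then have fz: "f (mact (rep C) z) = f z * ?j ^ k"
    using j by (simp add: slash_cmat[OF det_rep[OF C]] divide_eq_eq)
  have "complex_of_real ((cmod ?j)\<^sup>2) = ?j * cnj ?j"
    by (simp only: complex_norm_square)
  then have "complex_of_real (ht C z ^ k) = of_real (Im z ^ k) / (?j ^ k * cnj ?j ^ k)"
    unfolding ht_eq[OF C z] by (simp only: of_real_power of_real_divide power_divide power_mult_distrib)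
  then show ?thesis
    using j by (simp add: fz pterm_def)
qed

text \<open>\<open>sum_weight_le\<close> with weight u^(k/2) exp(-2 pi n u): it is at most u^2 for u
  <= 1 because k/2 >= 2, and at most (k/2)! throughout because u <= 2 pi n u.\<close>

lemma weight_sum_le:
  assumes z: "0 < Im z" and S: "finite S" "S \<subseteq> cosets"
  shows "(\<Sum>C\<in>S. ht C z ^ (k div 2) * exp (- (2 * pi * n * ht C z))) \<le> fact (k div 2) + 48"
proof (rule sum_weight_le[OF z S])
  fix u :: real assume u: "0 < u"
  have "u \<le> 2 * pi * n * u"
  proof -
    have "1 * 1 \<le> (2 * pi) * real n"
      using n pi_gt3 by (intro mult_mono) auto
    then show ?thesis
      using u by simp
  qed
  then have "u ^ (k div 2) * exp (- (2 * pi * n * u)) \<le> u ^ (k div 2) * exp (- u)"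
    using u by (intro mult_left_mono) auto
  also have "\<dots> \<le> fact (k div 2)"
    using u by (intro power_exp_bound) simp
  finally show "u ^ (k div 2) * exp (- (2 * pi * n * u)) \<le> fact (k div 2)" .
  assume "u \<le> 1"
  have "u ^ (k div 2) * exp (- (2 * pi * n * u)) \<le> u ^ (k div 2) * 1"
    using u by (intro mult_left_mono) auto
  also have "\<dots> \<le> u\<^sup>2"
    using u \<open>u \<le> 1\<close> k by (simp add: power_decreasing)
  finally show "u ^ (k div 2) * exp (- (2 * pi * n * u)) \<le> u\<^sup>2" .
qed simp

text \<open>Unfolding applied to e(nz) conj(f(z)) y^k. Its absolute values sum over the cosets to
  |f| y^(k/2) times the sum in \<open>weight_sum_le\<close>, so the majorant \<open>G\<close> is
  integrable as soon as |f| y^(k/2) is.\<close>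

lemma petersson_P:
  assumes f: "f \<in> cusp_forms \<Gamma> k"
    and L2: "integrable domain_measure (\<lambda>z. (norm (f z))\<^sup>2 * Im z ^ k)"
  shows "petersson D k P f = cnj (coeff_infinity f n) * of_real (fact (k - 2) / (4 * pi * n) ^ (k - 1))"
proof -
  define \<phi> where "\<phi> z = cexp n z * cnj (f z) * of_real (Im z ^ k)" for z
  define G where "G z = norm (f z) * Im z ^ (k div 2) * (fact (k div 2) + 48)" for z
  have fm [measurable]: "f \<in> borel_measurable borel"
    by (rule cusp_form_measurable[OF f])
  have \<phi>m: "\<phi> \<in> borel_measurable borel"
    unfolding \<phi>_def by measurable
  have kk: "x ^ k = x ^ (k div 2) * x ^ (k div 2)" for x :: real
    by (metis k(2) dvd_mult_div_cancel mult_2 power_add)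
  have norm_\<phi>: "norm (\<phi> (mact (rep C) z)) =
      norm (f z) * Im z ^ (k div 2) * (ht C z ^ (k div 2) * exp (- (2 * pi * n * ht C z)))"
    if C: "C \<in> cosets" and z: "0 < Im z" for C z
  proof -
    let ?j = "jf (rep C) z"
    have j: "?j \<noteq> 0" using det_rep[OF C] z by (rule jf_nonzero)
    have "(cmod ?j)\<^sup>2 ^ (k div 2) = cmod ?j ^ k"
      using k by (simp add: power_mult[symmetric])
    then have h: "ht C z ^ (k div 2) = Im z ^ (k div 2) / cmod ?j ^ k"
      unfolding ht_eq[OF C z] power_divide by simp
    have "norm (\<phi> (mact (rep C) z)) = norm (pterm n k (rep C) z * (cnj (f z) * of_real (Im z ^ k)))"
      unfolding \<phi>_def norm_cusp_form_act[OF f C z] ..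
    also have "\<dots> = exp (- (2 * pi * n * ht C z)) / cmod ?j ^ k * (norm (f z) * (Im z ^ (k div 2) * Im z ^ (k div 2)))"
      using z unfolding pterm_def kk[of "Im z"]
      by (simp add: norm_mult norm_divide norm_power norm_cexp)
    finally show ?thesis
      unfolding h by simp
  qed
  \<comment> \<open>Square integrable implies integrable by t <= 1 + t^2, because \<open>D\<close>
    has finite measure.\<close>
  have L1: "integrable domain_measure (\<lambda>z. norm (f z) * Im z ^ (k div 2))"
  proof (rule Bochner_Integration.integrable_bound[where f = "\<lambda>z. 1 + (norm (f z))\<^sup>2 * Im z ^ k"])
    show "integrable domain_measure (\<lambda>z. 1 + (norm (f z))\<^sup>2 * Im z ^ k)"
      using L2 finite_measure_domain by (intro Bochner_Integration.integrable_add finite_measure.integrable_const)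
    show "(\<lambda>z. norm (f z) * Im z ^ (k div 2)) \<in> borel_measurable domain_measure"
      by (rule measurable_domain) measurable
    show "AE z in domain_measure. norm (norm (f z) * Im z ^ (k div 2)) \<le> norm (1 + (norm (f z))\<^sup>2 * Im z ^ k)"
    proof (rule AE_I2)
      fix z assume "z \<in> space domain_measure"
      then have z: "0 < Im z" using D_sub by auto
      let ?t = "norm (f z) * Im z ^ (k div 2)"
      have "?t \<le> 1 + ?t\<^sup>2"
      proof -
        have "0 \<le> ?t" using z by simp
        then show ?thesis using sum_squares_bound[of ?t 1] by (simp only: power_one mult_1_right)
      qed
      also have "?t\<^sup>2 = (norm (f z))\<^sup>2 * Im z ^ k"
        unfolding kk[of "Im z"] by (simp add: power2_eq_square)
      finally show "norm ?t \<le> norm (1 + (norm (f z))\<^sup>2 * Im z ^ k)"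
        using z by simp
    qed
  qed
  have sum_le: "(\<Sum>C\<in>S. norm (\<phi> (mact (rep C) z))) \<le> G z"
    if z: "0 < Im z" and S: "finite S" "S \<subseteq> cosets" for z S
  proof -
    have "(\<Sum>C\<in>S. norm (\<phi> (mact (rep C) z))) =
        (\<Sum>C\<in>S. norm (f z) * Im z ^ (k div 2) * (ht C z ^ (k div 2) * exp (- (2 * pi * n * ht C z))))"
      using S z by (intro sum.cong refl norm_\<phi>) auto
    also have "\<dots> = norm (f z) * Im z ^ (k div 2) * (\<Sum>C\<in>S. ht C z ^ (k div 2) * exp (- (2 * pi * n * ht C z)))"
      by (rule sum_distrib_left[symmetric])
    also have "\<dots> \<le> G z"
      unfolding G_def using z by (intro mult_left_mono weight_sum_le[OF z S]) auto
    finally show ?thesis .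
  qed
  have D_Im: "0 < Im z" if "z \<in> D" for z
    using that D_sub by auto
  have summable: "(\<lambda>C. norm (\<phi> (mact (rep C) z))) summable_on cosets" if "z \<in> D" for z
  proof (rule nonneg_bdd_above_summable_on)
    show "bdd_above (sum (\<lambda>C. norm (\<phi> (mact (rep C) z))) ` {S. S \<subseteq> cosets \<and> finite S})"
      using sum_le[OF D_Im[OF that]] by (intro bdd_aboveI[of _ "G z"]) auto
  qed simp
  have per: "\<phi> (w + of_int l) = \<phi> w" if "0 < Im w" for w l
  proof -
    have "slash k (cmat (transl (of_int l))) f w = f w"
      using f transl_mem[of l] that by (simp add: cusp_forms_def)
    then have "f (w + of_int l) = f w"
      by (simp add: slash_cmat)
    then show ?thesis by (simp add: \<phi>_def)
  qed
  have le: "(\<Sum>\<^sub>\<infinity>C\<in>cosets. norm (\<phi> (mact (rep C) z))) \<le> G z" if "z \<in> D" for z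
    by (rule infsum_le_finite_sums[OF summable[OF that] sum_le[OF D_Im[OF that]]])
  have G: "integrable domain_measure G"
    unfolding G_def using L1 by (rule integrable_mult_left)
  note unf = unfolding_integral[OF \<phi>m per summable le G]
  have "petersson D k P f = (LINT z:D|hyp_measure. \<Sum>\<^sub>\<infinity>C\<in>cosets. \<phi> (mact (rep C) z))"
    unfolding petersson_def
  proof (rule set_lebesgue_integral_cong)
    show "\<forall>z. z \<in> D \<longrightarrow> P z * cnj (f z) * of_real (Im z ^ k) = (\<Sum>\<^sub>\<infinity>C\<in>cosets. \<phi> (mact (rep C) z))"
    proof (intro allI impI)
      fix z assume "z \<in> D"
      then have z: "0 < Im z" by (rule D_Im)
      have "P z * (cnj (f z) * of_real (Im z ^ k)) =
          (\<Sum>\<^sub>\<infinity>C\<in>cosets. pterm n k (rep C) z * (cnj (f z) * of_real (Im z ^ k)))"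
        using z by (simp add: P_def infsum_cmult_left')
      also have "\<dots> = (\<Sum>\<^sub>\<infinity>C\<in>cosets. \<phi> (mact (rep C) z))"
        unfolding \<phi>_def using norm_cusp_form_act[OF f _ z] by (intro infsum_cong) simp
      finally show "P z * cnj (f z) * of_real (Im z ^ k) = (\<Sum>\<^sub>\<infinity>C\<in>cosets. \<phi> (mact (rep C) z))"
        by (simp only: mult.assoc)
    qed
  qed simp
  also have "\<dots> = (LINT z:strip|hyp_measure. \<phi> z)"
    by (rule unf(2)[symmetric])
  also have "\<dots> = cnj (coeff_infinity f n) * of_real (fact (k - 2) / (4 * pi * n) ^ (k - 1))"
    unfolding \<phi>_def using unf(1) k n
    by (intro strip_integral cusp_form_expansion[OF f] fm) (auto simp: \<phi>_def)
  finally show ?thesis .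
qed

theorem P_expansion:
  assumes F: "orthonormal_basis \<Gamma> D k F"
  shows "P = (\<lambda>z. \<Sum>f\<in>F. cnj (coeff_infinity f n) * of_real (fact (k - 2) / (4 * pi * n) ^ (k - 1)) * f z)"
proof -
  have fin: "finite F" and sub: "F \<subseteq> cusp_forms \<Gamma> k"
    and orth: "\<And>f g. f \<in> F \<Longrightarrow> g \<in> F \<Longrightarrow> petersson D k f g = (if f = g then 1 else 0)"
    and span: "\<And>g. g \<in> cusp_forms \<Gamma> k \<Longrightarrow> \<exists>a. g = (\<lambda>z. \<Sum>f\<in>F. a f * f z)"
    using F unfolding orthonormal_basis_def by blast+
  have D_Im: "0 < Im z" if "z \<in> D" for z
    using that D_sub by auto
  \<comment> \<open>The norm integral of \<open>f\<close> equals 1, and a non-integrable function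
    would have integral 0.\<close>
  have L2: "integrable domain_measure (\<lambda>z. (norm (f z))\<^sup>2 * Im z ^ k)" if f: "f \<in> F" for f
  proof -
    have "integrable domain_measure (\<lambda>z. f z * cnj (f z) * of_real (Im z ^ k))"
      using orth[OF f f] not_integrable_integral_eq unfolding petersson_domain by fastforce
    then have "integrable domain_measure (\<lambda>z. norm (f z * cnj (f z) * of_real (Im z ^ k)))"
      by (rule integrable_norm)
    then show ?thesis
      by (rule Bochner_Integration.integrable_cong[THEN iffD1, OF refl, rotated])
        (auto simp: norm_mult norm_power power2_eq_square dest!: D_Im)
  qed
  have int: "integrable domain_measure (\<lambda>z. f z * cnj (g z) * of_real (Im z ^ k))" if fg: "f \<in> F" "g \<in> F" for f g
  proof (rule Bochner_Integration.integrable_bound[OF Bochner_Integration.integrable_add[OF L2[OF fg(1)] L2[OF fg(2)]]])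
    have [measurable]: "f \<in> borel_measurable borel" "g \<in> borel_measurable borel"
      using fg sub cusp_form_measurable by blast+
    show "(\<lambda>z. f z * cnj (g z) * of_real (Im z ^ k)) \<in> borel_measurable domain_measure"
      by (rule measurable_domain) measurable
    show "AE z in domain_measure. norm (f z * cnj (g z) * of_real (Im z ^ k)) \<le>
        norm ((norm (f z))\<^sup>2 * Im z ^ k + (norm (g z))\<^sup>2 * Im z ^ k)"
    proof (rule AE_I2)
      fix z assume "z \<in> space domain_measure"
      then have z: "0 < Im z" using D_Im by simp
      have "norm (f z) * norm (g z) \<le> (norm (f z))\<^sup>2 + (norm (g z))\<^sup>2"
        using sum_squares_bound[of "norm (f z)" "norm (g z)"] mult_nonneg_nonneg[of "norm (f z)" "norm (g z)"]
          norm_ge_zero[of "f z"] norm_ge_zero[of "g z"]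
        by linarith
      then have "norm (f z) * norm (g z) * Im z ^ k \<le> ((norm (f z))\<^sup>2 + (norm (g z))\<^sup>2) * Im z ^ k"
        using z by (intro mult_right_mono) auto
      then show "norm (f z * cnj (g z) * of_real (Im z ^ k)) \<le>
          norm ((norm (f z))\<^sup>2 * Im z ^ k + (norm (g z))\<^sup>2 * Im z ^ k)"
        using z by (simp add: norm_mult norm_power distrib_right)
    qed
  qed
  obtain a where a: "P = (\<lambda>z. \<Sum>f\<in>F. a f * f z)"
    using span[OF P_cusp_form] by blast
  have "a g = cnj (coeff_infinity g n) * of_real (fact (k - 2) / (4 * pi * n) ^ (k - 1))" if g: "g \<in> F" for g
  proof -
    have "petersson D k P g = (\<integral>z. (\<Sum>f\<in>F. a f * (f z * cnj (g z) * of_real (Im z ^ k))) \<partial>domain_measure)"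
      unfolding petersson_domain a by (simp add: sum_distrib_right mult.assoc)
    also have "\<dots> = (\<Sum>f\<in>F. a f * petersson D k f g)"
      using int g by (subst Bochner_Integration.integral_sum) (auto simp: petersson_domain)
    also have "\<dots> = (\<Sum>f\<in>F. if f = g then a f else 0)"
      using orth g by (intro sum.cong) auto
    also have "\<dots> = a g"
      using fin g by simp
    finally show ?thesis
      using petersson_P[OF _ L2[OF g]] g sub by auto
  qed
  then show ?thesis
    unfolding a by (intro ext sum.cong) auto
qed

end

section \<open>Expansions around an interior point\<close>

lemma infsum_sum:
  fixes f :: "'i \<Rightarrow> 'c \<Rightarrow> complex"
  assumes "finite I" "\<And>i. i \<in> I \<Longrightarrow> f i summable_on A"
  shows "(\<Sum>\<^sub>\<infinity>x\<in>A. \<Sum>i\<in>I. f i x) = (\<Sum>i\<in>I. \<Sum>\<^sub>\<infinity>x\<in>A. f i x)"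
proof -
  have "((\<lambda>x. \<Sum>i\<in>I. f i x) has_sum (\<Sum>i\<in>I. \<Sum>\<^sub>\<infinity>x\<in>A. f i x)) A"
    using assms by (induction I rule: finite_induct) (auto intro!: has_sum_add has_sum_infsum)
  then show ?thesis
    by (rule infsumI)
qed

lemma higher_deriv_sum_complex:
  assumes "finite I" "\<And>i. i \<in> I \<Longrightarrow> f i holomorphic_on S" "open S" "z \<in> S"
  shows "(deriv ^^ m) (\<lambda>w. \<Sum>i\<in>I. f i w) z = (\<Sum>i\<in>I. (deriv ^^ m) (f i) z)"
  using assms(1,2)
proof (induction I rule: finite_induct)
  case (insert i I)
  have "(deriv ^^ m) (\<lambda>w. f i w + (\<Sum>i\<in>I. f i w)) z =
      (deriv ^^ m) (f i) z + (deriv ^^ m) (\<lambda>w. \<Sum>i\<in>I. f i w) z"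
    using insert.prems assms(3,4) by (intro higher_deriv_add[of _ S] holomorphic_on_sum) auto
  then show ?case
    using insert by simp
qed simp

definition disc_map :: "complex \<Rightarrow> complex \<Rightarrow> complex" where
  "disc_map z0 w = (z0 - cnj z0 * w) / (1 - w)"

text \<open>The matrix has determinant 1/(2 i beta) and automorphy factor (1 - w)/(2 i beta);
  together these leave the factor (2 i beta)^(k/2) seen in the final formula.\<close>

lemma slash_disc:
  assumes z0: "0 < Im z0" and k: "even k" and w: "w \<noteq> 1"
  shows "slash k (disc_to_plane z0) f w =
    (2 * \<i> * of_real (Im z0)) ^ (k div 2) * (f (disc_map z0 w) / (1 - w) ^ k)"
proof -
  define s where "s = 1 / (2 * \<i> * complex_of_real (Im z0))"
  have s: "s \<noteq> 0" using z0 by (simp add: s_def)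
  have e: "disc_to_plane z0 $ 1 $ 1 = s * (- cnj z0)" "disc_to_plane z0 $ 1 $ 2 = s * z0"
    "disc_to_plane z0 $ 2 $ 1 = - s" "disc_to_plane z0 $ 2 $ 2 = s"
    by (simp_all add: disc_to_plane_def s_def)
  have "z0 - cnj z0 = 2 * \<i> * complex_of_real (Im z0)"
    by (simp add: complex_eq_iff)
  then have "s * (z0 - cnj z0) = 1"
    using z0 by (simp add: s_def)
  moreover have "det (disc_to_plane z0) = s * (s * (z0 - cnj z0))"
    unfolding det_2 e by (simp add: algebra_simps)
  ultimately have d: "det (disc_to_plane z0) = s" by simp
  have j: "jfac (disc_to_plane z0) w = s * (1 - w)"
    unfolding jfac_def e by (simp add: algebra_simps)
  have "act (disc_to_plane z0) w = (s * (z0 - cnj z0 * w)) / (s * (1 - w))"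
    unfolding act_def moebius_def e by (simp add: algebra_simps)
  also have "\<dots> = disc_map z0 w"
    using s by (simp add: disc_map_def)
  finally have a: "act (disc_to_plane z0) w = disc_map z0 w" .
  have k2: "s ^ k = s ^ (k div 2) * s ^ (k div 2)"
    using k by (metis dvd_mult_div_cancel mult_2 power_add)
  have "s ^ (k div 2) * f (disc_map z0 w) / (s * (1 - w)) ^ k = (1 / s) ^ (k div 2) * (f (disc_map z0 w) / (1 - w) ^ k)"
    unfolding power_mult_distrib k2 using s by (simp add: power_divide)
  also have "1 / s = 2 * \<i> * complex_of_real (Im z0)"
    by (simp add: s_def)
  finally show ?thesis
    unfolding slash_def d a j .
qed

lemma Im_disc_map:
  assumes "w \<noteq> 1"
  shows "Im (disc_map z0 w) = Im z0 * (1 - (cmod w)\<^sup>2) / (cmod (1 - w))\<^sup>2"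
  unfolding disc_map_def Im_divide cmod_power2 by (simp add: algebra_simps power2_eq_square)

lemma Im_disc_map_pos:
  assumes "0 < Im z0" "norm w < 1"
  shows "0 < Im (disc_map z0 w)"
proof -
  have "w \<noteq> 1" using assms by auto
  moreover have "(cmod w)\<^sup>2 < 1"
    using assms by (simp add: power_less_one_iff abs_square_less_1)
  ultimately show ?thesis
    using assms by (simp add: Im_disc_map)
qed

text \<open>Places the image of |w| < 1/2 in a region covered by \<open>dom_bound\<close>. The
  constants come from 1/2 <= |1 - w| <= 3/2 and 1 - |w|^2 >= 3/4.\<close>

lemma disc_map_bounds:
  assumes z0: "0 < Im z0" and w: "norm w < 1/2"
  shows "\<bar>Re (disc_map z0 w)\<bar> \<le> 3 * cmod z0" "Im z0 / 3 \<le> Im (disc_map z0 w)" "1 / 2 < cmod (1 - w)"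
proof -
  show l: "1 / 2 < cmod (1 - w)"
    using w norm_triangle_ineq2[of 1 w] by simp
  have u: "cmod (1 - w) \<le> 3 / 2"
    using w norm_triangle_ineq4[of 1 w] by simp
  have "cmod (z0 - cnj z0 * w) \<le> cmod z0 + cmod z0 * cmod w"
    using norm_triangle_ineq4[of z0 "cnj z0 * w"] by (simp add: norm_mult)
  also have "\<dots> \<le> cmod z0 + cmod z0 * (1 / 2)"
    using w by (intro add_left_mono mult_left_mono) auto
  finally have "cmod (disc_map z0 w) \<le> (cmod z0 + cmod z0 * (1 / 2)) / (1 / 2)"
    unfolding disc_map_def norm_divide using l by (intro frac_le) auto
  then show "\<bar>Re (disc_map z0 w)\<bar> \<le> 3 * cmod z0"
    using abs_Re_le_cmod[of "disc_map z0 w"] by simp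
  have "(cmod w)\<^sup>2 \<le> (1 / 2)\<^sup>2"
    using w by (intro power_mono) auto
  then have n: "3 / 4 \<le> 1 - (cmod w)\<^sup>2" by (simp add: power2_eq_square)
  have "(cmod (1 - w))\<^sup>2 \<le> (3 / 2)\<^sup>2"
    using u by (intro power_mono) auto
  moreover have "w \<noteq> 1" using w by auto
  ultimately have "Im z0 * (3 / 4) / (3 / 2)\<^sup>2 \<le> Im z0 * (1 - (cmod w)\<^sup>2) / (cmod (1 - w))\<^sup>2"
    using z0 n l by (intro frac_le mult_left_mono zero_less_power) auto
  also have "\<dots> = Im (disc_map z0 w)"
    by (rule Im_disc_map[symmetric]) fact
  finally show "Im z0 / 3 \<le> Im (disc_map z0 w)"
    by (simp add: power2_eq_square)
qed

lemma holomorphic_disc_map: "disc_map z0 holomorphic_on ball 0 1"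
  unfolding disc_map_def by (intro holomorphic_intros) auto

lemma holomorphic_slash_disc:
  assumes f: "f holomorphic_on upper_half_plane" and z0: "0 < Im z0" and k: "even k"
  shows "slash k (disc_to_plane z0) f holomorphic_on ball 0 1"
proof -
  have "(f \<circ> disc_map z0) holomorphic_on ball 0 1"
    using Im_disc_map_pos[OF z0] by (intro holomorphic_on_compose_gen[OF holomorphic_disc_map f]) auto
  then have "(\<lambda>w. f (disc_map z0 w)) holomorphic_on ball 0 1"
    unfolding o_def .
  then have "(\<lambda>w. (2 * \<i> * of_real (Im z0)) ^ (k div 2) * (f (disc_map z0 w) / (1 - w) ^ k)) holomorphic_on ball 0 1"
    by (intro holomorphic_intros) auto
  then show ?thesis
  proof (rule holomorphic_transform)
    fix w :: complex assume "w \<in> ball 0 1"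
    then have "w \<noteq> 1" by auto
    then show "(2 * \<i> * of_real (Im z0)) ^ (k div 2) * (f (disc_map z0 w) / (1 - w) ^ k) =
        slash k (disc_to_plane z0) f w"
      by (rule slash_disc[OF z0 k, symmetric])
  qed
qed

lemma coeff_at_eq:
  assumes f: "f holomorphic_on upper_half_plane" and z0: "0 < Im z0" and k: "even k"
  shows "coeff_at k z0 f m = (deriv ^^ m) (slash k (disc_to_plane z0) f) 0 / fact m"
proof -
  let ?h = "slash k (disc_to_plane z0) f"
  have "coeff_at k z0 f = (\<lambda>m. (deriv ^^ m) ?h 0 / fact m)"
    unfolding coeff_at_def
  proof (rule the_equality)
    show "\<forall>w\<in>ball 0 1. (\<lambda>m. (deriv ^^ m) ?h 0 / fact m * w ^ m) sums ?h w"
      using holomorphic_power_series[OF holomorphic_slash_disc[OF f z0 k]] by auto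
  next
    fix c assume c: "\<forall>w\<in>ball 0 1. (\<lambda>m. c m * w ^ m) sums ?h w"
    have "?h has_fps_expansion Abs_fps c"
    proof (rule has_fps_expansionI)
      have "\<forall>\<^sub>F w in nhds 0. w \<in> ball 0 (1::real)"
        by (rule eventually_nhds_in_open) auto
      then show "\<forall>\<^sub>F w in nhds 0. (\<lambda>m. fps_nth (Abs_fps c) m * w ^ m) sums ?h w"
        by eventually_elim (use c in auto)
    qed
    from fps_nth_fps_expansion[OF this] show "c = (\<lambda>m. (deriv ^^ m) ?h 0 / fact m)"
      by auto
  qed
  then show ?thesis by simp
qed

lemma coeff_at_sum:
  assumes F: "finite F" and f: "\<And>f. f \<in> F \<Longrightarrow> f holomorphic_on upper_half_plane"
    and z0: "0 < Im z0" and k: "even k"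
  shows "coeff_at k z0 (\<lambda>z. \<Sum>f\<in>F. a f * f z) m = (\<Sum>f\<in>F. a f * coeff_at k z0 f m)"
proof -
  let ?h = "slash k (disc_to_plane z0)"
  have hol: "?h f holomorphic_on ball 0 1" if "f \<in> F" for f
    using holomorphic_slash_disc[OF f[OF that] z0 k] .
  have "(\<lambda>z. \<Sum>f\<in>F. a f * f z) holomorphic_on upper_half_plane"
    using f by (intro holomorphic_intros) auto
  then have "coeff_at k z0 (\<lambda>z. \<Sum>f\<in>F. a f * f z) m =
      (deriv ^^ m) (?h (\<lambda>z. \<Sum>f\<in>F. a f * f z)) 0 / fact m"
    by (rule coeff_at_eq[OF _ z0 k])
  also have "?h (\<lambda>z. \<Sum>f\<in>F. a f * f z) = (\<lambda>w. \<Sum>f\<in>F. a f * ?h f w)"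
    by (simp add: slash_def sum_distrib_left sum_divide_distrib fun_eq_iff mult_ac)
  also have "(deriv ^^ m) (\<lambda>w. \<Sum>f\<in>F. a f * ?h f w) 0 = (\<Sum>f\<in>F. (deriv ^^ m) (\<lambda>w. a f * ?h f w) 0)"
    by (rule higher_deriv_sum_complex[of F _ "ball 0 1"]) (use hol F in \<open>auto intro!: holomorphic_intros\<close>)
  also have "\<dots> = (\<Sum>f\<in>F. a f * (deriv ^^ m) (?h f) 0)"
    by (intro sum.cong refl higher_deriv_cmult[of _ "ball 0 1"] hol) auto
  also have "\<dots> / fact m = (\<Sum>f\<in>F. a f * coeff_at k z0 f m)"
    using coeff_at_eq[OF f z0 k] by (simp add: sum_divide_distrib)
  finally show ?thesis .
qed

text \<open>The generating function of the Laguerre polynomials \<open>L\<^sub>m\<^sup>(\<^sup>k\<^sup>-\<^sup>1\<^sup>)(-x)\<close>.\<close>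

lemma laguerre_coeff:
  fixes x u :: complex
  assumes k: "0 < k"
  shows "(deriv ^^ m) (\<lambda>w. exp (x * (u * w / (1 - u * w))) / (1 - u * w) ^ k) 0 / fact m =
    u ^ m * (\<Sum>j=0..m. of_nat ((m + k - 1) choose (m - j)) * x ^ j / fact j)"
proof -
  define Y where "Y = fps_const u * fps_X"
  define I where "I = inverse (1 - Y)"
  have Y0: "fps_nth Y 0 = 0" by (simp add: Y_def)
  have G0: "fps_nth (Y * I) 0 = 0" by (simp add: Y0)
  have Yx: "(\<lambda>w. u * w) has_fps_expansion Y"
    unfolding Y_def by (intro fps_expansion_intros)
  have Ix: "(\<lambda>w. inverse (1 - u * w)) has_fps_expansion I"
    unfolding I_def using Y0 by (intro fps_expansion_intros Yx) simp
  have "((\<lambda>v. exp (x * v)) \<circ> (\<lambda>w. u * w * inverse (1 - u * w))) has_fps_expansion fps_compose (fps_exp x) (Y * I)"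
    by (intro has_fps_expansion_compose has_fps_expansion_exp has_fps_expansion_mult Yx Ix G0)
  then have "(\<lambda>w. ((\<lambda>v. exp (x * v)) \<circ> (\<lambda>w. u * w * inverse (1 - u * w))) w * inverse (1 - u * w) ^ k)
      has_fps_expansion fps_compose (fps_exp x) (Y * I) * I ^ k"
    by (intro has_fps_expansion_mult has_fps_expansion_power Ix)
  then have "(\<lambda>w. exp (x * (u * w / (1 - u * w))) / (1 - u * w) ^ k) has_fps_expansion
      fps_compose (fps_exp x) (Y * I) * I ^ k"
    by (simp add: o_def divide_inverse power_inverse)
  from fps_nth_fps_expansion[OF this, of m]
  have "(deriv ^^ m) (\<lambda>w. exp (x * (u * w / (1 - u * w))) / (1 - u * w) ^ k) 0 / fact m =
      fps_nth (fps_compose (fps_exp x) (Y * I) * I ^ k) m" ..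
  also have "\<dots> = (\<Sum>a=0..m. (\<Sum>j=0..a. x ^ j / fact j * fps_nth ((Y * I) ^ j) a) * fps_nth (I ^ k) (m - a))"
    by (simp add: fps_mult_nth fps_compose_nth)
  \<comment> \<open>The inner range may be extended to \<open>m\<close> because (Y I)^j has no terms
    of degree below j; after that the two sums can be exchanged.\<close>
  also have "\<dots> = (\<Sum>a=0..m. (\<Sum>j=0..m. x ^ j / fact j * fps_nth ((Y * I) ^ j) a) * fps_nth (I ^ k) (m - a))"
  proof (rule sum.cong[OF refl])
    fix a assume "a \<in> {0..m}"
    then have "(\<Sum>j=0..a. x ^ j / fact j * fps_nth ((Y * I) ^ j) a) = (\<Sum>j=0..m. x ^ j / fact j * fps_nth ((Y * I) ^ j) a)"
      by (intro sum.mono_neutral_left) (use startsby_zero_power_prefix[OF G0] in auto)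
    then show "(\<Sum>j=0..a. x ^ j / fact j * fps_nth ((Y * I) ^ j) a) * fps_nth (I ^ k) (m - a) =
        (\<Sum>j=0..m. x ^ j / fact j * fps_nth ((Y * I) ^ j) a) * fps_nth (I ^ k) (m - a)"
      by (simp only:)
  qed
  also have "\<dots> = (\<Sum>j=0..m. x ^ j / fact j * fps_nth ((Y * I) ^ j * I ^ k) m)"
    unfolding fps_mult_nth sum_distrib_left sum_distrib_right
    by (subst sum.swap) (simp add: mult.assoc)
  also have "\<dots> = (\<Sum>j=0..m. u ^ m * (of_nat ((m + k - 1) choose (m - j)) * x ^ j / fact j))"
  proof (intro sum.cong refl)
    fix j assume j: "j \<in> {0..m}"
    have "(Y * I) ^ j * I ^ k = fps_X ^ j * (fps_const (u ^ j) * I ^ (j + k))"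
      by (simp add: Y_def power_mult_distrib power_add mult_ac)
    then have "fps_nth ((Y * I) ^ j * I ^ k) m = u ^ j * fps_nth (I ^ (j + k)) (m - j)"
      using j by (simp add: fps_X_power_mult_nth)
    \<comment> \<open>The negative binomial series, read at degree i = m - j: its upper index j + k
      + i - 1 becomes m + k - 1 for every j.\<close>
    also have "I ^ (j + k) = Abs_fps (\<lambda>i. of_nat ((j + k + i - 1) choose i) * u ^ i)"
      unfolding I_def Y_def fps_inverse_power[symmetric]
      by (rule one_minus_const_fps_X_neg_power') (use k in simp)
    finally show "x ^ j / fact j * fps_nth ((Y * I) ^ j * I ^ k) m =
        u ^ m * (of_nat ((m + k - 1) choose (m - j)) * x ^ j / fact j)"
      using j by (simp add: add.commute power_add[symmetric])
  qed
  finally show ?thesis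
    by (simp add: sum_distrib_left)
qed

lemma jf_disc_map:
  assumes "w \<noteq> 1"
  shows "jf A (disc_map z0 w) * (1 - w) = jf A z0 - cnj (jf A z0) * w"
  using assms by (simp add: jfac_def disc_map_def field_simps)

text \<open>A real matrix carries the disc chart centred at z0 to the one centred at its image Z, up
  to the rotation w to v: the right-hand side of the first claim is (Z - conj(Z) v) / (1 -
  v).\<close>

lemma mact_disc_map:
  assumes A: "det A = 1" and z0: "0 < Im z0" and w: "norm w < 1"
  defines "v \<equiv> cnj (jf A z0) / jf A z0 * w"
  shows "mact A (disc_map z0 w) = mact A z0 + 2 * \<i> * of_real (Im (mact A z0)) * (v / (1 - v))"
    and "jf A (disc_map z0 w) * (1 - w) = jf A z0 * (1 - v)"
    and "v \<noteq> 1"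
proof -
  let ?J = "jf A z0" and ?Z = "mact A z0"
  have J: "?J \<noteq> 0" using A z0 by (rule jf_nonzero)
  have w1: "w \<noteq> 1" using w by auto
  have "norm v < 1"
    using J w by (simp add: v_def norm_mult norm_divide)
  then show v1: "v \<noteq> 1" by auto
  show j: "jf A (disc_map z0 w) * (1 - w) = ?J * (1 - v)"
    unfolding jf_disc_map[OF w1] using J by (simp add: v_def algebra_simps)
  have N: "of_real (A$1$1) * z0 + of_real (A$1$2) = ?Z * ?J"
    using J by (simp add: mact_eq)
  then have N': "of_real (A$1$1) * cnj z0 + of_real (A$1$2) = cnj ?Z * cnj ?J"
    by (metis complex_cnj_add complex_cnj_complex_of_real complex_cnj_mult)
  have "mact A (disc_map z0 w) =
      ((of_real (A$1$1) * disc_map z0 w + of_real (A$1$2)) * (1 - w)) / (jf A (disc_map z0 w) * (1 - w))"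
    using w1 by (simp add: mact_eq)
  also have "(of_real (A$1$1) * disc_map z0 w + of_real (A$1$2)) * (1 - w) =
      (of_real (A$1$1) * z0 + of_real (A$1$2)) - (of_real (A$1$1) * cnj z0 + of_real (A$1$2)) * w"
    using w1 by (simp add: disc_map_def field_simps)
  also have "\<dots> = ?J * (?Z - cnj ?Z * v)"
    unfolding N N' using J by (simp add: v_def algebra_simps)
  also have "\<dots> / (jf A (disc_map z0 w) * (1 - w)) = (?Z - cnj ?Z * v) / (1 - v)"
    unfolding j using J by simp
  also have "?Z - cnj ?Z * v = ?Z * (1 - v) + 2 * \<i> * of_real (Im ?Z) * v"
  proof -
    have c: "cnj ?Z = ?Z - 2 * \<i> * of_real (Im ?Z)"
      by (simp add: complex_eq_iff)
    show ?thesis unfolding c by (simp add: algebra_simps)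
  qed
  also have "\<dots> / (1 - v) = ?Z + 2 * \<i> * of_real (Im ?Z) * (v / (1 - v))"
    using v1 by (simp add: add_divide_distrib)
  finally show "mact A (disc_map z0 w) = ?Z + 2 * \<i> * of_real (Im ?Z) * (v / (1 - v))" .
qed

text \<open>Inserting \<open>mact_disc_map\<close> into the exponential gives the factor 2 pi i n *
  2 i Im(Az0) = -4 pi n Im(Az0) in front of v/(1 - v), and \<open>laguerre_coeff\<close> applies
  with \<open>u\<close> the rotation.\<close>

lemma pterm_disc_coeff:
  assumes A: "det A = 1" and z0: "0 < Im z0" and k: "0 < k"
  shows "(deriv ^^ m) (\<lambda>w. pterm n k A (disc_map z0 w) / (1 - w) ^ k) 0 / fact m =
    pterm n k A z0 * (cnj (jf A z0) / jf A z0) ^ m *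
    (\<Sum>j=0..m. of_nat ((m + k - 1) choose (m - j)) * of_real (- (4 * pi * n * Im (mact A z0))) ^ j / fact j)"
proof -
  define u where "u = cnj (jf A z0) / jf A z0"
  define x where "x = complex_of_real (- (4 * pi * n * Im (mact A z0)))"
  define L where "L w = exp (x * (u * w / (1 - u * w))) / (1 - u * w) ^ k" for w
  have u: "norm u = 1"
    using jf_nonzero[OF A z0] by (simp add: u_def norm_divide)
  have eq: "pterm n k A (disc_map z0 w) / (1 - w) ^ k = pterm n k A z0 * L w" if w: "norm w < 1" for w
  proof -
    note m = mact_disc_map[OF A z0 w, folded u_def]
    have "cexp n (mact A (disc_map z0 w)) = cexp n (mact A z0) * exp (x * (u * w / (1 - u * w)))"
      unfolding m(1) cexp_def exp_add[symmetric] by (simp add: x_def algebra_simps)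
    moreover have "jf A (disc_map z0 w) ^ k * (1 - w) ^ k = jf A z0 ^ k * (1 - u * w) ^ k"
      unfolding power_mult_distrib[symmetric] m(2) ..
    ultimately show ?thesis
      by (simp add: pterm_def L_def)
  qed
  have "\<forall>\<^sub>F w in nhds 0. w \<in> ball 0 (1::real)"
    by (rule eventually_nhds_in_open) auto
  then have "\<forall>\<^sub>F w in nhds 0. pterm n k A (disc_map z0 w) / (1 - w) ^ k = pterm n k A z0 * L w"
    by eventually_elim (use eq in auto)
  then have "(deriv ^^ m) (\<lambda>w. pterm n k A (disc_map z0 w) / (1 - w) ^ k) 0 = (deriv ^^ m) (\<lambda>w. pterm n k A z0 * L w) 0"
    by (rule higher_deriv_cong_ev) simp
  also have "\<dots> = pterm n k A z0 * (deriv ^^ m) L 0"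
  proof (rule higher_deriv_cmult[of _ "ball 0 1"])
    have "1 - u * w \<noteq> 0" if "norm w < 1" for w
      using that u by (metis mult_1 norm_mult norm_one less_irrefl right_minus_eq)
    then show "L holomorphic_on ball 0 1"
      unfolding L_def by (intro holomorphic_intros) auto
  qed auto
  finally have E: "(deriv ^^ m) (\<lambda>w. pterm n k A (disc_map z0 w) / (1 - w) ^ k) 0 = pterm n k A z0 * (deriv ^^ m) L 0" .
  have "(deriv ^^ m) L 0 / fact m =
      u ^ m * (\<Sum>j=0..m. of_nat ((m + k - 1) choose (m - j)) * x ^ j / fact j)"
    unfolding L_def[abs_def] by (rule laguerre_coeff[OF k])
  then show ?thesis
    unfolding E u_def[symmetric] x_def[symmetric] by (simp only: times_divide_eq_right[symmetric] mult.assoc)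
qed

context poincare
begin

text \<open>The series converges uniformly for |w| < 1/2, so by Weierstrass it may be differentiated
  term by term at 0.\<close>

lemma summable_pterm_disc:
  assumes z0: "0 < Im z0"
  shows "((\<lambda>C. (deriv ^^ m) (\<lambda>w. pterm n k (rep C) (disc_map z0 w) / (1 - w) ^ k) 0) has_sum
    (deriv ^^ m) (\<lambda>w. \<Sum>\<^sub>\<infinity>C\<in>cosets. pterm n k (rep C) (disc_map z0 w) / (1 - w) ^ k) 0) cosets"
proof -
  let ?T = "\<lambda>C w. pterm n k (rep C) (disc_map z0 w) / (1 - w) ^ k"
  let ?B = "ball (0::complex) (1/2)"
  have hol: "?T C holomorphic_on ?B" if C: "C \<in> cosets" for C
  proof -
    have "(pterm n k (rep C) \<circ> disc_map z0) holomorphic_on ball 0 1"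
      using Im_disc_map_pos[OF z0]
      by (intro holomorphic_on_compose_gen[OF holomorphic_disc_map holomorphic_pterm[OF det_rep[OF C]]]) auto
    then have "(\<lambda>w. pterm n k (rep C) (disc_map z0 w)) holomorphic_on ball 0 1"
      unfolding o_def .
    then have "?T C holomorphic_on ball 0 1"
      by (intro holomorphic_intros) auto
    then show ?thesis
      by (rule holomorphic_on_subset) auto
  qed
  have "uniform_limit ?B (\<lambda>S w. \<Sum>C\<in>S. ?T C w) (\<lambda>w. \<Sum>\<^sub>\<infinity>C\<in>cosets. ?T C w) (finite_subsets_at_top cosets)"
  proof (rule Weierstrass_m_test_general)
    fix C w assume C: "C \<in> cosets" and w: "w \<in> ?B"
    then have w: "norm w < 1/2" by simp
    note b = disc_map_bounds[OF z0 w]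
    have "norm (pterm n k (rep C ** mat 1) (disc_map z0 w)) \<le> dom_bound (mat 1) (3 * cmod z0) (Im z0 / 3) C"
      using b z0 by (intro dom_bound[OF C]) auto
    moreover have "(1 / 2) ^ k \<le> cmod (1 - w) ^ k"
      using b(3) by (intro power_mono) auto
    ultimately have "norm (pterm n k (rep C) (disc_map z0 w)) / cmod (1 - w) ^ k \<le>
        dom_bound (mat 1) (3 * cmod z0) (Im z0 / 3) C / (1 / 2) ^ k"
      by (intro frac_le order_trans[OF norm_ge_zero]) auto
    then show "norm (?T C w) \<le> dom_bound (mat 1) (3 * cmod z0) (Im z0 / 3) C * 2 ^ k"
      by (simp add: norm_divide norm_power power_divide)
  next
    show "(\<lambda>C. dom_bound (mat 1) (3 * cmod z0) (Im z0 / 3) C * 2 ^ k) summable_on cosets"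
      by (intro summable_on_cmult_left summable_dom_bound) simp
  qed
  then have "((\<lambda>S. (deriv ^^ m) (\<lambda>w. \<Sum>C\<in>S. ?T C w) 0) \<longlongrightarrow>
      (deriv ^^ m) (\<lambda>w. \<Sum>\<^sub>\<infinity>C\<in>cosets. ?T C w) 0) (finite_subsets_at_top cosets)"
  proof (rule higher_deriv_complex_uniform_limit)
    show "\<forall>\<^sub>F S in finite_subsets_at_top cosets. (\<lambda>w. \<Sum>C\<in>S. ?T C w) holomorphic_on ?B"
      by (rule eventually_finite_subsets_at_top_weakI) (intro holomorphic_on_sum hol, auto)
  qed auto
  moreover have "\<forall>\<^sub>F S in finite_subsets_at_top cosets.
      (deriv ^^ m) (\<lambda>w. \<Sum>C\<in>S. ?T C w) 0 = (\<Sum>C\<in>S. (deriv ^^ m) (?T C) 0)"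
  proof (rule eventually_finite_subsets_at_top_weakI)
    fix S assume "finite S" "S \<subseteq> cosets"
    then show "(deriv ^^ m) (\<lambda>w. \<Sum>C\<in>S. ?T C w) 0 = (\<Sum>C\<in>S. (deriv ^^ m) (?T C) 0)"
      by (intro higher_deriv_sum_complex[of S _ ?B] hol) auto
  qed
  ultimately show ?thesis
    unfolding has_sum_def by (rule Lim_transform_eventually)
qed

text \<open>The summand of \<open>poincare_F\<close> in weight k + 2m at s = k/2 + j. The exponent s
  - (k + 2m)/2 = j - m can be negative, hence the quotient of powers.\<close>

definition Fterm :: "complex \<Rightarrow> nat \<Rightarrow> nat \<Rightarrow> (real^2^2) set \<Rightarrow> complex" where
  "Fterm z m j C = of_real (ht C z ^ j / ht C z ^ m) / jf (rep C) z ^ (k + 2 * m) * cexp n (mact (rep C) z)"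

lemma poincare_F_eq:
  assumes z: "0 < Im z"
  shows "poincare_F \<Gamma> (k + 2 * m) z n (of_nat k / 2 + of_nat j) = (\<Sum>\<^sub>\<infinity>C\<in>cosets. Fterm z m j C)"
  unfolding poincare_F_def Let_def rep_def[symmetric] cexp_def[symmetric]
proof (rule infsum_cong)
  fix C assume "C \<in> cosets"
  then have h: "0 < ht C z" using z by (rule ht_pos)
  have e: "of_nat k / 2 + of_nat j - of_nat (k + 2 * m) / 2 = (of_real (real j - real m) :: complex)"
    by (simp add: field_simps)
  have "complex_of_real (ht C z) powr of_real (real j - real m) = of_real (ht C z powr (real j - real m))"
    using h by (subst powr_of_real) auto
  also have "ht C z powr (real j - real m) = ht C z ^ j / ht C z ^ m"
    using h by (simp add: powr_diff powr_realpow)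
  finally show "of_real (ht C z) powr (of_nat k / 2 + of_nat j - of_nat (k + 2 * m) / 2) /
      jf (rep C) z ^ (k + 2 * m) * cexp n (mact (rep C) z) = Fterm z m j C"
    unfolding e Fterm_def by (simp only:)
qed

text \<open>The unimodular factor is rewritten by |J|^2 = Im z / \<open>ht C z\<close>: conj(J)^m /
  J^(k+m) = (Im z / \<open>ht C z\<close>)^m / J^(k+2m).\<close>

lemma Fterm_eq:
  assumes C: "C \<in> cosets" and z: "0 < Im z"
  shows "pterm n k (rep C) z * (cnj (jf (rep C) z) / jf (rep C) z) ^ m * of_real (ht C z) ^ j =
    of_real (Im z) ^ m * Fterm z m j C"
proof -
  let ?J = "jf (rep C) z"
  have J: "?J \<noteq> 0" using det_rep[OF C] z by (rule jf_nonzero)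
  have "complex_of_real (ht C z) = of_real (Im z) / (?J * cnj ?J)"
    unfolding ht_eq[OF C z] by (simp only: of_real_divide complex_norm_square)
  then have h: "complex_of_real (ht C z) ^ m = of_real (Im z) ^ m / (?J ^ m * cnj ?J ^ m)"
    by (simp only: power_divide power_mult_distrib)
  have p: "?J ^ (k + 2 * m) = ?J ^ k * (?J ^ m * ?J ^ m)"
    by (simp add: power_add mult_2)
  have "of_real (Im z) ^ m * Fterm z m j C =
      of_real (ht C z) ^ j * cexp n (mact (rep C) z) * (of_real (Im z) ^ m / complex_of_real (ht C z) ^ m / ?J ^ (k + 2 * m))"
    by (simp add: Fterm_def)
  also have "of_real (Im z) ^ m / complex_of_real (ht C z) ^ m / ?J ^ (k + 2 * m) = cnj ?J ^ m / (?J ^ k * ?J ^ m)"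
    unfolding h p using J z by (simp add: field_simps)
  finally show ?thesis
    by (simp add: pterm_def power_divide)
qed

text \<open>The power of the height from the Laguerre sum is absorbed by the exponential at the cost
  of j!, leaving the series of \<open>summable_jf\<close>.\<close>

lemma summable_Fterm:
  assumes z: "0 < Im z"
  shows "Fterm z m j summable_on cosets"
proof (rule abs_summable_summable)
  have "(\<lambda>C. fact j / Im z ^ m * (1 / cmod (jf (rep C) z) ^ k)) summable_on cosets"
    using k z by (intro summable_on_cmult_right summable_jf) auto
  then show "(\<lambda>C. norm (Fterm z m j C)) summable_on cosets"
  proof (rule summable_on_comparison_test)
    fix C assume C: "C \<in> cosets"
    let ?J = "jf (rep C) z"
    have J: "?J \<noteq> 0" using det_rep[OF C] z by (rule jf_nonzero)
    have h: "0 < ht C z" using ht_pos[OF C z] .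
    have n1: "norm (of_real (Im z) ^ m * Fterm z m j C) = exp (- (2 * pi * n * ht C z)) / cmod ?J ^ k * ht C z ^ j"
      unfolding Fterm_eq[OF C z, symmetric]
      using J h by (simp add: norm_mult norm_power norm_divide pterm_def norm_cexp)
    have "norm (Fterm z m j C) = norm (of_real (Im z) ^ m * Fterm z m j C) / Im z ^ m"
      using z by (simp add: norm_mult norm_power)
    then have e: "norm (Fterm z m j C) = (ht C z ^ j * exp (- (2 * pi * n * ht C z))) / Im z ^ m * (1 / cmod ?J ^ k)"
      unfolding n1 by (simp add: mult_ac)
    have "ht C z \<le> 2 * pi * n * ht C z"
    proof -
      have "1 * 1 \<le> (2 * pi) * real n"
        using n pi_gt3 by (intro mult_mono) auto
      then show ?thesis
        using h by simp
    qed
    then have "ht C z ^ j * exp (- (2 * pi * n * ht C z)) \<le> ht C z ^ j * exp (- ht C z)"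
      using h by (intro mult_left_mono) auto
    also have "\<dots> \<le> fact j"
      using h by (intro power_exp_bound) simp
    finally have "ht C z ^ j * exp (- (2 * pi * n * ht C z)) \<le> fact j" .
    then show "norm (Fterm z m j C) \<le> fact j / Im z ^ m * (1 / cmod ?J ^ k)"
      unfolding e using z by (intro mult_right_mono divide_right_mono) auto
  qed simp
qed

text \<open>The Taylor coefficients of the pulled-back terms are summed over the cosets; summability
  for each of the finitely many \<open>j\<close> permits exchanging the two sums, and each inner sum
  is a value of \<open>poincare_F\<close>.\<close>

theorem coeff_at_P:
  assumes z0: "0 < Im z0"
  shows "coeff_at k z0 P m = (2 * \<i> * of_real (Im z0)) ^ (k div 2) * of_real (Im z0) ^ m *
    (\<Sum>j=0..m. of_nat ((m + k - 1) choose (m - j)) * of_real (- (4 * pi * n)) ^ j / fact j *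
      poincare_F \<Gamma> (k + 2 * m) z0 n (of_nat k / 2 + of_nat j))"
proof -
  let ?T = "\<lambda>C w. pterm n k (rep C) (disc_map z0 w) / (1 - w) ^ k"
  let ?c = "(2 * \<i> * complex_of_real (Im z0)) ^ (k div 2)"
  define a where "a j = of_nat ((m + k - 1) choose (m - j)) * complex_of_real (- (4 * pi * n)) ^ j / fact j" for j
  have hP: "P holomorphic_on upper_half_plane"
    using P_cusp_form by (simp add: cusp_forms_def)
  have sl: "slash k (disc_to_plane z0) P w = ?c * (\<Sum>\<^sub>\<infinity>C\<in>cosets. ?T C w)" if w: "norm w < 1" for w
  proof -
    have "w \<noteq> 1" using w by auto
    then have "slash k (disc_to_plane z0) P w = ?c * (P (disc_map z0 w) / (1 - w) ^ k)"
      using z0 k by (intro slash_disc) auto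
    also have "P (disc_map z0 w) / (1 - w) ^ k = (\<Sum>\<^sub>\<infinity>C\<in>cosets. ?T C w)"
      using Im_disc_map_pos[OF z0 w] by (simp add: P_def divide_inverse infsum_cmult_left')
    finally show ?thesis .
  qed
  have "\<forall>\<^sub>F w in nhds 0. w \<in> ball 0 (1::real)"
    by (rule eventually_nhds_in_open) auto
  then have ev: "\<forall>\<^sub>F w in nhds 0. (\<Sum>\<^sub>\<infinity>C\<in>cosets. ?T C w) = (1 / ?c) * slash k (disc_to_plane z0) P w"
    by eventually_elim (use sl z0 in auto)
  have "(deriv ^^ m) (\<lambda>w. \<Sum>\<^sub>\<infinity>C\<in>cosets. ?T C w) 0 =
      (deriv ^^ m) (\<lambda>w. (1 / ?c) * slash k (disc_to_plane z0) P w) 0"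
    by (rule higher_deriv_cong_ev[OF ev refl])
  also have "\<dots> = (1 / ?c) * (deriv ^^ m) (slash k (disc_to_plane z0) P) 0"
    by (rule higher_deriv_cmult[of _ "ball 0 1"]) (use holomorphic_slash_disc[OF hP z0] k in auto)
  finally have "coeff_at k z0 P m = ?c * ((deriv ^^ m) (\<lambda>w. \<Sum>\<^sub>\<infinity>C\<in>cosets. ?T C w) 0 / fact m)"
    using z0 k by (simp add: coeff_at_eq[OF hP])
  also have "(deriv ^^ m) (\<lambda>w. \<Sum>\<^sub>\<infinity>C\<in>cosets. ?T C w) 0 = (\<Sum>\<^sub>\<infinity>C\<in>cosets. (deriv ^^ m) (?T C) 0)"
    by (rule infsumI[symmetric]) (rule summable_pterm_disc[OF z0])
  also have "\<dots> / fact m = (\<Sum>\<^sub>\<infinity>C\<in>cosets. (deriv ^^ m) (?T C) 0 / fact m)"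
    unfolding divide_inverse by (rule infsum_cmult_left'[symmetric])
  also have "\<dots> = (\<Sum>\<^sub>\<infinity>C\<in>cosets. \<Sum>j=0..m. of_real (Im z0) ^ m * a j * Fterm z0 m j C)"
  proof (rule infsum_cong)
    fix C assume C: "C \<in> cosets"
    let ?p = "pterm n k (rep C) z0 * (cnj (jf (rep C) z0) / jf (rep C) z0) ^ m"
    have "(deriv ^^ m) (?T C) 0 / fact m =
      ?p * (\<Sum>j=0..m. of_nat ((m + k - 1) choose (m - j)) * of_real (- (4 * pi * n * ht C z0)) ^ j / fact j)"
      using k by (intro pterm_disc_coeff det_rep[OF C] z0) auto
    also have "\<dots> = (\<Sum>j=0..m. a j * (?p * of_real (ht C z0) ^ j))"
      unfolding sum_distrib_left
    proof (rule sum.cong[OF refl])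
      fix j
      have e: "complex_of_real (- (4 * pi * n * ht C z0)) ^ j = of_real (- (4 * pi * n)) ^ j * of_real (ht C z0) ^ j"
        by (simp add: power_mult_distrib[symmetric])
      show "?p * (of_nat ((m + k - 1) choose (m - j)) * of_real (- (4 * pi * n * ht C z0)) ^ j / fact j) =
          a j * (?p * of_real (ht C z0) ^ j)"
        unfolding e a_def by (simp add: mult_ac)
    qed
    also have "\<dots> = (\<Sum>j=0..m. of_real (Im z0) ^ m * a j * Fterm z0 m j C)"
      unfolding Fterm_eq[OF C z0] by (simp add: mult_ac)
    finally show "(deriv ^^ m) (?T C) 0 / fact m = (\<Sum>j=0..m. of_real (Im z0) ^ m * a j * Fterm z0 m j C)" .
  qed
  also have "\<dots> = (\<Sum>j=0..m. \<Sum>\<^sub>\<infinity>C\<in>cosets. of_real (Im z0) ^ m * a j * Fterm z0 m j C)"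
    by (rule infsum_sum) (auto intro!: summable_on_cmult_right summable_Fterm z0)
  also have "\<dots> = (\<Sum>j=0..m. of_real (Im z0) ^ m * (a j * poincare_F \<Gamma> (k + 2 * m) z0 n (of_nat k / 2 + of_nat j)))"
    unfolding poincare_F_eq[OF z0] infsum_cmult_right' by (simp only: mult.assoc)
  finally show ?thesis
    unfolding sum_distrib_left[symmetric] a_def by (simp only: mult.assoc)
qed

end

theorem theorem8p2:
  fixes \<Gamma> :: "(real^2^2) set" and D :: "complex set" and k m n :: nat and z0 :: complex
    and F :: "(complex \<Rightarrow> complex) set"
  assumes "subgroup \<Gamma> SL2R"
    and "discrete \<Gamma>"
    and "finitely_generated \<Gamma>"
    and "fundamental_domain \<Gamma> D"
    and "emeasure hyp_measure D < \<infinity>"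
    and "stab_infinity \<Gamma> =
           {mat2 1 (of_int l) 0 1 | l :: int. True} \<union> {- mat2 1 (of_int l) 0 1 | l :: int. True}"
    and "k \<ge> 4" and "even k"
    and "z0 \<in> upper_half_plane"
    and "n \<ge> 1"
    and "orthonormal_basis \<Gamma> D k F"
  shows "(\<Sum>f\<in>F. coeff_at k z0 f m * cnj (coeff_infinity f n)) =
      - ((2 * \<i>) ^ (k div 2)) * of_real (Im z0) ^ (m + k div 2) / fact (k - 2) *
      (\<Sum>j=0..m. of_nat ((m + k - 1) choose (m - j)) *
         of_real (- 4 * pi * real n) ^ (k + j - 1) / fact j *
         poincare_F \<Gamma> (k + 2 * m) z0 n (of_nat k / 2 + of_nat j))"
proof -
  interpret poincare_domain \<Gamma> n k D
    by (intro poincare_domain.intro poincare.intro cusp_group_domain.intro cusp_group.intro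
        poincare_axioms.intro cusp_group_domain_axioms.intro assms)
  have z0: "0 < Im z0" using assms by simp
  define r where "r = complex_of_real (- (4 * pi * n))"
  define b where "b = complex_of_real (Im z0)"
  define a where "a j = of_nat ((m + k - 1) choose (m - j)) / fact j *
      poincare_F \<Gamma> (k + 2 * m) z0 n (of_nat k / 2 + of_nat j)" for j
  have r: "r \<noteq> 0" using assms by (simp add: r_def)
  have F: "finite F" "\<And>f. f \<in> F \<Longrightarrow> f holomorphic_on upper_half_plane"
    using assms unfolding orthonormal_basis_def cusp_forms_def by auto
  \<comment> \<open>Origin of the leading minus sign: passing from 4 pi n to its negative
    \<open>r\<close> in an odd power.\<close>
  have "odd (k - 1)" using assms by simp
  then have sgn: "complex_of_real (fact (k - 2) / (4 * pi * n) ^ (k - 1)) = - (fact (k - 2) / r ^ (k - 1))"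
    by (simp add: r_def)
  \<comment> \<open>The m-th coefficient at \<open>z0\<close> is applied to both sides of the
    expansion of \<open>P\<close>; the wanted sum appears up to a nonzero constant and is solved
    for.\<close>
  have "coeff_at k z0 P m = (\<Sum>f\<in>F. cnj (coeff_infinity f n) * of_real (fact (k - 2) / (4 * pi * n) ^ (k - 1)) * coeff_at k z0 f m)"
    unfolding P_expansion[OF assms(11)] by (rule coeff_at_sum[OF F z0 assms(8)])
  also have "\<dots> = - (fact (k - 2) / r ^ (k - 1)) * (\<Sum>f\<in>F. coeff_at k z0 f m * cnj (coeff_infinity f n))"
    unfolding sgn sum_distrib_left by (simp only: mult_ac)
  finally have "(\<Sum>f\<in>F. coeff_at k z0 f m * cnj (coeff_infinity f n)) = - (r ^ (k - 1) / fact (k - 2)) * coeff_at k z0 P m"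
    using r by (simp add: field_simps)
  also have "coeff_at k z0 P m = (2 * \<i>) ^ (k div 2) * b ^ (m + k div 2) * (\<Sum>j=0..m. r ^ j * a j)"
    unfolding coeff_at_P[OF z0] a_def r_def[symmetric] b_def[symmetric]
    by (simp add: power_mult_distrib power_add mult_ac)
  also have "- (r ^ (k - 1) / fact (k - 2)) * ((2 * \<i>) ^ (k div 2) * b ^ (m + k div 2) * (\<Sum>j=0..m. r ^ j * a j)) =
      - ((2 * \<i>) ^ (k div 2)) * b ^ (m + k div 2) / fact (k - 2) * (\<Sum>j=0..m. r ^ (k - 1) * r ^ j * a j)"
  proof -
    have S: "(\<Sum>j=0..m. r ^ (k - 1) * r ^ j * a j) = r ^ (k - 1) * (\<Sum>j=0..m. r ^ j * a j)"
      unfolding sum_distrib_left by (simp only: mult.assoc)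
    show ?thesis
      unfolding S by simp
  qed
  also have "(\<Sum>j=0..m. r ^ (k - 1) * r ^ j * a j) =
      (\<Sum>j=0..m. of_nat ((m + k - 1) choose (m - j)) * r ^ (k + j - 1) / fact j *
         poincare_F \<Gamma> (k + 2 * m) z0 n (of_nat k / 2 + of_nat j))"
  proof (rule sum.cong[OF refl])
    fix j
    have "k + j - 1 = (k - 1) + j" using assms by simp
    then show "r ^ (k - 1) * r ^ j * a j = of_nat ((m + k - 1) choose (m - j)) * r ^ (k + j - 1) / fact j *
         poincare_F \<Gamma> (k + 2 * m) z0 n (of_nat k / 2 + of_nat j)"
      by (simp add: a_def power_add mult_ac)
  qed
  finally show ?thesis
    by (simp add: r_def b_def)
qed

end
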